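(* For every finite-dimensional complex symplectic vector space $V = \mathbb C^{2n}$ ($n\ge1$), the complex manifold $\mathcal L(V)$ of all Lagrangian splittings of $V$ has the density property.
   Context: $V = \mathbb C^{2n}$ carries the symplectic form $\langle x,y\rangle = x^t J y$ with $J = \begin{pmatrix}0&-I\\ I&0\end{pmatrix}$, and $Sp(2n,\mathbb C)=\{g : g^tJg=J\}$. A Lagrangian subspace is a maximal isotropic subspace (dimension $n$). $\mathcal L(V)$ is the set of ordered pairs $(L_1,L_2)$ of Lagrangian subspaces with $V = L_1\oplus L_2$; $Sp(2n,\mathbb C)$ acts transitively on it, and $\mathcal L(V)$ is given the complex structure of $Sp(2n,\mathbb C)/L$, where $L$ is the stabilizer of the pair $(\mathrm{span}(e_1,\dots,e_n),\mathrm{span}(e_{n+1},\dots,e_{2n}))$; equivalently, $\mathcal L(V)$ is identified with the (closed) orbit of $\begin{pmatrix} I&0\\0&-I\end{pmatrix}$ under conjugation by $Sp(2n,\mathbb C)$. The density property: the Lie algebra generated by complete holomorphic vector fields is dense (locally uniform topology) in the Lie algebra of all holomorphic vector fields. *)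

theory Defs
  imports "HOL-Analysis.Analysis"
begin

text \<open>The ambient space: complex (2n x 2n)-matrices, with rows/columns indexed by
  'n + 'n (first block Inl, second block Inr), flattened to a vector space
  complex ^ (index x index) so that it is a real normed (Euclidean) space.\<close>

type_synonym 'n spmat = "complex ^ (('n + 'n) \<times> ('n + 'n))"

definition csc :: "complex \<Rightarrow> complex ^ 'i \<Rightarrow> complex ^ 'i" where
  "csc c v = (\<chi> i. c * v $ i)"

definition sp_mul :: "'n::finite spmat \<Rightarrow> 'n spmat \<Rightarrow> 'n spmat" where
  "sp_mul A B = (\<chi> ij. \<Sum>k\<in>UNIV. A $ (fst ij, k) * B $ (k, snd ij))"

definition sp_transp :: "'n::finite spmat \<Rightarrow> 'n spmat" where
  "sp_transp A = (\<chi> ij. A $ (snd ij, fst ij))"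

definition sp_id :: "'n::finite spmat" where
  "sp_id = (\<chi> ij. if fst ij = snd ij then 1 else 0)"

definition sp_J :: "'n::finite spmat" where
  "sp_J = (\<chi> ij. case ij of
      (Inl i, Inr j) \<Rightarrow> if i = j then -1 else 0
    | (Inr i, Inl j) \<Rightarrow> if i = j then 1 else 0
    | _ \<Rightarrow> 0)"

definition sp_D :: "'n::finite spmat" where
  "sp_D = (\<chi> ij. case ij of
      (Inl i, Inl j) \<Rightarrow> if i = j then 1 else 0
    | (Inr i, Inr j) \<Rightarrow> if i = j then -1 else 0
    | _ \<Rightarrow> 0)"

definition Sp :: "'n::finite spmat set" where
  "Sp = {g. sp_mul (sp_mul (sp_transp g) sp_J) g = sp_J}"

text \<open>The manifold of Lagrangian splittings, realised as the conjugation orbit of D under Sp.\<close>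
definition LagSplit :: "'n::finite spmat set" where
  "LagSplit = {A. \<exists>g h. g \<in> Sp \<and> sp_mul g h = sp_id \<and> A = sp_mul (sp_mul g sp_D) h}"

definition cholo :: "(complex ^ 'i) set \<Rightarrow> (complex ^ 'i::finite \<Rightarrow> complex ^ 'i) \<Rightarrow> bool" where
  "cholo U F \<longleftrightarrow> (\<forall>x\<in>U. \<exists>L. (F has_derivative L) (at x) \<and> (\<forall>c v. L (csc c v) = csc c (L v)))"

definition tangent_vec :: "(complex ^ 'i) set \<Rightarrow> complex ^ 'i \<Rightarrow> complex ^ 'i::finite \<Rightarrow> bool" where
  "tangent_vec M p v \<longleftrightarrow> (\<exists>\<gamma> :: real \<Rightarrow> complex ^ 'i. \<gamma> 0 = p \<and> (\<forall>t\<in>{-1<..<1}. \<gamma> t \<in> M)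
      \<and> (\<gamma> has_vector_derivative v) (at 0))"

text \<open>Holomorphic vector fields on a closed complex submanifold M, normalised to vanish off M.\<close>
definition hvf :: "(complex ^ 'i::finite) set \<Rightarrow> (complex ^ 'i \<Rightarrow> complex ^ 'i) \<Rightarrow> bool" where
  "hvf M X \<longleftrightarrow> (\<forall>q. q \<notin> M \<longrightarrow> X q = 0) \<and> (\<forall>p\<in>M. tangent_vec M p (X p))
     \<and> (\<forall>p\<in>M. \<exists>U F. open U \<and> p \<in> U \<and> cholo U F \<and> (\<forall>q\<in>U \<inter> M. F q = X q))"

definition complete_hvf :: "(complex ^ 'i::finite) set \<Rightarrow> (complex ^ 'i \<Rightarrow> complex ^ 'i) \<Rightarrow> bool" where
  "complete_hvf M X \<longleftrightarrow> hvf M X \<and> (\<forall>p\<in>M. \<exists>\<gamma> :: complex \<Rightarrow> complex ^ 'i. \<gamma> 0 = p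
      \<and> (\<forall>t. \<gamma> t \<in> M) \<and> (\<forall>t. (\<gamma> has_derivative (\<lambda>s. csc s (X (\<gamma> t)))) (at t)))"

definition bracket_rel :: "(complex ^ 'i::finite) set \<Rightarrow> (complex ^ 'i \<Rightarrow> complex ^ 'i)
     \<Rightarrow> (complex ^ 'i \<Rightarrow> complex ^ 'i) \<Rightarrow> (complex ^ 'i \<Rightarrow> complex ^ 'i) \<Rightarrow> bool" where
  "bracket_rel M X Y Z \<longleftrightarrow> (\<forall>p\<in>M. \<exists>U F G. open U \<and> p \<in> U \<and> cholo U F \<and> cholo U G
      \<and> (\<forall>q\<in>U \<inter> M. F q = X q \<and> G q = Y q)
      \<and> Z p = frechet_derivative G (at p) (X p) - frechet_derivative F (at p) (Y p))"

inductive_set Lie_gen :: "(complex ^ 'i::finite) set \<Rightarrow> (complex ^ 'i \<Rightarrow> complex ^ 'i) set"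
  for M where
  base: "complete_hvf M X \<Longrightarrow> X \<in> Lie_gen M"
| add: "X \<in> Lie_gen M \<Longrightarrow> Y \<in> Lie_gen M \<Longrightarrow> (\<lambda>p. X p + Y p) \<in> Lie_gen M"
| smul: "X \<in> Lie_gen M \<Longrightarrow> (\<lambda>p. csc c (X p)) \<in> Lie_gen M"
| brk: "X \<in> Lie_gen M \<Longrightarrow> Y \<in> Lie_gen M \<Longrightarrow> hvf M Z \<Longrightarrow> bracket_rel M X Y Z \<Longrightarrow> Z \<in> Lie_gen M"

definition density_property :: "(complex ^ 'i::finite) set \<Rightarrow> bool" where
  "density_property M \<longleftrightarrow> (\<forall>Y. hvf M Y \<longrightarrow> (\<forall>K \<epsilon>. compact K \<and> K \<subseteq> M \<and> \<epsilon> > 0 \<longrightarrow>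
      (\<exists>Z\<in>Lie_gen M. \<forall>p\<in>K. norm (Z p - Y p) < \<epsilon>)))"

end

theory Submission
  imports Defs "HOL-Complex_Analysis.Complex_Analysis"
begin

text \<open>
  Let \<open>\<omega>\<close> be the symplectic form, \<open>\<xi>\<^sub>v x = \<omega>(v, x) v\<close> the infinitesimal transvections, \<open>X\<^sub>v\<close> the
  field \<open>A \<mapsto> [\<xi>\<^sub>v, A]\<close> on \<open>M = {A \<in> sp. A\<^sup>2 = 1}\<close>, and \<open>B(u, w)\<close> the function \<open>A \<mapsto> \<omega>(u, A w)\<close>.

  Algebraic part. A multiple \<open>f X\<^sub>v\<close> is complete as soon as \<open>f\<close> is affine along the flow of \<open>X\<^sub>v\<close>.
  For \<open>\<omega>(v, w) = 1\<close> and \<open>a = B(v, w)\<close>, brackets of such fields give \<open>f g W\<close> with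
  \<open>W = B(w, w) X\<^sub>v - B(v, v) X\<^sub>w\<close>, where \<open>f\<close> is invariant under \<open>X\<^sub>v\<close> and \<open>g\<close> under \<open>X\<^sub>w\<close>. The relation
  \<open>A\<^sup>2 = 1\<close> makes \<open>a\<^sup>2\<close> a sum of such products, so the polynomials are \<open>R + a R\<close> with \<open>R\<close> the span of
  these products, and one more bracket puts every polynomial multiple of \<open>B(v, v) W\<close> into the Lie
  algebra. The polynomial multiples contained in the Lie algebra form a module that is normalised by
  the Lie algebra; contracting with \<open>A\<^sup>2 = 1\<close> then shows that it contains each \<open>X\<^sub>u\<close>.

  Analytic part. Every holomorphic field is a combination of the \<open>X\<^sub>u\<close> with holomorphic coefficients, so
  it remains to approximate holomorphic functions \<open>f\<close> on \<open>M\<close> by polynomials on compact sets. Let \<open>\<mu>\<close> be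
  the invariant measure of the compact form \<open>M\<^sub>c\<close>, the hermitian points of \<open>M\<close>. The polynomials
  \<open>p \<mapsto> \<integral> (tr (p q) + 2 n)\<^sup>N f(q) d\<mu>(q)\<close>, suitably normalised, converge to \<open>f\<close>: by analytic
  continuation \<open>\<integral> h d\<mu>\<close> is invariant under the complex group for holomorphic \<open>h\<close>, which moves the
  peak of the kernel from \<open>D\<close> to \<open>p\<close>.
\<close>

text \<open>Transvections are the right generators because \<open>xi v \<cdot> xi v = 0\<close>: the
  orbits of their fields are quadratic in the time parameter, and many of the functions
  \<open>B(u, w)\<close> are constant or affine along them. The obstacle is that other polynomial
  multiples need not be complete, so a missing coefficient has to arise as a derivative. With
  \<open>y = B(v, v)\<close> one has \<open>W(y) = - 2 a y\<close>; this produces the coefficient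
  \<open>a\<close>, and it is why \<open>y\<close> has to be carried in front of \<open>W\<close>.
  On the analytic side the invariant measure is the image of Lebesgue measure under an equivariant
  retraction onto the compact form, given by the matrix sign. Cayley transforms supply rational
  curves that meet both the compact group and the transvections, and analytic continuation runs
  along these. A uniform estimate on a compact set needs group elements of bounded norm carrying
  \<open>D\<close> to \<open>p\<close>; hence \<open>p\<close> is reached by a compact element
  followed by a unipotent one of controlled norm. The same argument shows that the equations
  \<open>star A = - A\<close> and \<open>A \<cdot> A = sp_id\<close> cut out exactly one
  orbit.\<close>

type_synonym 'n spvec = "complex ^ ('n + 'n)"

notation sp_mul (infixl "\<cdot>" 70)

definition mv :: "'n::finite spmat \<Rightarrow> 'n spvec \<Rightarrow> 'n spvec" where
  "mv A x = (\<chi> i. \<Sum>k\<in>UNIV. A $ (i, k) * x $ k)"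

definition om :: "'n::finite spvec \<Rightarrow> 'n spvec \<Rightarrow> complex" where
  "om x y = (\<Sum>i\<in>UNIV. x $ Inr i * y $ Inl i - x $ Inl i * y $ Inr i)"

text \<open>The adjoint with respect to the symplectic form; on \<open>Sp\<close> it is the inverse.\<close>

definition star :: "'n::finite spmat \<Rightarrow> 'n spmat" where
  "star X = - (sp_J \<cdot> sp_transp X \<cdot> sp_J)"

text \<open>The rank-one operator sending \<open>x\<close> to \<open>om v x\<close> times
  \<open>u\<close>. For \<open>u = v\<close> it is the nilpotent generator of the transvections
  along \<open>v\<close>.\<close>

definition rk :: "'n::finite spvec \<Rightarrow> 'n spvec \<Rightarrow> 'n spmat" where
  "rk u v = (\<chi> ij. u $ fst ij * om v (axis (snd ij) 1))"

abbreviation xi :: "'n::finite spvec \<Rightarrow> 'n spmat" where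
  "xi v \<equiv> rk v v"

section \<open>Matrix-vector calculus over coordinatewise complex scalars\<close>

lemma sum_UNIV_Plus:
  fixes f :: "'a::finite + 'b::finite \<Rightarrow> 'c::comm_monoid_add"
  shows "sum f UNIV = (\<Sum>i\<in>UNIV. f (Inl i)) + (\<Sum>i\<in>UNIV. f (Inr i))"
  using sum.Plus[of "UNIV::'a set" "UNIV::'b set" f] by (simp add: UNIV_Plus_UNIV comp_def)

lemma csc_nth [simp]: "csc c v $ i = c * v $ i"
  by (simp add: csc_def)

lemma csc_add_right: "csc c (x + y) = csc c x + csc c y"
  and csc_diff_right: "csc c (x - y) = csc c x - csc c y"
  and csc_add_left: "csc (c + d) x = csc c x + csc d x"
  and csc_diff_left: "csc (c - d) x = csc c x - csc d x"
  and csc_minus_right: "csc c (- x) = - csc c x"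
  and csc_minus_left: "csc (- c) x = - csc c x"
  and csc_csc: "csc c (csc d x) = csc (c * d) x"
  by (simp_all add: vec_eq_iff algebra_simps)

lemma csc_simps [simp]: "csc 0 x = 0" "csc 1 x = x" "csc c 0 = 0"
  by (simp_all add: vec_eq_iff)

lemma csc_sum_right: "csc c (\<Sum>i\<in>S. f i) = (\<Sum>i\<in>S. csc c (f i))"
  by (simp add: vec_eq_iff sum_distrib_left)

lemma csc_sum_left: "csc (\<Sum>i\<in>S. f i) x = (\<Sum>i\<in>S. csc (f i) x)"
  by (simp add: vec_eq_iff sum_distrib_right)

lemma scaleR_eq_csc: "r *\<^sub>R x = csc (complex_of_real r) x"
  unfolding vec_eq_iff vector_scaleR_component csc_nth by (simp only: scaleR_conv_of_real simp_thms)

lemma norm_csc: "norm (csc c x) = cmod c * norm (x :: complex ^ 'i::finite)"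
  unfolding norm_vec_def by (simp add: norm_mult L2_set_right_distrib)

lemmas csc_lin = csc_add_right csc_diff_right csc_add_left csc_diff_left
  csc_minus_right csc_minus_left csc_csc

lemma mv_add_right: "mv A (x + y) = mv A x + mv A y"
  and mv_diff_right: "mv A (x - y) = mv A x - mv A y"
  and mv_minus_right: "mv A (- x) = - mv A x"
  and mv_csc_right: "mv A (csc c x) = csc c (mv A x)"
  and mv_add_left: "mv (A + B) x = mv A x + mv B x"
  and mv_diff_left: "mv (A - B) x = mv A x - mv B x"
  and mv_minus_left: "mv (- A) x = - mv A x"
  and mv_csc_left: "mv (csc c A) x = csc c (mv A x)"
  by (simp_all add: mv_def vec_eq_iff algebra_simps sum.distrib sum_subtractf sum_negf sum_distrib_left)

lemma mv_zero [simp]: "mv 0 x = 0" "mv A 0 = 0"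
  by (simp_all add: mv_def vec_eq_iff)

lemma mv_id [simp]: "mv sp_id x = x"
proof -
  have "(if a then 1 else 0) * b = (if a then b else (0::complex))" for a b by simp
  then show ?thesis by (simp add: mv_def sp_id_def vec_eq_iff)
qed

lemma mv_mul: "mv (A \<cdot> B) x = mv A (mv B x)"
proof -
  have "(\<Sum>k\<in>UNIV. (\<Sum>l\<in>UNIV. A $ (i, l) * B $ (l, k)) * x $ k) =
        (\<Sum>l\<in>UNIV. A $ (i, l) * (\<Sum>k\<in>UNIV. B $ (l, k) * x $ k))" for i
    unfolding sum_distrib_left sum_distrib_right by (subst sum.swap) (simp add: mult.assoc)
  then show ?thesis by (simp add: mv_def sp_mul_def vec_eq_iff)
qed

lemmas mv_lin = mv_add_right mv_diff_right mv_minus_right mv_csc_right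
  mv_add_left mv_diff_left mv_minus_left mv_csc_left mv_mul

lemma mv_sum_left: "mv (\<Sum>i\<in>S. f i) x = (\<Sum>i\<in>S. mv (f i) x)"
  by (induction S rule: infinite_finite_induct) (simp_all add: mv_lin)

lemma mv_sum_right: "mv A (\<Sum>i\<in>S. f i) = (\<Sum>i\<in>S. mv A (f i))"
  by (induction S rule: infinite_finite_induct) (simp_all add: mv_lin)

lemma mv_axis: "mv A (axis j 1) $ i = A $ (i, j)"
proof -
  have "a * (if b then 1 else 0) = (if b then a else (0::complex))" for a b by simp
  then show ?thesis by (simp add: mv_def axis_def)
qed

lemma spmat_eqI: "(\<And>x. mv A x = mv B x) \<Longrightarrow> A = B"
  by (metis mv_axis surj_pair vec_eq_iff)

lemma vec_axis_expand: "x = (\<Sum>k\<in>UNIV. csc (x $ k) (axis k 1))"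
proof -
  have "a * (if b then 1 else 0) = (if b then a else (0::complex))" for a b by simp
  then show ?thesis by (simp add: vec_eq_iff axis_def)
qed

lemma sp_mul_assoc: "A \<cdot> B \<cdot> C = A \<cdot> (B \<cdot> C)"
  and sp_mul_add_right: "A \<cdot> (B + C) = A \<cdot> B + A \<cdot> C"
  and sp_mul_diff_right: "A \<cdot> (B - C) = A \<cdot> B - A \<cdot> C"
  and sp_mul_minus_right: "A \<cdot> (- B) = - (A \<cdot> B)"
  and sp_mul_csc_right: "A \<cdot> csc c B = csc c (A \<cdot> B)"
  and sp_mul_add_left: "(A + B) \<cdot> C = A \<cdot> C + B \<cdot> C"
  and sp_mul_diff_left: "(A - B) \<cdot> C = A \<cdot> C - B \<cdot> C"
  and sp_mul_minus_left: "(- A) \<cdot> B = - (A \<cdot> B)"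
  and sp_mul_csc_left: "csc c A \<cdot> B = csc c (A \<cdot> B)"
  by (rule spmat_eqI; simp add: mv_lin)+

lemma sp_mul_simps [simp]: "sp_id \<cdot> A = A" "A \<cdot> sp_id = A" "0 \<cdot> A = 0" "A \<cdot> 0 = 0"
  by (rule spmat_eqI; simp add: mv_lin)+

lemmas spm_lin = sp_mul_assoc sp_mul_add_right sp_mul_diff_right sp_mul_minus_right
  sp_mul_csc_right sp_mul_add_left sp_mul_diff_left sp_mul_minus_left sp_mul_csc_left

lemma sp_mul_sum: "Z \<cdot> (\<Sum>i\<in>S. f i) = (\<Sum>i\<in>S. Z \<cdot> f i)" "(\<Sum>i\<in>S. f i) \<cdot> Z = (\<Sum>i\<in>S. f i \<cdot> Z)"
  by (induction S rule: infinite_finite_induct) (simp_all add: spm_lin)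

section \<open>The symplectic form, its adjoint, and rank-one operators\<close>

lemma om_lin:
  "om (x + y) z = om x z + om y z" "om x (y + z) = om x y + om x z"
  "om (x - y) z = om x z - om y z" "om x (y - z) = om x y - om x z"
  "om (- x) y = - om x y" "om x (- y) = - om x y"
  "om (csc c x) y = c * om x y" "om x (csc c y) = c * om x y"
  by (simp_all add: om_def algebra_simps sum.distrib sum_subtractf sum_negf sum_distrib_left)

lemma om_zero [simp]: "om 0 x = 0" "om x 0 = 0"
  by (simp_all add: om_def)

lemma om_self [simp]: "om x x = 0"
  by (simp add: om_def mult.commute)

lemma om_skew: "om x y = - om y x"
  by (simp add: om_def sum_negf[symmetric] algebra_simps)

lemma om_sum_right: "om x (\<Sum>i\<in>S. f i) = (\<Sum>i\<in>S. om x (f i))"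
  by (induction S rule: infinite_finite_induct) (simp_all add: om_lin)

lemma om_sum_left: "om (\<Sum>i\<in>S. f i) x = (\<Sum>i\<in>S. om (f i) x)"
  by (induction S rule: infinite_finite_induct) (simp_all add: om_lin)

text \<open>The vector that represents the coordinate functional \<open>i\<close> through
  \<open>om\<close>; entries thereby become values of the symplectic form.\<close>

definition dual :: "'n::finite + 'n \<Rightarrow> 'n spvec" where
  "dual i = (case i of Inl k \<Rightarrow> axis (Inr k) 1 | Inr k \<Rightarrow> - axis (Inl k) 1)"

lemma om_dual: "om (dual i) x = x $ i"
proof -
  have e: "(if b then 1 else 0) * a = (if b then a else (0::complex))" for a b by simp
  show ?thesis
    by (cases i) (simp_all add: dual_def om_def axis_def e sum_subtractf sum_negf)
qed

lemma om_nondegenerate: "(\<And>x. om x y = om x z) \<Longrightarrow> y = z"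
  by (metis om_dual vec_eq_iff)

lemma exists_om_one: "x \<noteq> 0 \<Longrightarrow> \<exists>w. om x w = 1"
proof -
  assume "x \<noteq> 0"
  then obtain i where i: "x $ i \<noteq> 0" by (metis vec_eq_iff zero_index)
  have "om x (csc (- 1 / x $ i) (dual i)) = 1"
    using i om_dual[of i x] by (simp add: om_lin om_skew[of x "dual i"])
  then show ?thesis by blast
qed

lemma mv_J: "mv sp_J x $ Inl i = - x $ Inr i" "mv sp_J x $ Inr i = x $ Inl i"
proof -
  have e: "(if b then 1 else 0) * a = (if b then a else (0::complex))" 
    "(if b then - 1 else 0) * a = (if b then - a else (0::complex))" for a b by simp_all
  show "mv sp_J x $ Inl i = - x $ Inr i" "mv sp_J x $ Inr i = x $ Inl i"
    by (simp_all add: mv_def sp_J_def sum_UNIV_Plus e)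
qed

lemma J_J: "sp_J \<cdot> sp_J = (- sp_id :: 'n::finite spmat)"
proof (rule spmat_eqI)
  fix x :: "'n spvec"
  have "mv sp_J (mv sp_J x) $ i = - x $ i" for i by (cases i) (simp_all add: mv_J)
  then show "mv (sp_J \<cdot> sp_J) x = mv (- sp_id) x"
    by (simp add: mv_lin vec_eq_iff)
qed

lemma om_J: "om x y = (\<Sum>i\<in>UNIV. x $ i * mv sp_J y $ i)"
  by (simp add: om_def sum_UNIV_Plus mv_J sum_subtractf sum_negf)

lemma sum_transp: "(\<Sum>i\<in>UNIV. mv (sp_transp X) x $ i * y $ i) = (\<Sum>i\<in>UNIV. x $ i * mv X y $ i)"
  unfolding mv_def sp_transp_def
  by (simp add: sum_distrib_left sum_distrib_right, subst sum.swap) (simp add: mult_ac)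

lemma om_star: "om (mv X x) y = om x (mv (star X) y)"
proof -
  have JJ: "mv sp_J (mv sp_J z) = - z" for z :: "'a spvec"
    using J_J[where 'n='a] by (metis mv_id mv_minus_left mv_mul)
  have "om (mv X x) y = (\<Sum>i\<in>UNIV. mv (sp_transp X) (mv sp_J y) $ i * x $ i)"
    unfolding om_J sum_transp by (simp add: mult.commute)
  also have "\<dots> = om x (mv (star X) y)"
    by (simp add: om_J star_def mv_lin JJ mult.commute)
  finally show ?thesis .
qed

text \<open>Nondegeneracy of \<open>om\<close> determines the adjoint, so the rules for
  \<open>star\<close> follow from computations with vectors instead of matrix entries.\<close>

lemma star_unique: "(\<And>x y. om (mv X x) y = om x (mv Y y)) \<Longrightarrow> star X = Y"
  by (metis om_star om_nondegenerate spmat_eqI)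

lemma star_star [simp]: "star (star X) = X"
  by (rule star_unique) (metis om_skew om_star)

lemma star_mul: "star (X \<cdot> Y) = star Y \<cdot> star X"
  and star_add: "star (X + Y) = star X + star Y"
  and star_diff: "star (X - Y) = star X - star Y"
  and star_minus: "star (- X) = - star X"
  and star_csc: "star (csc c X) = csc c (star X)"
  and star_id [simp]: "star sp_id = sp_id"
  and star_zero [simp]: "star 0 = 0"
  by (rule star_unique; simp add: mv_lin om_lin om_star)+

lemmas star_lin = star_mul star_add star_diff star_minus star_csc

lemma star_sum: "star (\<Sum>i\<in>S. f i) = (\<Sum>i\<in>S. star (f i))"
  by (induction S rule: infinite_finite_induct) (simp_all add: star_lin)

lemma mv_rk: "mv (rk u v) x = csc (om v x) u"
proof -
  have "(\<Sum>k\<in>UNIV. om v (axis k 1) * x $ k) = om v x"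
    by (subst (2) vec_axis_expand[of x]) (simp add: om_sum_right om_lin mult.commute)
  then show ?thesis
    by (simp add: mv_def rk_def vec_eq_iff mult.assoc flip: sum_distrib_left)
qed

lemma star_rk: "star (rk u v) = - rk v u"
  by (rule star_unique) (simp add: mv_lin mv_rk om_lin, metis om_skew mult.commute mult_minus_left)

lemma rk_lin: "rk (u + u') v = rk u v + rk u' v" "rk u (v + v') = rk u v + rk u v'"
  "rk (csc c u) v = csc c (rk u v)" "rk u (csc c v) = csc c (rk u v)"
  by (rule spmat_eqI; simp add: mv_lin mv_rk om_lin csc_lin mult.commute)+

lemma rk_mul: "rk a b \<cdot> rk c d = csc (om b c) (rk a d)"
  by (rule spmat_eqI) (simp add: mv_lin mv_rk csc_lin om_lin mult.commute)

lemma mul_rk: "X \<cdot> rk a b = rk (mv X a) b" "rk a b \<cdot> X = rk a (mv (star X) b)"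
  by (rule spmat_eqI; simp add: mv_lin mv_rk om_star)+

section \<open>The symplectic group and its conjugation action\<close>

lemma Sp_iff: "g \<in> Sp \<longleftrightarrow> star g \<cdot> g = sp_id"
proof -
  have "sp_J \<cdot> (sp_transp g \<cdot> sp_J \<cdot> g) = - (star g \<cdot> g)"
    by (simp add: star_def spm_lin)
  then have "star g \<cdot> g = sp_id \<longleftrightarrow> sp_J \<cdot> (sp_transp g \<cdot> sp_J \<cdot> g) = sp_J \<cdot> sp_J"
    by (simp add: J_J)
  also have "\<dots> \<longleftrightarrow> sp_transp g \<cdot> sp_J \<cdot> g = sp_J"
  proof
    assume "sp_J \<cdot> (sp_transp g \<cdot> sp_J \<cdot> g) = sp_J \<cdot> sp_J"
    then have "sp_J \<cdot> (sp_J \<cdot> (sp_transp g \<cdot> sp_J \<cdot> g)) = sp_J \<cdot> (sp_J \<cdot> sp_J)" by simp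
    then show "sp_transp g \<cdot> sp_J \<cdot> g = sp_J"
      by (simp add: J_J spm_lin flip: sp_mul_assoc)
  qed simp
  finally show ?thesis by (simp add: Sp_def)
qed

definition to_mat :: "'n::finite spmat \<Rightarrow> complex ^ ('n + 'n) ^ ('n + 'n)" where
  "to_mat A = (\<chi> i j. A $ (i, j))"

lemma to_mat_mul: "to_mat (A \<cdot> B) = to_mat A ** to_mat B"
  by (simp add: to_mat_def sp_mul_def matrix_matrix_mult_def vec_eq_iff)

lemma to_mat_id: "to_mat sp_id = mat 1"
  by (simp add: to_mat_def sp_id_def mat_def vec_eq_iff)

lemma to_mat_inject: "to_mat A = to_mat B \<longleftrightarrow> A = B"
  by (auto simp: to_mat_def vec_eq_iff)

lemma to_mat_mv: "to_mat A *v x = mv A x"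
  by (simp add: to_mat_def mv_def matrix_vector_mult_def vec_eq_iff)

lemma to_mat_surj: "\<exists>A. to_mat A = B"
  by (rule exI[of _ "\<chi> ij. B $ fst ij $ snd ij"]) (simp add: to_mat_def vec_eq_iff)

lemma sp_inverse_commute: "A \<cdot> B = sp_id \<Longrightarrow> B \<cdot> A = sp_id"
  by (metis matrix_left_right_inverse to_mat_id to_mat_inject to_mat_mul)

lemma sp_inverse_exists:
  assumes "\<And>x. mv A x = 0 \<Longrightarrow> x = 0"
  shows "\<exists>B. A \<cdot> B = sp_id \<and> B \<cdot> A = sp_id"
proof -
  have "inj ((*v) (to_mat A))"
    unfolding inj_def to_mat_mv by (metis assms mv_diff_right right_minus_eq)
  then obtain B where "B ** to_mat A = mat 1"
    using matrix_left_invertible_injective by blast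
  then show ?thesis
    by (metis sp_inverse_commute to_mat_id to_mat_inject to_mat_mul to_mat_surj)
qed

lemma Sp_iff': "g \<in> Sp \<longleftrightarrow> star g \<cdot> g = sp_id \<and> g \<cdot> star g = sp_id"
  using Sp_iff sp_inverse_commute by blast

lemma Sp_mul: "g \<in> Sp \<Longrightarrow> h \<in> Sp \<Longrightarrow> g \<cdot> h \<in> Sp"
proof -
  assume "g \<in> Sp" "h \<in> Sp"
  then have "star h \<cdot> (star g \<cdot> g) \<cdot> h = sp_id" by (simp add: Sp_iff)
  then show ?thesis by (simp add: Sp_iff star_lin spm_lin)
qed

lemma Sp_star: "g \<in> Sp \<Longrightarrow> star g \<in> Sp"
  by (simp add: Sp_iff')

lemma sp_id_in_Sp [simp]: "sp_id \<in> Sp"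
  by (simp add: Sp_iff)

definition act :: "'n::finite spmat \<Rightarrow> 'n spmat \<Rightarrow> 'n spmat" where
  "act g A = g \<cdot> A \<cdot> star g"

lemma act_act: "act g (act h A) = act (g \<cdot> h) A"
  by (simp add: act_def spm_lin star_lin)

lemma act_id [simp]: "act sp_id A = A"
  by (simp add: act_def)

lemma act_mul: "g \<in> Sp \<Longrightarrow> act g A \<cdot> act g B = act g (A \<cdot> B)"
  by (simp add: act_def Sp_iff spm_lin) (metis Sp_iff sp_mul_assoc sp_mul_simps(1))

text \<open>The orbit described by equations: for an involution in the symplectic Lie algebra both
  eigenspaces are isotropic, hence Lagrangian. Only one inclusion is available at first; equality is
  \<open>LagSplit_eq\<close>, after transitivity has been proved through the compact form.\<close>

definition LagSplit' :: "'n::finite spmat set" where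
  "LagSplit' = {A. star A = - A \<and> A \<cdot> A = sp_id}"

lemma mv_D: "mv sp_D x $ Inl i = x $ Inl i" "mv sp_D x $ Inr i = - x $ Inr i"
proof -
  have e: "(if b then 1 else 0) * a = (if b then a else (0::complex))" 
    "(if b then - 1 else 0) * a = (if b then - a else (0::complex))" for a b by simp_all
  show "mv sp_D x $ Inl i = x $ Inl i" "mv sp_D x $ Inr i = - x $ Inr i"
    by (simp_all add: mv_def sp_D_def sum_UNIV_Plus e)
qed

lemma star_D: "star sp_D = - sp_D"
  by (rule star_unique) (simp add: om_def mv_lin mv_D)

lemma D_D: "sp_D \<cdot> sp_D = (sp_id :: 'n::finite spmat)"
proof (rule spmat_eqI)
  fix x :: "'n spvec"
  have "mv sp_D (mv sp_D x) $ i = x $ i" for i by (cases i) (simp_all add: mv_D)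
  then show "mv (sp_D \<cdot> sp_D) x = mv sp_id x"
    by (simp add: mv_lin vec_eq_iff)
qed

lemma D_in: "sp_D \<in> LagSplit'"
  by (simp add: LagSplit'_def D_D star_D)

lemma act_in: "g \<in> Sp \<Longrightarrow> A \<in> LagSplit' \<Longrightarrow> act g A \<in> LagSplit'"
proof -
  assume g: "g \<in> Sp" and A: "A \<in> LagSplit'"
  have "act g A \<cdot> act g A = sp_id"
    using act_mul[OF g, of A A] A g by (simp add: LagSplit'_def act_def Sp_iff')
  moreover have "star (act g A) = - act g A"
    using A by (simp add: LagSplit'_def act_def star_lin spm_lin)
  ultimately show ?thesis by (simp add: LagSplit'_def)
qed

lemma LagSplit_eq_orbit: "LagSplit = {act g sp_D |g. g \<in> Sp}"
proof -
  have "h = star g" if "g \<in> Sp" "g \<cdot> h = sp_id" for g h :: "'n::finite spmat"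
    using that by (metis Sp_iff sp_mul_assoc sp_mul_simps(1,2))
  then show ?thesis
    by (auto simp: LagSplit_def act_def Sp_iff')
qed

lemma LagSplit_subset: "LagSplit \<subseteq> LagSplit'"
  by (auto simp: LagSplit_eq_orbit intro: act_in D_in)

lemma D_in_LagSplit: "sp_D \<in> LagSplit"
  by (metis (mono_tags, lifting) LagSplit_eq_orbit act_id mem_Collect_eq sp_id_in_Sp)

lemma act_in_LagSplit: "g \<in> Sp \<Longrightarrow> A \<in> LagSplit \<Longrightarrow> act g A \<in> LagSplit"
  by (auto simp: LagSplit_eq_orbit act_act intro: Sp_mul)

section \<open>Transvections and the expansion of the symplectic Lie algebra\<close>

definition transv :: "'n::finite spvec \<Rightarrow> complex \<Rightarrow> 'n spmat" where
  "transv v s = sp_id + csc s (xi v)"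

lemma star_xi: "star (xi v) = - xi v"
  by (rule star_rk)

lemma xi_xi [simp]: "xi v \<cdot> xi v = 0"
  by (simp add: rk_mul)

lemma star_transv: "star (transv v s) = transv v (- s)"
  by (simp add: transv_def star_lin star_xi csc_lin)

lemma transv_mul: "transv v s \<cdot> transv v t = transv v (s + t)"
  by (simp add: transv_def spm_lin csc_lin)

lemma transv_zero [simp]: "transv v 0 = sp_id"
  by (simp add: transv_def)

lemma transv_Sp: "transv v s \<in> Sp"
  by (simp add: Sp_iff star_transv transv_mul)

lemma mv_transv: "mv (transv v s) x = x + csc (s * om v x) v"
  by (simp add: transv_def mv_lin mv_rk csc_lin)

lemma xi_csc: "xi (csc c v) = csc (c\<^sup>2) (xi v)"
  by (simp add: rk_lin csc_lin power2_eq_square)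

text \<open>As \<open>xi\<close> is quadratic in its vector, the parameter can be absorbed there.
  Invariance of the integral then has to be shown for parameter 1 only.\<close>

lemma transv_csqrt: "transv v s = transv (csc (csqrt s) v) 1"
  by (simp add: transv_def xi_csc)

text \<open>An explicit expansion in symmetrised rank-one operators. Its coefficients are linear in
  \<open>X\<close>, so they stay holomorphic when \<open>X\<close> depends holomorphically on a
  point.\<close>

lemma sp_decomp:
  fixes X :: "'a::finite spmat"
  assumes "star X = - X"
  shows "X = (\<Sum>k\<in>UNIV. \<Sum>j\<in>UNIV. csc (- mv X (dual k) $ j / 2) (rk (axis j 1) (axis k 1) + rk (axis k 1) (axis j 1)))"
proof -
  have e1: "(\<Sum>k\<in>UNIV. rk (mv X (dual k)) (axis k 1)) = - X"
  proof (rule spmat_eqI)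
    fix x :: "'a spvec"
    have "om y (\<Sum>k\<in>UNIV. csc (om (axis k 1) x) (dual k)) = - om y x" for y
    proof -
      have "om y (\<Sum>k\<in>UNIV. csc (om (axis k 1) x) (dual k)) = - (\<Sum>k\<in>UNIV. om (dual k) y * om (axis k 1) x)"
        by (simp add: om_sum_right om_lin om_skew[of y "dual _"] sum_negf mult.commute)
      also have "(\<Sum>k\<in>UNIV. om (dual k) y * om (axis k 1) x) = om y x"
        using om_sum_left[of "\<lambda>k. csc (y $ k) (axis k 1)" UNIV x] unfolding vec_axis_expand[of y, symmetric]
        by (simp add: om_dual om_lin)
      finally show ?thesis .
    qed
    then have "(\<Sum>k\<in>UNIV. csc (om (axis k 1) x) (dual k)) = - x"
      by (intro om_nondegenerate) (simp add: om_lin)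
    moreover have "mv (\<Sum>k\<in>UNIV. rk (mv X (dual k)) (axis k 1)) x = mv X (\<Sum>k\<in>UNIV. csc (om (axis k 1) x) (dual k))"
      by (simp add: mv_sum_left mv_sum_right mv_rk mv_lin)
    ultimately show "mv (\<Sum>k\<in>UNIV. rk (mv X (dual k)) (axis k 1)) x = mv (- X) x"
      by (simp add: mv_lin)
  qed
  \<comment> \<open>The adjoint exchanges the two factors of \<open>rk\<close>. This gives a second
    expansion of \<open>- X\<close>, and the mean of the two is symmetric.\<close>
  have "star (\<Sum>k\<in>UNIV. rk (mv X (dual k)) (axis k 1)) = - (\<Sum>k\<in>UNIV. rk (axis k 1) (mv X (dual k)))"
    by (simp add: star_sum star_rk sum_negf)
  then have "- (\<Sum>k\<in>UNIV. rk (axis k 1) (mv X (dual k))) = X"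
    unfolding e1 star_minus assms by simp
  then have e2: "(\<Sum>k\<in>UNIV. rk (axis k 1) (mv X (dual k))) = - X"
    by (rule minus_equation_iff[THEN iffD1, symmetric])
  have a: "(\<Sum>j\<in>UNIV. csc (u $ j) (rk (axis j 1) v)) = rk u v" for u v :: "'a spvec"
  proof (rule spmat_eqI)
    fix x
    have "mv (\<Sum>j\<in>UNIV. csc (u $ j) (rk (axis j 1) v)) x = csc (om v x) (\<Sum>j\<in>UNIV. csc (u $ j) (axis j 1))"
      by (simp add: mv_sum_left mv_rk mv_lin csc_sum_right csc_csc mult.commute)
    then show "mv (\<Sum>j\<in>UNIV. csc (u $ j) (rk (axis j 1) v)) x = mv (rk u v) x"
      by (simp only: vec_axis_expand[symmetric] mv_rk)
  qed
  have b: "(\<Sum>j\<in>UNIV. csc (v $ j) (rk u (axis j 1))) = rk u v" for u v :: "'a spvec"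
  proof (rule spmat_eqI)
    fix x
    have "mv (\<Sum>j\<in>UNIV. csc (v $ j) (rk u (axis j 1))) x = csc (om (\<Sum>j\<in>UNIV. csc (v $ j) (axis j 1)) x) u"
      by (simp add: mv_sum_left mv_rk mv_lin csc_sum_left om_sum_left om_lin csc_csc)
    then show "mv (\<Sum>j\<in>UNIV. csc (v $ j) (rk u (axis j 1))) x = mv (rk u v) x"
      by (simp only: vec_axis_expand[symmetric] mv_rk)
  qed
  have "(\<Sum>j\<in>UNIV. csc (- u $ j / 2) (rk (axis j 1) v + rk v (axis j 1))) = csc (-1/2) (rk u v + rk v u)"
    for u v :: "'a spvec"
    unfolding a[of u v, symmetric] b[of u v, symmetric]
    by (simp add: csc_add_right csc_sum_right csc_csc sum.distrib)
  then have "(\<Sum>k\<in>UNIV. \<Sum>j\<in>UNIV. csc (- mv X (dual k) $ j / 2) (rk (axis j 1) (axis k 1) + rk (axis k 1) (axis j 1)))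
     = csc (-1/2) ((\<Sum>k\<in>UNIV. rk (mv X (dual k)) (axis k 1)) + (\<Sum>k\<in>UNIV. rk (axis k 1) (mv X (dual k))))"
    by (simp only: csc_add_right csc_sum_right sum.distrib)
  also have "\<dots> = X"
    unfolding e1 e2 by (simp add: vec_eq_iff)
  finally show ?thesis by (rule sym)
qed

text \<open>Polarisation: statements about the operators \<open>xi v\<close> extend to the whole
  symplectic Lie algebra.\<close>

lemma rk_polar: "rk a b + rk b a = xi (a + b) - xi a - xi b"
  by (simp add: rk_lin)

section \<open>Continuity and differentiation of the matrix operations\<close>

lemma bounded_linear_csc_left: "bounded_linear (\<lambda>c. csc c (x :: complex ^ 'i::finite))"
  by (rule bounded_linear_intro[where K="norm x"])
     (simp_all add: csc_lin norm_csc scaleR_eq_csc scaleR_conv_of_real)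

lemma bounded_bilinear_csc: "bounded_bilinear (csc :: complex \<Rightarrow> complex ^ 'i::finite \<Rightarrow> _)"
  by (unfold_locales)
     (auto simp: csc_lin norm_csc scaleR_eq_csc scaleR_conv_of_real mult.commute intro!: exI[of _ 1])

text \<open>The norm of the flattened matrix is the Hilbert-Schmidt norm, which is submultiplicative
  by the Cauchy-Schwarz inequality.\<close>

lemma norm_sp_mul: "norm (A \<cdot> B) \<le> norm A * norm B"
proof -
  have n: "(norm X)\<^sup>2 = (\<Sum>i\<in>UNIV. \<Sum>j\<in>UNIV. (cmod (X $ (i, j)))\<^sup>2)" for X :: "'a spmat"
    unfolding norm_vec_def L2_set_def
    by (simp add: sum_nonneg sum.cartesian_product flip: UNIV_Times_UNIV)
  have cs: "(cmod (\<Sum>k\<in>UNIV. A $ (i, k) * B $ (k, j)))\<^sup>2 \<le>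
      (\<Sum>k\<in>UNIV. (cmod (A $ (i, k)))\<^sup>2) * (\<Sum>k\<in>UNIV. (cmod (B $ (k, j)))\<^sup>2)" for i j
  proof -
    have "cmod (\<Sum>k\<in>UNIV. A $ (i, k) * B $ (k, j)) \<le> (\<Sum>k\<in>UNIV. cmod (A $ (i, k)) * cmod (B $ (k, j)))"
      by (rule order_trans[OF norm_sum]) (simp add: norm_mult)
    then have "(cmod (\<Sum>k\<in>UNIV. A $ (i, k) * B $ (k, j)))\<^sup>2 \<le> (\<Sum>k\<in>UNIV. cmod (A $ (i, k)) * cmod (B $ (k, j)))\<^sup>2"
      by (rule power_mono) simp
    also have "\<dots> \<le> (\<Sum>k\<in>UNIV. (cmod (A $ (i, k)))\<^sup>2) * (\<Sum>k\<in>UNIV. (cmod (B $ (k, j)))\<^sup>2)"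
      by (rule Cauchy_Schwarz_ineq_sum)
    finally show ?thesis .
  qed
  have "(norm (A \<cdot> B))\<^sup>2 \<le> (\<Sum>i\<in>UNIV. \<Sum>j\<in>UNIV. (\<Sum>k\<in>UNIV. (cmod (A $ (i, k)))\<^sup>2) * (\<Sum>k\<in>UNIV. (cmod (B $ (k, j)))\<^sup>2))"
    unfolding n by (intro sum_mono) (simp add: sp_mul_def cs)
  also have "\<dots> = (norm A)\<^sup>2 * (norm B)\<^sup>2"
    unfolding n[of A] n[of B] sum.swap[of "\<lambda>i j. (cmod (B $ (i, j)))\<^sup>2"] sum_product ..
  finally have "(norm (A \<cdot> B))\<^sup>2 \<le> (norm A * norm B)\<^sup>2" by (simp add: power_mult_distrib)
  then show ?thesis by (rule power2_le_imp_le) simp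
qed

lemma bounded_bilinear_sp_mul: "bounded_bilinear (sp_mul :: 'n::finite spmat \<Rightarrow> _)"
  by unfold_locales
     (auto simp: spm_lin scaleR_eq_csc norm_sp_mul intro!: exI[of _ 1])

lemma bounded_linear_star: "bounded_linear (star :: 'n::finite spmat \<Rightarrow> _)"
  by (intro linear_conv_bounded_linear[THEN iffD1] linearI) (simp_all add: star_lin scaleR_eq_csc)

lemmas has_vector_derivative_sp_mul = bounded_bilinear.has_vector_derivative[OF bounded_bilinear_sp_mul]
lemmas has_vector_derivative_star = bounded_linear.has_vector_derivative[OF bounded_linear_star]

section \<open>Polynomial functions and fields\<close>

definition chol1 :: "(complex ^ 'i) set \<Rightarrow> (complex ^ 'i::finite \<Rightarrow> complex) \<Rightarrow> bool" where
  "chol1 U f \<longleftrightarrow> (\<forall>x\<in>U. \<exists>L. (f has_derivative L) (at x) \<and> (\<forall>c v. L (csc c v) = c * L v))"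

lemma
  assumes f: "chol1 U f" and g: "chol1 U g"
  shows chol1_add: "chol1 U (\<lambda>x. f x + g x)" and chol1_mult: "chol1 U (\<lambda>x. f x * g x)"
proof -
  have "\<exists>L L'. ((\<lambda>A. f A + g A) has_derivative L) (at x) \<and> (\<forall>c v. L (csc c v) = c * L v) \<and>
      ((\<lambda>A. f A * g A) has_derivative L') (at x) \<and> (\<forall>c v. L' (csc c v) = c * L' v)" if "x \<in> U" for x
  proof -
    obtain L1 L2 where L: "(f has_derivative L1) (at x)" "(g has_derivative L2) (at x)"
      "\<And>c v. L1 (csc c v) = c * L1 v" "\<And>c v. L2 (csc c v) = c * L2 v"
      using f g \<open>x \<in> U\<close> unfolding chol1_def by blast
    show ?thesis using has_derivative_add[OF L(1,2)] has_derivative_mult[OF L(1,2)] L(3,4)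
      by (intro exI[of _ "\<lambda>v. L1 v + L2 v"] exI[of _ "\<lambda>v. f x * L2 v + L1 v * g x"]) (simp add: distrib_left mult_ac)
  qed
  then show "chol1 U (\<lambda>x. f x + g x)" "chol1 U (\<lambda>x. f x * g x)"
    unfolding chol1_def by meson+
qed

inductive_set Pol :: "(complex ^ 'i::finite \<Rightarrow> complex) set" where
  const: "(\<lambda>_. c) \<in> Pol"
| coord: "(\<lambda>A. A $ i) \<in> Pol"
| add: "f \<in> Pol \<Longrightarrow> g \<in> Pol \<Longrightarrow> (\<lambda>A. f A + g A) \<in> Pol"
| mult: "f \<in> Pol \<Longrightarrow> g \<in> Pol \<Longrightarrow> (\<lambda>A. f A * g A) \<in> Pol"

lemma Pol_minus: "f \<in> Pol \<Longrightarrow> (\<lambda>A. - f A) \<in> Pol"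
  using Pol.mult[OF Pol.const[of "-1"], of f] by simp

lemma Pol_diff: "f \<in> Pol \<Longrightarrow> g \<in> Pol \<Longrightarrow> (\<lambda>A. f A - g A) \<in> Pol"
  using Pol.add[OF _ Pol_minus, of f g] by simp

lemma Pol_sum: "(\<And>i. i \<in> S \<Longrightarrow> f i \<in> Pol) \<Longrightarrow> (\<lambda>A. \<Sum>i\<in>S. f i A) \<in> Pol"
  by (induction S rule: infinite_finite_induct) (auto intro: Pol.intros)

lemma Pol_power: "f \<in> Pol \<Longrightarrow> (\<lambda>A. f A ^ k) \<in> Pol"
  by (induction k) (auto intro: Pol.intros)

definition dd :: "(complex ^ 'i::finite \<Rightarrow> complex) \<Rightarrow> complex ^ 'i \<Rightarrow> complex ^ 'i \<Rightarrow> complex" where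
  "dd f A = frechet_derivative f (at A)"

lemma dd_eqI: "(f has_derivative L) (at A) \<Longrightarrow> dd f A = L"
  unfolding dd_def by (rule frechet_derivative_at[symmetric])

lemma Pol_chol1: "f \<in> Pol \<Longrightarrow> chol1 UNIV f"
proof (induction rule: Pol.induct)
  case (const c)
  then show ?case unfolding chol1_def by (force intro: has_derivative_const)
next
  case (coord i)
  have "((\<lambda>A. A $ i) has_derivative (\<lambda>v. v $ i)) (at x)" for x :: "complex ^ 'a"
    using bounded_linear_imp_has_derivative[OF bounded_linear_vec_nth] .
  then show ?case unfolding chol1_def by (metis csc_nth)
next
  case (add f g)
  then show ?case by (intro chol1_add)
next
  case (mult f g)
  then show ?case by (intro chol1_mult)
qed

lemma Pol_has_derivative: "f \<in> Pol \<Longrightarrow> (f has_derivative dd f A) (at A)"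
  using Pol_chol1[of f] unfolding chol1_def by (metis UNIV_I dd_eqI)

lemma dd_csc: "f \<in> Pol \<Longrightarrow> dd f A (csc c v) = c * dd f A v"
  using Pol_chol1[of f] unfolding chol1_def by (metis UNIV_I dd_eqI)

lemma dd_const [simp]: "dd (\<lambda>A. c) A v = 0"
  and dd_coord [simp]: "dd (\<lambda>A. A $ i) A v = v $ i"
  using dd_eqI[OF has_derivative_const[of c "at A"]]
    dd_eqI[OF bounded_linear_imp_has_derivative[OF bounded_linear_vec_nth], of i A] by auto

lemma dd_add: "f \<in> Pol \<Longrightarrow> g \<in> Pol \<Longrightarrow> dd (\<lambda>A. f A + g A) A v = dd f A v + dd g A v"
  using dd_eqI[OF has_derivative_add[OF Pol_has_derivative Pol_has_derivative, of f g A]] by simp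

lemma dd_mult: "f \<in> Pol \<Longrightarrow> g \<in> Pol \<Longrightarrow> dd (\<lambda>A. f A * g A) A v = f A * dd g A v + dd f A v * g A"
  using dd_eqI[OF has_derivative_mult[OF Pol_has_derivative Pol_has_derivative, of f g A]] by simp

definition PolF :: "(complex ^ 'i::finite \<Rightarrow> complex ^ 'i) \<Rightarrow> bool" where
  "PolF T \<longleftrightarrow> (\<forall>i. (\<lambda>A. T A $ i) \<in> Pol)"

lemma Pol_dd: "f \<in> Pol \<Longrightarrow> PolF V \<Longrightarrow> (\<lambda>A. dd f A (V A)) \<in> Pol"
proof (induction rule: Pol.induct)
  case (add f g)
  then show ?case by (simp add: dd_add Pol.add)
next
  case (mult f g)
  then show ?case by (simp add: dd_mult Pol.intros)
qed (auto simp: PolF_def intro: Pol.const)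

lemma PolF_add: "PolF T \<Longrightarrow> PolF T' \<Longrightarrow> PolF (\<lambda>A. T A + T' A)"
  and PolF_diff: "PolF T \<Longrightarrow> PolF T' \<Longrightarrow> PolF (\<lambda>A. T A - T' A)"
  and PolF_csc: "f \<in> Pol \<Longrightarrow> PolF T \<Longrightarrow> PolF (\<lambda>A. csc (f A) (T A))"
  by (auto simp: PolF_def intro: Pol.intros Pol_diff)

definition dF :: "(complex ^ 'i::finite \<Rightarrow> complex ^ 'i) \<Rightarrow> complex ^ 'i \<Rightarrow> complex ^ 'i \<Rightarrow> complex ^ 'i" where
  "dF T A v = (\<chi> i. dd (\<lambda>A. T A $ i) A v)"

lemma PolF_has_derivative: "PolF T \<Longrightarrow> (T has_derivative dF T A) (at A)"
proof -
  assume T: "PolF T"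
  have "((\<lambda>A. \<Sum>i\<in>UNIV. csc (T A $ i) (axis i 1)) has_derivative
        (\<lambda>v. \<Sum>i\<in>UNIV. csc (dd (\<lambda>A. T A $ i) A v) (axis i 1))) (at A)"
    using T unfolding PolF_def
    by (intro has_derivative_sum bounded_linear.has_derivative[OF bounded_linear_csc_left] Pol_has_derivative) auto
  moreover have "(\<Sum>i\<in>UNIV. csc (dd (\<lambda>A. T A $ i) A v) (axis i 1)) = dF T A v" for v
    using vec_axis_expand[of "dF T A v"] by (simp add: dF_def)
  ultimately show ?thesis
    by (simp only: vec_axis_expand[symmetric])
qed

lemma PolF_frechet: "PolF T \<Longrightarrow> frechet_derivative T (at A) = dF T A"
  using PolF_has_derivative frechet_derivative_at by metis

lemma PolF_cholo: "PolF T \<Longrightarrow> cholo UNIV T"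
  unfolding cholo_def using PolF_has_derivative
  by (auto intro!: exI[of _ "dF T _"] simp: dF_def vec_eq_iff dd_csc PolF_def)

lemma PolF_dF: "PolF T \<Longrightarrow> PolF V \<Longrightarrow> PolF (\<lambda>A. dF T A (V A))"
  unfolding PolF_def dF_def by (simp add: Pol_dd PolF_def)

lemma dF_csc: "f \<in> Pol \<Longrightarrow> PolF T \<Longrightarrow>
    dF (\<lambda>A. csc (f A) (T A)) A v = csc (dd f A v) (T A) + csc (f A) (dF T A v)"
  by (simp add: dF_def PolF_def vec_eq_iff dd_mult)

lemma dF_csc_right: "PolF T \<Longrightarrow> dF T A (csc c v) = csc c (dF T A v)"
  by (simp add: dF_def PolF_def vec_eq_iff dd_csc)

definition br :: "(complex ^ 'i::finite \<Rightarrow> complex ^ 'i) \<Rightarrow> (complex ^ 'i \<Rightarrow> complex ^ 'i) \<Rightarrow> complex ^ 'i \<Rightarrow> complex ^ 'i" where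
  "br S T A = dF T A (S A) - dF S A (T A)"

lemma PolF_br: "PolF S \<Longrightarrow> PolF T \<Longrightarrow> PolF (br S T)"
  unfolding br_def[abs_def] by (intro PolF_diff PolF_dF)

lemma br_csc_csc:
  assumes "f \<in> Pol" "g \<in> Pol" "PolF S" "PolF T"
  shows "br (\<lambda>A. csc (f A) (S A)) (\<lambda>A. csc (g A) (T A)) A =
    csc (f A * dd g A (S A)) (T A) - csc (g A * dd f A (T A)) (S A) + csc (f A * g A) (br S T A)"
  using assms
  by (simp add: br_def dF_csc dF_csc_right dd_csc vec_eq_iff right_diff_distrib)

section \<open>Tangent vectors\<close>

text \<open>The kernel of the linearised equations of \<open>LagSplit'\<close>. It is linear by
  construction, whereas the velocity vectors of \<open>tangent_vec\<close> are not obviously so; the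
  two notions are shown to agree.\<close>

definition tang :: "'n::finite spmat \<Rightarrow> 'n spmat \<Rightarrow> bool" where
  "tang p V \<longleftrightarrow> star V = - V \<and> p \<cdot> V + V \<cdot> p = 0"

lemma tang_add: "tang p V \<Longrightarrow> tang p W \<Longrightarrow> tang p (V + W)"
  and tang_csc: "tang p V \<Longrightarrow> tang p (csc c V)"
proof -
  show "tang p (V + W)" if "tang p V" "tang p W"
  proof -
    have "p \<cdot> (V + W) + (V + W) \<cdot> p = (p \<cdot> V + V \<cdot> p) + (p \<cdot> W + W \<cdot> p)"
      by (simp add: spm_lin)
    then show ?thesis using that by (simp add: tang_def star_lin)
  qed
  show "tang p (csc c V)" if "tang p V"
  proof -
    have "p \<cdot> csc c V + csc c V \<cdot> p = csc c (p \<cdot> V + V \<cdot> p)"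
      by (simp add: spm_lin csc_lin)
    then show ?thesis using that unfolding tang_def by (simp add: star_csc csc_minus_right)
  qed
qed

lemma zero_deriv_of_const:
  fixes f :: "real \<Rightarrow> 'a::real_normed_vector"
  assumes "(f has_vector_derivative v) (at 0)" "\<And>t. t \<in> {-1<..<1} \<Longrightarrow> f t = c"
  shows "v = 0"
proof -
  have "((\<lambda>t. c) has_vector_derivative v) (at 0)"
    by (rule has_vector_derivative_transform_within_open[OF assms(1), of "{-1<..<1}"]) (use assms(2) in auto)
  then show ?thesis
    using has_vector_derivative_const vector_derivative_unique_at by blast
qed

lemma tangent_vec_imp_tang:
  assumes "tangent_vec LagSplit p V"
  shows "tang p V"
proof -
  from assms obtain \<gamma> where g: "\<gamma> 0 = p" "\<And>t. t \<in> {-1<..<1} \<Longrightarrow> \<gamma> t \<in> LagSplit" "(\<gamma> has_vector_derivative V) (at 0)"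
    unfolding tangent_vec_def by blast
  have m: "star (\<gamma> t) + \<gamma> t = 0" "\<gamma> t \<cdot> \<gamma> t = sp_id" if "t \<in> {-1<..<1}" for t
    using g(2)[OF that] LagSplit_subset by (auto simp: LagSplit'_def)
  have "((\<lambda>t. star (\<gamma> t) + \<gamma> t) has_vector_derivative star V + V) (at 0)"
    by (intro has_vector_derivative_add has_vector_derivative_star g)
  then have "star V + V = 0" using zero_deriv_of_const m(1) by blast
  moreover have "((\<lambda>t. \<gamma> t \<cdot> \<gamma> t) has_vector_derivative \<gamma> 0 \<cdot> V + V \<cdot> \<gamma> 0) (at 0)"
    by (intro has_vector_derivative_sp_mul g)
  then have "\<gamma> 0 \<cdot> V + V \<cdot> \<gamma> 0 = 0" using zero_deriv_of_const m(2) by blast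
  ultimately show ?thesis by (simp add: tang_def g(1) eq_neg_iff_add_eq_0)
qed

text \<open>Velocities at the identity of curves in the group. Pointwise products of curves add
  velocities, so transvections and polarisation yield every element of the Lie algebra.\<close>

definition SpCurve :: "'n::finite spmat \<Rightarrow> bool" where
  "SpCurve V \<longleftrightarrow> (\<exists>g. g 0 = sp_id \<and> (\<forall>t::real. g t \<in> Sp) \<and> (g has_vector_derivative V) (at 0))"

lemma SpCurve_xi: "SpCurve (csc c (xi v))"
proof -
  have "((\<lambda>t. transv v (c * of_real t)) has_vector_derivative csc c (xi v)) (at 0)"
    unfolding transv_def has_vector_derivative_def
    by (auto intro!: derivative_eq_intros bounded_linear.has_derivative[OF bounded_linear_csc_left]
        simp: scaleR_eq_csc csc_lin mult.commute)
  then show ?thesis unfolding SpCurve_def by (intro exI[of _ "\<lambda>t. transv v (c * of_real t)"]) (simp add: transv_Sp)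
qed

lemma SpCurve_add: "SpCurve V \<Longrightarrow> SpCurve W \<Longrightarrow> SpCurve (V + W)"
proof -
  assume "SpCurve V" "SpCurve W"
  then obtain g h where g: "g 0 = sp_id" "\<And>t::real. g t \<in> Sp" "(g has_vector_derivative V) (at 0)"
    "h 0 = sp_id" "\<And>t::real. h t \<in> Sp" "(h has_vector_derivative W) (at 0)" unfolding SpCurve_def by blast
  have "((\<lambda>t. g t \<cdot> h t) has_vector_derivative g 0 \<cdot> W + V \<cdot> h 0) (at 0)"
    by (intro has_vector_derivative_sp_mul g)
  then show ?thesis unfolding SpCurve_def
    by (intro exI[of _ "\<lambda>t. g t \<cdot> h t"]) (simp add: g Sp_mul add.commute)
qed

lemma SpCurve_zero: "SpCurve 0"
  using SpCurve_xi[of 0] by simp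

lemma SpCurve_sum: "(\<And>i. i \<in> S \<Longrightarrow> SpCurve (f i)) \<Longrightarrow> SpCurve (\<Sum>i\<in>S. f i)"
  by (induction S rule: infinite_finite_induct) (auto intro: SpCurve_add SpCurve_zero)

lemma SpCurve_sp: "star X = - X \<Longrightarrow> SpCurve X"
proof -
  assume X: "star X = - X"
  have "SpCurve (csc c (rk a b + rk b a))" for c and a b :: "'a spvec"
  proof -
    have "csc c (rk a b + rk b a) = csc c (xi (a + b)) + csc (- c) (xi a) + csc (- c) (xi b)"
      by (simp add: rk_polar csc_lin)
    then show ?thesis by (metis SpCurve_add SpCurve_xi)
  qed
  then have "SpCurve (\<Sum>k\<in>UNIV. \<Sum>j\<in>UNIV. csc (- mv X (dual k) $ j / 2) (rk (axis j 1) (axis k 1) + rk (axis k 1) (axis j 1)))"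
    by (intro SpCurve_sum)
  then show ?thesis using sp_decomp[OF X] by simp
qed

text \<open>\<open>V\<close> anticommutes with \<open>p\<close> and
  \<open>p \<cdot> p = sp_id\<close>, so \<open>V \<cdot> p / 2\<close> is an explicit preimage of
  \<open>V\<close> under the commutator with \<open>p\<close>. Being linear in \<open>V\<close> and
  polynomial in \<open>p\<close>, it also provides the holomorphic coefficients in
  \<open>cfun\<close>.\<close>

lemma tang_commutator:
  assumes p: "p \<in> LagSplit'" and V: "tang p V"
  shows "star (csc (1/2) (V \<cdot> p)) = - csc (1/2) (V \<cdot> p)"
    "csc (1/2) (V \<cdot> p) \<cdot> p - p \<cdot> csc (1/2) (V \<cdot> p) = V"
proof -
  have pp: "star p = - p" "p \<cdot> p = sp_id" using p by (auto simp: LagSplit'_def)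
  have pV: "p \<cdot> V = - (V \<cdot> p)" using V by (simp add: tang_def eq_neg_iff_add_eq_0)
  show "star (csc (1/2) (V \<cdot> p)) = - csc (1/2) (V \<cdot> p)"
    using V pp pV by (simp add: star_lin spm_lin tang_def csc_lin)
  have "p \<cdot> (V \<cdot> p) = p \<cdot> V \<cdot> p" by (simp add: sp_mul_assoc)
  also have "\<dots> = - V" unfolding pV by (simp add: spm_lin pp)
  finally show "csc (1/2) (V \<cdot> p) \<cdot> p - p \<cdot> csc (1/2) (V \<cdot> p) = V"
    by (simp add: spm_lin pp csc_lin flip: csc_add_left)
qed

lemma tang_imp_tangent_vec:
  assumes p: "p \<in> LagSplit" and V: "tang p V"
  shows "tangent_vec LagSplit p V"
proof -
  define X where "X = csc (1/2) (V \<cdot> p)"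
  note X = tang_commutator[OF subsetD[OF LagSplit_subset p] V, folded X_def]
  obtain g where g: "g 0 = sp_id" "\<And>t::real. g t \<in> Sp" "(g has_vector_derivative X) (at 0)"
    using SpCurve_sp[OF X(1)] unfolding SpCurve_def by blast
  have "((\<lambda>t. g t \<cdot> p \<cdot> star (g t)) has_vector_derivative
      g 0 \<cdot> p \<cdot> star X + (g 0 \<cdot> 0 + X \<cdot> p) \<cdot> star (g 0)) (at 0)"
    by (intro has_vector_derivative_sp_mul has_vector_derivative_star g has_vector_derivative_const)
  then have "((\<lambda>t. act (g t) p) has_vector_derivative V) (at 0)"
    using X by (simp add: act_def g spm_lin)
  then show ?thesis unfolding tangent_vec_def
    by (intro exI[of _ "\<lambda>t. act (g t) p"]) (simp add: g act_in_LagSplit[OF _ p])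
qed

lemma tangent_vec_iff: "p \<in> LagSplit \<Longrightarrow> tangent_vec LagSplit p V \<longleftrightarrow> tang p V"
  using tang_imp_tangent_vec tangent_vec_imp_tang by blast

section \<open>The Lie algebra of polynomial fields\<close>

text \<open>\<open>hvf\<close> asks for the value 0 off the manifold, so a polynomial field is cut
  off before it enters \<open>Lie_gen\<close>. The uncut field remains its holomorphic extension and
  computes brackets.\<close>

definition res :: "('n::finite spmat \<Rightarrow> 'n spmat) \<Rightarrow> 'n spmat \<Rightarrow> 'n spmat" where
  "res T p = (if p \<in> LagSplit then T p else 0)"

lemma hvf_res: "PolF T \<Longrightarrow> (\<And>p. p \<in> LagSplit \<Longrightarrow> tang p (T p)) \<Longrightarrow> hvf LagSplit (res T)"
  unfolding hvf_def
  by (auto simp: res_def tangent_vec_iff intro!: exI[of _ UNIV] exI[of _ T] PolF_cholo)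

lemma Lie_gen_tang: "X \<in> Lie_gen LagSplit \<Longrightarrow> p \<in> LagSplit \<Longrightarrow> tang p (X p)"
  by (induction rule: Lie_gen.induct)
     (auto simp: complete_hvf_def hvf_def tangent_vec_iff intro: tang_add tang_csc)

definition inLie :: "('n::finite spmat \<Rightarrow> 'n spmat) \<Rightarrow> bool" where
  "inLie T \<longleftrightarrow> PolF T \<and> res T \<in> Lie_gen LagSplit"

lemma inLie_cong: "inLie T \<Longrightarrow> PolF T' \<Longrightarrow> (\<And>p. p \<in> LagSplit \<Longrightarrow> T' p = T p) \<Longrightarrow> inLie T'"
proof -
  assume a: "inLie T" "PolF T'" "\<And>p. p \<in> LagSplit \<Longrightarrow> T' p = T p"
  then have "res T' = res T" by (auto simp: res_def)
  then show ?thesis using a by (simp add: inLie_def)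
qed

lemma inLie_add: "inLie S \<Longrightarrow> inLie T \<Longrightarrow> inLie (\<lambda>A. S A + T A)"
proof -
  assume a: "inLie S" "inLie T"
  have "res (\<lambda>A. S A + T A) = (\<lambda>A. res S A + res T A)" by (auto simp: res_def)
  then show ?thesis using a by (simp add: inLie_def Lie_gen.add PolF_add)
qed

lemma inLie_smul: "inLie T \<Longrightarrow> inLie (\<lambda>A. csc c (T A))"
proof -
  assume a: "inLie T"
  have "res (\<lambda>A. csc c (T A)) = (\<lambda>A. csc c (res T A))" by (auto simp: res_def)
  then show ?thesis using a by (simp add: inLie_def Lie_gen.smul PolF_csc Pol.const)
qed

lemma inLie_diff: "inLie S \<Longrightarrow> inLie T \<Longrightarrow> inLie (\<lambda>A. S A - T A)"
  using inLie_add[OF _ inLie_smul[of T "-1"], of S] by (simp add: csc_lin)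

lemma inLie_tang: "inLie T \<Longrightarrow> p \<in> LagSplit \<Longrightarrow> tang p (T p)"
  using Lie_gen_tang[of "res T" p] by (simp add: inLie_def res_def)

text \<open>The tangency equations of \<open>T\<close> are differentiated along a curve with
  velocity \<open>S p\<close>. The derivative of \<open>T\<close> need not be tangent, but the error
  term \<open>S p \<cdot> T p + T p \<cdot> S p\<close> is symmetric in \<open>S\<close> and
  \<open>T\<close> and cancels in the bracket.\<close>

lemma tang_dF:
  assumes "inLie S" "inLie T" "p \<in> LagSplit"
  shows "star (dF T p (S p)) = - dF T p (S p)"
    "S p \<cdot> T p + T p \<cdot> S p + (p \<cdot> dF T p (S p) + dF T p (S p) \<cdot> p) = 0"
proof -
  have "tangent_vec LagSplit p (S p)" using assms by (simp add: tangent_vec_iff inLie_tang)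
  then obtain \<gamma> where g: "\<gamma> 0 = p" "\<And>t. t \<in> {-1<..<1} \<Longrightarrow> \<gamma> t \<in> LagSplit"
      "(\<gamma> has_vector_derivative S p) (at 0)"
    unfolding tangent_vec_def by blast
  have "(T has_derivative dF T (\<gamma> 0)) (at (\<gamma> 0))" using assms by (simp add: inLie_def PolF_has_derivative)
  then have d: "((\<lambda>t. T (\<gamma> t)) has_vector_derivative dF T p (S p)) (at 0)"
    using vector_derivative_diff_chain_within[of \<gamma> "S p" 0 UNIV T "dF T p"] g
    by (auto simp: comp_def intro: has_derivative_at_withinI)
  have m: "star (T (\<gamma> t)) + T (\<gamma> t) = 0" "\<gamma> t \<cdot> T (\<gamma> t) + T (\<gamma> t) \<cdot> \<gamma> t = 0" if "t \<in> {-1<..<1}" for t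
    using inLie_tang[OF assms(2) g(2)[OF that]] by (auto simp: tang_def)
  have "((\<lambda>t. star (T (\<gamma> t)) + T (\<gamma> t)) has_vector_derivative star (dF T p (S p)) + dF T p (S p)) (at 0)"
    by (intro has_vector_derivative_add has_vector_derivative_star d)
  then show "star (dF T p (S p)) = - dF T p (S p)"
    using zero_deriv_of_const m(1) eq_neg_iff_add_eq_0 by blast
  have "((\<lambda>t. \<gamma> t \<cdot> T (\<gamma> t) + T (\<gamma> t) \<cdot> \<gamma> t) has_vector_derivative
      (\<gamma> 0 \<cdot> dF T p (S p) + S p \<cdot> T (\<gamma> 0)) + (T (\<gamma> 0) \<cdot> S p + dF T p (S p) \<cdot> \<gamma> 0)) (at 0)"
    by (intro has_vector_derivative_add has_vector_derivative_sp_mul d g)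
  then have "(\<gamma> 0 \<cdot> dF T p (S p) + S p \<cdot> T (\<gamma> 0)) + (T (\<gamma> 0) \<cdot> S p + dF T p (S p) \<cdot> \<gamma> 0) = 0"
    using zero_deriv_of_const m(2) by blast
  then show "S p \<cdot> T p + T p \<cdot> S p + (p \<cdot> dF T p (S p) + dF T p (S p) \<cdot> p) = 0"
    by (simp add: g(1) algebra_simps)
qed

lemma inLie_br: "inLie S \<Longrightarrow> inLie T \<Longrightarrow> inLie (br S T)"
proof -
  assume a: "inLie S" "inLie T"
  have P: "PolF S" "PolF T" using a by (auto simp: inLie_def)
  have "tang p (br S T p)" if p: "p \<in> LagSplit" for p
  proof -
    note s = tang_dF(1)[OF a p] tang_dF(1)[OF a(2,1) p]
    have "p \<cdot> br S T p + br S T p \<cdot> p =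
      (S p \<cdot> T p + T p \<cdot> S p + (p \<cdot> dF T p (S p) + dF T p (S p) \<cdot> p)) -
      (T p \<cdot> S p + S p \<cdot> T p + (p \<cdot> dF S p (T p) + dF S p (T p) \<cdot> p))"
      by (simp add: br_def spm_lin)
    also have "\<dots> = 0" unfolding tang_dF(2)[OF a p] tang_dF(2)[OF a(2,1) p] by simp
    finally show ?thesis using s by (simp add: tang_def br_def star_lin)
  qed
  then have "hvf LagSplit (res (br S T))" using hvf_res PolF_br[OF P] by blast
  moreover have "bracket_rel LagSplit (res S) (res T) (res (br S T))"
    unfolding bracket_rel_def
    by (intro ballI exI[of _ UNIV] exI[of _ S] exI[of _ T])
       (auto simp: res_def PolF_cholo P PolF_frechet br_def)
  ultimately show ?thesis
    using a by (auto simp: inLie_def PolF_br intro: Lie_gen.brk)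
qed

section \<open>Transvection fields and their complete multiples\<close>

definition xf :: "'n::finite spvec \<Rightarrow> 'n spmat \<Rightarrow> 'n spmat" where
  "xf v A = xi v \<cdot> A - A \<cdot> xi v"

lemma Pol_sp_mul: "(\<And>i. (\<lambda>A. F A $ i) \<in> Pol) \<Longrightarrow> (\<And>i. (\<lambda>A. G A $ i) \<in> Pol) \<Longrightarrow> (\<lambda>A. (F A \<cdot> G A) $ i) \<in> Pol"
  by (simp add: sp_mul_def Pol_sum Pol.mult)

lemma PolF_xf: "PolF (xf v)"
  unfolding PolF_def xf_def vector_minus_component
  by (auto intro!: Pol_diff Pol_sp_mul Pol.intros)

lemma tang_xf: "p \<in> LagSplit' \<Longrightarrow> tang p (xf v p)"
proof -
  assume "p \<in> LagSplit'"
  then have p: "star p = - p" "p \<cdot> p = sp_id" by (auto simp: LagSplit'_def)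
  then have "p \<cdot> (p \<cdot> xi v) = xi v" by (metis sp_mul_assoc sp_mul_simps(1))
  then show ?thesis using p by (simp add: tang_def xf_def star_lin star_xi spm_lin)
qed

lemma act_transv: "act (transv v s) p = p + csc s (xf v p) - csc (s\<^sup>2) (xi v \<cdot> p \<cdot> xi v)"
  unfolding act_def star_transv by (simp add: transv_def spm_lin csc_lin xf_def power2_eq_square)

lemma xf_act_transv: "xf v (act (transv v s) p) = xf v p - csc (2 * s) (xi v \<cdot> p \<cdot> xi v)"
proof -
  have "xi v \<cdot> (xi v \<cdot> X) = 0" for X by (metis sp_mul_assoc xi_xi sp_mul_simps(3))
  then show ?thesis
    by (simp add: act_transv xf_def spm_lin vec_eq_iff algebra_simps)
qed

text \<open>Moving along the transvection curve through \<open>p\<close> reduces the flow to the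
  scalar equation \<open>s' = f p + s * g\<close>. Affinity of \<open>f\<close> makes this equation
  linear, so its solution exists for all complex times.\<close>

lemma inLie_shear:
  assumes f: "f \<in> Pol" and aff: "\<And>A. A \<in> LagSplit \<Longrightarrow> \<exists>g. \<forall>s. f (act (transv v s) A) = f A + s * g"
  shows "inLie (\<lambda>A. csc (f A) (xf v A))"
proof -
  let ?T = "\<lambda>A. csc (f A) (xf v A)"
  have P: "PolF ?T" by (intro PolF_csc f PolF_xf)
  have h: "hvf LagSplit (res ?T)"
    by (rule hvf_res[OF P]) (use LagSplit_subset in \<open>auto intro: tang_csc tang_xf\<close>)
  have "\<exists>\<gamma> :: complex \<Rightarrow> 'a spmat. \<gamma> 0 = p \<and> (\<forall>t. \<gamma> t \<in> LagSplit) \<and>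
      (\<forall>t. (\<gamma> has_derivative (\<lambda>s. csc s (res ?T (\<gamma> t)))) (at t))" if p: "p \<in> LagSplit" for p
  proof -
    from aff[OF p] obtain g where g: "\<And>s. f (act (transv v s) p) = f p + s * g" by blast
    \<comment> \<open>The solution with \<open>s 0 = 0\<close>; for \<open>g = 0\<close> the
      exponential formula degenerates to linear motion.\<close>
    define s where "s t = (if g = 0 then f p * t else f p * (exp (g * t) - 1) / g)" for t
    have s': "(s has_field_derivative f p + s t * g) (at t)" for t
    proof (cases "g = 0")
      case True
      then show ?thesis unfolding s_def by (auto intro!: derivative_eq_intros)
    next
      case False
      then show ?thesis unfolding s_def by (auto intro!: derivative_eq_intros simp: field_simps)
    qed
    define \<gamma> where "\<gamma> t = act (transv v (s t)) p" for t
    have M: "\<gamma> t \<in> LagSplit" for t by (simp add: \<gamma>_def act_in_LagSplit transv_Sp p)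
    have "(\<gamma> has_derivative (\<lambda>h. csc h (?T (\<gamma> t)))) (at t)" for t
    proof -
      have 1: "((\<lambda>t. csc (s t) X) has_derivative (\<lambda>h. csc ((f p + s t * g) * h) X)) (at t)" for X :: "'a spmat"
        using s'[of t] unfolding has_field_derivative_def
        by (rule bounded_linear.has_derivative[OF bounded_linear_csc_left])
      have "((\<lambda>t. (s t)\<^sup>2) has_field_derivative 2 * s t * (f p + s t * g)) (at t)"
        by (auto intro!: derivative_eq_intros s')
      then have 2: "((\<lambda>t. csc ((s t)\<^sup>2) X) has_derivative (\<lambda>h. csc (2 * s t * (f p + s t * g) * h) X)) (at t)" for X :: "'a spmat"
        unfolding has_field_derivative_def
        by (rule bounded_linear.has_derivative[OF bounded_linear_csc_left])
      have "(\<gamma> has_derivative (\<lambda>h. 0 + csc ((f p + s t * g) * h) (xf v p) - csc (2 * s t * (f p + s t * g) * h) (xi v \<cdot> p \<cdot> xi v))) (at t)"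
        unfolding \<gamma>_def act_transv by (intro has_derivative_diff has_derivative_add has_derivative_const 1 2)
      moreover have "csc h (?T (\<gamma> t)) = 0 + csc ((f p + s t * g) * h) (xf v p) - csc (2 * s t * (f p + s t * g) * h) (xi v \<cdot> p \<cdot> xi v)" for h
        by (simp add: \<gamma>_def g xf_act_transv csc_diff_right csc_csc mult_ac)
      ultimately show ?thesis by simp
    qed
    then show ?thesis using M
      by (intro exI[of _ \<gamma>]) (simp add: res_def, simp add: \<gamma>_def s_def)
  qed
  then have "complete_hvf LagSplit (res ?T)" unfolding complete_hvf_def using h by blast
  then show ?thesis by (simp add: inLie_def P Lie_gen.base)
qed

section \<open>Polynomial multiples of the transvection fields\<close>

abbreviation Bf :: "'n::finite spvec \<Rightarrow> 'n spvec \<Rightarrow> 'n spmat \<Rightarrow> complex" where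
  "Bf u w A \<equiv> om u (mv A w)"

lemma Pol_Bf: "(\<lambda>A. Bf u w A) \<in> Pol"
  unfolding om_def mv_def by (auto intro!: Pol_sum Pol_diff Pol.intros)

lemma dd_Bf: "dd (\<lambda>A. Bf u w A) A V = Bf u w V"
proof -
  have "linear (\<lambda>A. Bf u w A)"
    by (rule linearI) (simp_all add: mv_lin om_lin scaleR_eq_csc scaleR_conv_of_real)
  then have "bounded_linear (\<lambda>A. Bf u w A)" by (simp add: linear_conv_bounded_linear)
  then show ?thesis by (metis bounded_linear_imp_has_derivative dd_eqI)
qed

lemma Bf_sym: "A \<in> LagSplit \<Longrightarrow> Bf u w A = Bf w u A"
proof -
  assume "A \<in> LagSplit"
  then have "star A = - A" using LagSplit_subset by (auto simp: LagSplit'_def)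
  then show ?thesis using om_star[of A u w] om_skew[of "mv A u" w] by (simp add: mv_lin om_lin)
qed

lemma LagSplit_sq: "A \<in> LagSplit \<Longrightarrow> mv A (mv A x) = x"
  using LagSplit_subset by (auto simp: LagSplit'_def simp flip: mv_mul)

lemma Bf_xf: "Bf u w (xf v A) = om u v * Bf v w A - om v w * Bf u v A"
  by (simp add: xf_def mv_lin mv_rk om_lin mult.commute)

lemma Bf_act_transv: "Bf u w (act (transv v s) A) = om (u - csc (s * om v u) v) (mv A (w - csc (s * om v w) v))"
proof -
  have "Bf u w (act (transv v s) A) = om (mv (star (transv v s)) u) (mv A (mv (star (transv v s)) w))"
    by (simp add: act_def mv_mul om_star)
  then show ?thesis by (simp add: star_transv mv_transv csc_lin)
qed

definition invar :: "'n::finite spvec \<Rightarrow> ('n spmat \<Rightarrow> complex) \<Rightarrow> bool" where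
  "invar v f \<longleftrightarrow> (\<forall>A\<in>LagSplit. \<forall>s. f (act (transv v s) A) = f A)"

definition affin :: "'n::finite spvec \<Rightarrow> ('n spmat \<Rightarrow> complex) \<Rightarrow> bool" where
  "affin v f \<longleftrightarrow> (\<forall>A\<in>LagSplit. \<exists>g. \<forall>s. f (act (transv v s) A) = f A + s * g)"

lemma invar_mult: "invar v f \<Longrightarrow> invar v g \<Longrightarrow> invar v (\<lambda>A. f A * g A)"
  and invar_const: "invar v (\<lambda>A. c)"
  and invar_affin: "invar v f \<Longrightarrow> affin v f"
  by (auto simp: invar_def affin_def intro!: exI[of _ 0])

lemma affin_mult: "affin v a \<Longrightarrow> invar v f \<Longrightarrow> affin v (\<lambda>A. a A * f A)"
  unfolding invar_def affin_def
proof
  fix A :: "'a spmat" assume a: "\<forall>A\<in>LagSplit. \<exists>g. \<forall>s. a (act (transv v s) A) = a A + s * g"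
     "\<forall>A\<in>LagSplit. \<forall>s. f (act (transv v s) A) = f A" and A: "A \<in> LagSplit"
  then obtain g where "\<And>s. a (act (transv v s) A) = a A + s * g" by blast
  then show "\<exists>g. \<forall>s. a (act (transv v s) A) * f (act (transv v s) A) = a A * f A + s * g"
    using a(2) A by (intro exI[of _ "g * f A"]) (simp add: algebra_simps)
qed

lemma invar_Bf: "om v u = 0 \<Longrightarrow> om v w = 0 \<Longrightarrow> invar v (\<lambda>A. Bf u w A)"
  by (simp add: invar_def Bf_act_transv)

text \<open>The flow of \<open>v\<close> fixes the argument \<open>v\<close> and shifts the other
  one by a multiple of \<open>v\<close>, so time enters linearly.\<close>

lemma affin_Bf: "affin v (\<lambda>A. Bf v w A)" "affin w (\<lambda>A. Bf v w A)"
proof -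
  have "Bf v w (act (transv v s) A) = Bf v w A + s * (- om v w * Bf v v A)"
    "Bf v w (act (transv w s) A) = Bf v w A + s * (- om w v * Bf w w A)" for s A
    by (simp_all add: Bf_act_transv mv_lin om_lin)
  then show "affin v (\<lambda>A. Bf v w A)" "affin w (\<lambda>A. Bf v w A)" unfolding affin_def by blast+
qed

lemma inLie_xf: "f \<in> Pol \<Longrightarrow> affin v f \<Longrightarrow> inLie (\<lambda>A. csc (f A) (xf v A))"
  by (rule inLie_shear) (auto simp: affin_def)

text \<open>In \<open>[f S, a g T] - [a f S, g T]\<close> the terms with \<open>[S, T]\<close> and
  with derivatives of \<open>f\<close> and \<open>g\<close> cancel; only derivatives of
  \<open>a\<close> survive.\<close>

lemma inLie_key:
  assumes P: "f \<in> Pol" "g \<in> Pol" "a \<in> Pol" "PolF S" "PolF T"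
    and L: "inLie (\<lambda>A. csc (f A) (S A))" "inLie (\<lambda>A. csc (a A * g A) (T A))"
      "inLie (\<lambda>A. csc (a A * f A) (S A))" "inLie (\<lambda>A. csc (g A) (T A))"
  shows "inLie (\<lambda>A. csc (f A * g A) (csc (dd a A (S A)) (T A) + csc (dd a A (T A)) (S A)))"
proof (rule inLie_cong[OF inLie_diff[OF inLie_br[OF L(1,2)] inLie_br[OF L(3,4)]]])
  show "PolF (\<lambda>A. csc (f A * g A) (csc (dd a A (S A)) (T A) + csc (dd a A (T A)) (S A)))"
    by (intro PolF_add PolF_csc Pol.mult Pol_dd P)
  fix p
  show "csc (f p * g p) (csc (dd a p (S p)) (T p) + csc (dd a p (T p)) (S p)) =
      br (\<lambda>A. csc (f A) (S A)) (\<lambda>A. csc (a A * g A) (T A)) p -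
      br (\<lambda>A. csc (a A * f A) (S A)) (\<lambda>A. csc (g A) (T A)) p"
    by (simp add: br_csc_csc P Pol.mult dd_mult vec_eq_iff algebra_simps)
qed

text \<open>The largest module over the polynomials inside the Lie algebra.\<close>

definition LieMod :: "('n::finite spmat \<Rightarrow> 'n spmat) \<Rightarrow> bool" where
  "LieMod T \<longleftrightarrow> PolF T \<and> (\<forall>h\<in>Pol. inLie (\<lambda>A. csc (h A) (T A)))"

text \<open>With \<open>X = xf u\<close> the identity is
  \<open>[X, f h T] - [f X, h T] - X(f) h T = h T(f) X\<close>. All polynomial multiples of
  \<open>T\<close> are thus turned into all polynomial multiples of \<open>T(f) X\<close>.\<close>

lemma LieMod_transfer:
  assumes T: "LieMod T" and f: "f \<in> Pol" "affin u f"
  shows "LieMod (\<lambda>A. csc (dd f A (T A)) (xf u A))"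
proof -
  have P: "PolF T" using T by (simp add: LieMod_def)
  have "inLie (\<lambda>A. csc (h A) (csc (dd f A (T A)) (xf u A)))" if h: "h \<in> Pol" for h
  proof -
    have 1: "inLie (\<lambda>A. csc (f A * h A) (T A))" and 2: "inLie (\<lambda>A. csc (h A) (T A))"
      and 3: "inLie (\<lambda>A. csc (dd f A (xf u A) * h A) (T A))"
      using T f h Pol.mult[OF Pol_dd[OF f(1) PolF_xf] h] by (auto simp: LieMod_def intro: Pol.mult)
    have 4: "inLie (\<lambda>A. csc (f A) (xf u A))" using f by (rule inLie_xf)
    \<comment> \<open>The factor 1 is kept visible so that the Leibniz rule
      \<open>br_csc_csc\<close> applies to this field as well.\<close>
    have 5: "inLie (\<lambda>A. csc 1 (xf u A))" by (intro inLie_xf Pol.const invar_affin invar_const)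
    show ?thesis
    proof (rule inLie_cong[OF inLie_diff[OF inLie_diff[OF inLie_br[OF 5 1] inLie_br[OF 4 2]] 3]])
      show "PolF (\<lambda>A. csc (h A) (csc (dd f A (T A)) (xf u A)))"
        by (intro PolF_csc Pol_dd PolF_xf P f h)
      fix p
      show "csc (h p) (csc (dd f p (T p)) (xf u p)) =
         br (\<lambda>A. csc 1 (xf u A)) (\<lambda>A. csc (f A * h A) (T A)) p -
         br (\<lambda>A. csc (f A) (xf u A)) (\<lambda>A. csc (h A) (T A)) p - csc (dd f p (xf u p) * h p) (T p)"
        by (simp add: br_csc_csc P PolF_xf f h Pol.mult Pol.const dd_mult vec_eq_iff algebra_simps del: csc_simps(2))
    qed
  qed
  then show ?thesis by (simp add: LieMod_def PolF_csc Pol_dd PolF_xf P f)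
qed

text \<open>Modulo equality on the manifold this is an ideal of coefficients; the aim of what
  follows is to show that it contains the constant 1.\<close>

definition Idl :: "'n::finite spvec \<Rightarrow> ('n spmat \<Rightarrow> complex) set" where
  "Idl u = {h \<in> Pol. LieMod (\<lambda>A. csc (h A) (xf u A))}"

lemma Idl_iff: "h \<in> Idl u \<longleftrightarrow> h \<in> Pol \<and> (\<forall>g\<in>Pol. inLie (\<lambda>A. csc (g A * h A) (xf u A)))"
  by (auto simp: Idl_def LieMod_def csc_csc intro: PolF_csc PolF_xf)

lemma Idl_add: "f \<in> Idl u \<Longrightarrow> g \<in> Idl u \<Longrightarrow> (\<lambda>A. f A + g A) \<in> Idl u"
proof -
  assume fg: "f \<in> Idl u" "g \<in> Idl u"
  have "inLie (\<lambda>A. csc (h A * (f A + g A)) (xf u A))" if "h \<in> Pol" for h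
    using fg that inLie_add[of "\<lambda>A. csc (h A * f A) (xf u A)" "\<lambda>A. csc (h A * g A) (xf u A)"]
    by (simp add: Idl_iff csc_add_left distrib_left)
  then show ?thesis using fg by (simp add: Idl_iff Pol.add)
qed

lemma Idl_mult: "f \<in> Idl u \<Longrightarrow> g \<in> Pol \<Longrightarrow> (\<lambda>A. g A * f A) \<in> Idl u"
  unfolding Idl_iff by (auto simp: Pol.mult simp flip: mult.assoc)

lemma Idl_cong: "f \<in> Idl u \<Longrightarrow> g \<in> Pol \<Longrightarrow> (\<And>A. A \<in> LagSplit \<Longrightarrow> g A = f A) \<Longrightarrow> g \<in> Idl u"
  unfolding Idl_iff
proof (intro conjI ballI)
  fix h :: "'a spmat \<Rightarrow> complex"
  assume a: "f \<in> Pol \<and> (\<forall>g\<in>Pol. inLie (\<lambda>A. csc (g A * f A) (xf u A)))" "g \<in> Pol" "\<And>A. A \<in> LagSplit \<Longrightarrow> g A = f A"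
    "h \<in> Pol"
  show "inLie (\<lambda>A. csc (h A * g A) (xf u A))"
    by (rule inLie_cong[of "\<lambda>A. csc (h A * f A) (xf u A)"]) (use a in \<open>auto intro: PolF_csc PolF_xf Pol.mult\<close>)
qed

lemma Idl_sum: "finite S \<Longrightarrow> S \<noteq> {} \<Longrightarrow> (\<And>i. i \<in> S \<Longrightarrow> f i \<in> Idl u) \<Longrightarrow> (\<lambda>A. \<Sum>i\<in>S. f i A) \<in> Idl u"
  by (induction S rule: finite_ne_induct) (auto intro: Idl_add)

text \<open>Because \<open>A \<cdot> A = 1\<close>, the vector \<open>w\<close> is a combination, with polynomial coefficients, of the columns of \<open>A\<close>.\<close>

lemma Idl_contract:
  assumes h: "h \<in> Pol" and I: "\<And>u'. (\<lambda>A. h A * Bf v u' A) \<in> Idl u" and v: "v \<noteq> 0"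
  shows "h \<in> Idl u"
proof -
  obtain w where w: "om v w = 1" using exists_om_one[OF v] by blast
  have "(\<lambda>A. \<Sum>k\<in>UNIV. om (dual k) (mv A w) * (h A * Bf v (axis k 1) A)) \<in> Idl u"
    by (rule Idl_sum) (auto intro: Idl_mult I Pol_Bf)
  then show ?thesis
  proof (rule Idl_cong[OF _ h])
    fix A :: "'a spmat" assume A: "A \<in> LagSplit"
    have "(\<Sum>k\<in>UNIV. om (dual k) (mv A w) * (h A * Bf v (axis k 1) A)) =
        h A * om v (mv A (\<Sum>k\<in>UNIV. csc (mv A w $ k) (axis k 1)))"
      by (simp add: om_dual mv_sum_right om_sum_right mv_lin om_lin sum_distrib_left mult_ac)
    also have "\<dots> = h A"
      using A by (simp only: vec_axis_expand[symmetric] LagSplit_sq w) simp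
    finally show "h A = (\<Sum>k\<in>UNIV. om (dual k) (mv A w) * (h A * Bf v (axis k 1) A))" by simp
  qed
qed

inductive_set Rvw :: "'n::finite spvec \<Rightarrow> 'n spvec \<Rightarrow> ('n spmat \<Rightarrow> complex) set" for v w where
  base: "f \<in> Pol \<Longrightarrow> g \<in> Pol \<Longrightarrow> invar v f \<Longrightarrow> invar w g \<Longrightarrow> (\<lambda>A. f A * g A) \<in> Rvw v w"
| add: "f \<in> Rvw v w \<Longrightarrow> g \<in> Rvw v w \<Longrightarrow> (\<lambda>A. f A + g A) \<in> Rvw v w"

lemma Rvw_Pol: "f \<in> Rvw v w \<Longrightarrow> f \<in> Pol"
  by (induction rule: Rvw.induct) (auto intro: Pol.intros)

lemma Rvw_mult_base: "r \<in> Rvw v w \<Longrightarrow> f \<in> Pol \<Longrightarrow> g \<in> Pol \<Longrightarrow> invar v f \<Longrightarrow> invar w g \<Longrightarrow>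
    (\<lambda>A. r A * (f A * g A)) \<in> Rvw v w"
proof (induction rule: Rvw.induct)
  case (base f' g')
  have "(\<lambda>A. (f' A * f A) * (g' A * g A)) \<in> Rvw v w"
    by (intro Rvw.base Pol.mult invar_mult base)
  then show ?case by (simp add: mult_ac)
qed (auto simp: distrib_right intro: Rvw.add)

lemma Rvw_mult: "r \<in> Rvw v w \<Longrightarrow> s \<in> Rvw v w \<Longrightarrow> (\<lambda>A. s A * r A) \<in> Rvw v w"
proof (induction rule: Rvw.induct)
  case (base f g)
  then show ?case by (intro Rvw_mult_base)
qed (auto simp: distrib_left intro: Rvw.add)

lemma Rvw_const: "(\<lambda>A. c) \<in> Rvw v w"
  using Rvw.base[of "\<lambda>A. c" "\<lambda>A. 1" v w] by (simp add: Pol.const invar_const)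

lemma Rvw_left: "f \<in> Pol \<Longrightarrow> invar v f \<Longrightarrow> f \<in> Rvw v w"
  using Rvw.base[of f "\<lambda>A. 1" v w] by (simp add: Pol.const invar_const)

lemma Rvw_right: "f \<in> Pol \<Longrightarrow> invar w f \<Longrightarrow> f \<in> Rvw v w"
  using Rvw.base[of "\<lambda>A. 1" f v w] by (simp add: Pol.const invar_const)

lemma Rvw_sum: "(\<And>i. i \<in> S \<Longrightarrow> f i \<in> Rvw v w) \<Longrightarrow> (\<lambda>A. \<Sum>i\<in>S. f i A) \<in> Rvw v w"
  by (induction S rule: infinite_finite_induct) (auto intro: Rvw.add Rvw_const)

lemma Rvw_scale: "r \<in> Rvw v w \<Longrightarrow> (\<lambda>A. c * r A) \<in> Rvw v w"
  by (rule Rvw_mult) (auto intro: Rvw_const)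

section \<open>Multiples of \<open>W\<close> for a fixed pair \<open>v\<close>, \<open>w\<close>
  with \<open>om v w = 1\<close>\<close>

context
  fixes v w :: "'n::finite spvec"
  assumes vw: "om v w = 1"
begin

private lemma wv: "om w v = - 1"
  using vw om_skew[of w v] by simp

text \<open>The projection onto the symplectic complement of the plane spanned by \<open>v\<close>
  and \<open>w\<close>, with that plane as kernel.\<close>

private definition p0 :: "'n spvec \<Rightarrow> 'n spvec" where
  "p0 u = u - csc (om u w) v + csc (om u v) w"

private lemma p0_orth: "om v (p0 u) = 0" "om w (p0 u) = 0"
  by (simp_all add: p0_def om_lin vw wv om_skew[of u])

private lemma p0_adj: "om (p0 u) x = om u (p0 x)"
  by (simp add: p0_def om_lin om_skew[of x] mult.commute)

private lemma p0_p0: "p0 (p0 u) = p0 u"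
  using p0_orth[of u] om_skew[of "p0 u"] by (simp add: p0_def[of "p0 u"])

private lemma p0_lin: "p0 (\<Sum>k\<in>UNIV. csc (c k) (e k)) = (\<Sum>k\<in>UNIV. csc (c k) (p0 (e k)))"
  by (simp add: p0_def om_sum_left om_lin csc_lin csc_add_right csc_diff_right sum.distrib sum_subtractf csc_sum_left)

text \<open>Start from \<open>om v (A (A w)) = 1\<close> and split the inner vector
  \<open>A w\<close> along \<open>v\<close>, \<open>w\<close> and their complement. The plane
  contributes \<open>(Bf v w A)\<^sup>2 - Bf v v A * Bf w w A\<close>; the complement contributes
  products of a factor invariant under \<open>v\<close> with one invariant under
  \<open>w\<close>.\<close>

lemma a_squared: "\<exists>r\<in>Rvw v w. \<forall>A\<in>LagSplit. Bf v w A * Bf v w A = r A"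
proof
  let ?r = "\<lambda>A. 1 + (Bf v v A * Bf w w A + - 1 * (\<Sum>k\<in>UNIV. Bf v (p0 (axis k 1)) A * Bf (p0 (dual k)) w A))"
  show "?r \<in> Rvw v w"
    using p0_orth by (intro Rvw.add Rvw_const Rvw.base Rvw_scale Rvw_sum Pol_Bf invar_Bf) auto
  show "\<forall>A\<in>LagSplit. Bf v w A * Bf v w A = ?r A"
  proof
    fix A :: "'n spmat" assume A: "A \<in> LagSplit"
    have "(\<Sum>k\<in>UNIV. Bf v (p0 (axis k 1)) A * Bf (p0 (dual k)) w A) =
        om v (mv A (\<Sum>k\<in>UNIV. csc (p0 (mv A w) $ k) (p0 (axis k 1))))"
      by (simp add: p0_adj om_dual mv_sum_right mv_lin om_sum_right om_lin mult.commute)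
    also have "(\<Sum>k\<in>UNIV. csc (p0 (mv A w) $ k) (p0 (axis k 1))) = p0 (mv A w)"
      by (simp only: p0_lin[symmetric] vec_axis_expand[symmetric] p0_p0)
    also have "p0 (mv A w) = mv A w + csc (Bf w w A) v - csc (Bf v w A) w"
      by (simp add: p0_def om_skew[of "mv A w"] csc_lin)
    also have "om v (mv A (mv A w + csc (Bf w w A) v - csc (Bf v w A) w)) =
        1 + Bf w w A * Bf v v A - Bf v w A * Bf v w A"
      using A by (simp add: mv_lin om_lin LagSplit_sq vw)
    finally show "Bf v w A * Bf v w A = ?r A" by simp
  qed
qed

private definition Rm :: "('n spmat \<Rightarrow> complex) \<Rightarrow> bool" where
  "Rm h \<longleftrightarrow> (\<exists>r\<in>Rvw v w. \<exists>s\<in>Rvw v w. \<forall>A\<in>LagSplit. h A = r A + Bf v w A * s A)"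

private lemma Rm_Rvw: "r \<in> Rvw v w \<Longrightarrow> Rm r"
  unfolding Rm_def using Rvw_const[of 0] by force

private lemma Rm_add: "Rm f \<Longrightarrow> Rm g \<Longrightarrow> Rm (\<lambda>A. f A + g A)"
proof -
  assume "Rm f" "Rm g"
  then obtain r s r' s' where "r \<in> Rvw v w" "s \<in> Rvw v w" "r' \<in> Rvw v w" "s' \<in> Rvw v w"
    "\<forall>A\<in>LagSplit. f A = r A + Bf v w A * s A" "\<forall>A\<in>LagSplit. g A = r' A + Bf v w A * s' A"
    unfolding Rm_def by blast
  then show ?thesis unfolding Rm_def
    by (intro bexI[of _ "\<lambda>A. r A + r' A"] bexI[of _ "\<lambda>A. s A + s' A"]) (auto simp: algebra_simps intro: Rvw.add)
qed

private lemma Rm_mult: "Rm f \<Longrightarrow> Rm g \<Longrightarrow> Rm (\<lambda>A. f A * g A)"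
proof -
  assume "Rm f" "Rm g"
  then obtain r s r' s' where R: "r \<in> Rvw v w" "s \<in> Rvw v w" "r' \<in> Rvw v w" "s' \<in> Rvw v w"
    "\<forall>A\<in>LagSplit. f A = r A + Bf v w A * s A" "\<forall>A\<in>LagSplit. g A = r' A + Bf v w A * s' A"
    unfolding Rm_def by blast
  obtain q where q: "q \<in> Rvw v w" "\<forall>A\<in>LagSplit. Bf v w A * Bf v w A = q A" using a_squared by blast
  have "f A * g A = (r A * r' A + q A * (s A * s' A)) + Bf v w A * (r A * s' A + s A * r' A)" if "A \<in> LagSplit" for A
    using R(5,6) that by (simp add: q(2)[rule_format, OF that, symmetric] algebra_simps)
  then show ?thesis unfolding Rm_def
    by (intro bexI[of _ "\<lambda>A. r A * r' A + q A * (s A * s' A)"] bexI[of _ "\<lambda>A. r A * s' A + s A * r' A"])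
       (auto intro!: Rvw.add Rvw_mult R q)
qed

text \<open>Split both arguments along \<open>v\<close>, \<open>w\<close> and their complement.
  Every resulting pairing is invariant under \<open>v\<close> or under \<open>w\<close>, except that
  of \<open>v\<close> with \<open>w\<close>, which is the extra generator itself.\<close>

private lemma Rm_Bf: "Rm (\<lambda>A. Bf u u' A)"
proof -
  have e: "u = csc (om u w) v + csc (- om u v) w + p0 u" for u
    by (simp add: p0_def csc_lin)
  have c: "Rm (\<lambda>A. c * f A)" if "Rm f" for c f
    using Rm_mult[OF Rm_Rvw[OF Rvw_const[of c]] that] .
  have 1: "Rm (\<lambda>A. Bf v w A)"
    unfolding Rm_def using Rvw_const[of 0] Rvw_const[of 1] by (force intro: bexI[of _ "\<lambda>_. 0"])
  have 2: "Rm (\<lambda>A. Bf w v A)"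
    using 1 Bf_sym[of _ w v] unfolding Rm_def by simp
  have 3: "Rm (\<lambda>A. Bf x y A)" if "om v x = 0" "om v y = 0" for x y
    by (intro Rm_Rvw Rvw_left Pol_Bf invar_Bf that)
  have 4: "Rm (\<lambda>A. Bf x y A)" if "om w x = 0" "om w y = 0" for x y
    by (intro Rm_Rvw Rvw_right Pol_Bf invar_Bf that)
  have "Rm (\<lambda>A. om (csc a v + csc b w + p0 u) (mv A (csc a' v + csc b' w + p0 u')))" for a b a' b'
    unfolding mv_lin om_lin using p0_orth
    by (intro Rm_add c 1 2) (auto intro: 3 4)
  then show ?thesis using e by metis
qed

lemma Pol_split: "h \<in> Pol \<Longrightarrow> \<exists>r\<in>Rvw v w. \<exists>s\<in>Rvw v w. \<forall>A\<in>LagSplit. h A = r A + Bf v w A * s A"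
proof -
  assume "h \<in> Pol"
  then have "Rm h"
  proof (induction rule: Pol.induct)
    case (coord i)
    have "(\<lambda>A :: 'n spmat. A $ i) = (\<lambda>A. Bf (dual (fst i)) (axis (snd i) 1) A)"
      by (simp add: om_dual mv_axis)
    then show ?case using Rm_Bf by simp
  qed (auto intro: Rm_Rvw Rvw_const Rm_add Rm_mult)
  then show ?thesis by (simp add: Rm_def)
qed

private definition W :: "'n spmat \<Rightarrow> 'n spmat" where
  "W A = csc (Bf w w A) (xf v A) - csc (Bf v v A) (xf w A)"

private lemma PolF_W: "PolF W"
  unfolding W_def by (intro PolF_diff PolF_csc Pol_Bf PolF_xf)

private lemma inLie_Rvw: "r \<in> Rvw v w \<Longrightarrow> inLie (\<lambda>A. csc (r A) (W A))"
proof (induction rule: Rvw.induct)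
  case (base f g)
  \<comment> \<open>The derivative of \<open>Bf v w\<close> is \<open>- Bf v v\<close> along
    \<open>xf v\<close> and \<open>Bf w w\<close> along \<open>xf w\<close>, so the combination from
    \<open>inLie_key\<close> is \<open>W\<close>.\<close>
  have "inLie (\<lambda>A. csc (f A * g A) (csc (dd (\<lambda>A. Bf v w A) A (xf v A)) (xf w A) + csc (dd (\<lambda>A. Bf v w A) A (xf w A)) (xf v A)))"
    by (rule inLie_key) (intro base Pol_Bf PolF_xf inLie_xf Pol.mult affin_mult affin_Bf invar_affin[OF base(3)] invar_affin[OF base(4)])+
  then show ?case
    by (simp add: dd_Bf Bf_xf W_def vw csc_lin)
next
  case (add f g)
  then show ?case using inLie_add by (force simp: csc_add_left)
qed

private lemma dd_W: "A \<in> LagSplit \<Longrightarrow> dd (\<lambda>A. Bf v v A) A (W A) = - 2 * Bf v w A * Bf v v A"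
  using Bf_sym[of A w v]
  by (simp add: dd_Bf W_def mv_lin om_lin Bf_xf vw wv)

lemma LieMod_yW: "LieMod (\<lambda>A. csc (Bf v v A) (W A))"
proof -
  have y: "(\<lambda>A. Bf v v A) \<in> Rvw v w" by (intro Rvw_left Pol_Bf invar_Bf) auto
  have ya: "inLie (\<lambda>A. csc (Bf v v A * (Bf v w A * s A)) (W A))" if s: "s \<in> Rvw v w" for s
  proof -
    have L: "inLie (\<lambda>A. csc (s A) (W A))" "inLie (\<lambda>A. csc (Bf v v A) (W A))" "inLie (\<lambda>A. csc 1 (W A))"
      "inLie (\<lambda>A. csc (Bf v v A * s A) (W A))"
      by (intro inLie_Rvw s y Rvw_const Rvw_mult[of s v w "\<lambda>A. Bf v v A"])+
    note P = Rvw_Pol[OF s] Pol_Bf PolF_W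
    \<comment> \<open>With \<open>y = Bf v v\<close>, the derivatives of \<open>s\<close> cancel in
      \<open>[s W, y W] + [W, y s W]\<close> and \<open>2 s W(y) W\<close> remains. By
      \<open>dd_W\<close> this is \<open>- 4 y a s W\<close> with \<open>a = Bf v w\<close>, whence
      the factor \<open>- 1 / 4\<close>.\<close>
    show ?thesis
    proof (rule inLie_cong[OF inLie_smul[of _ "-1/4", OF inLie_add[OF inLie_br[OF L(1,2)] inLie_br[OF L(3,4)]]]])
      show "PolF (\<lambda>A. csc (Bf v v A * (Bf v w A * s A)) (W A))"
        by (intro PolF_csc Pol.mult P)
      fix p :: "'n spmat" assume "p \<in> LagSplit"
      then show "csc (Bf v v p * (Bf v w p * s p)) (W p) =
         csc (- 1 / 4) (br (\<lambda>A. csc (s A) (W A)) (\<lambda>A. csc (Bf v v A) (W A)) p +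
                 br (\<lambda>A. csc 1 (W A)) (\<lambda>A. csc (Bf v v A * s A) (W A)) p)"
        by (simp add: br_csc_csc P Pol.mult Pol.const dd_mult dd_W vec_eq_iff del: csc_simps(2))
           (simp add: br_def algebra_simps)
    qed
  qed
  have "inLie (\<lambda>A. csc (h A) (csc (Bf v v A) (W A)))" if h: "h \<in> Pol" for h
  proof -
    obtain r s where rs: "r \<in> Rvw v w" "s \<in> Rvw v w" "\<And>A. A\<in>LagSplit \<Longrightarrow> h A = r A + Bf v w A * s A"
      using Pol_split[OF h] by blast
    have "inLie (\<lambda>A. csc (Bf v v A * r A) (W A))"
      by (intro inLie_Rvw Rvw_mult[of r v w "\<lambda>A. Bf v v A"] rs y)
    from inLie_add[OF this ya[OF rs(2)]] show ?thesis
      by (rule inLie_cong) (auto simp: rs(3) csc_lin algebra_simps intro!: PolF_csc Pol.mult h Pol_Bf PolF_W)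
  qed
  then show ?thesis by (simp add: LieMod_def PolF_csc Pol_Bf PolF_W)
qed

text \<open>Transfer from the field \<open>y W\<close> with the function \<open>y = Bf v v\<close>:
  its derivative along \<open>y W\<close> is \<open>- 2 y\<^sup>2 a\<close>, where
  \<open>a = Bf v w\<close>. The target is now a multiple of the single field
  \<open>xf v\<close>.\<close>

lemma Idl_yya: "(\<lambda>A. (Bf v v A)\<^sup>2 * Bf v w A) \<in> Idl v"
proof -
  have "LieMod (\<lambda>A. csc (dd (\<lambda>A. Bf v v A) A (csc (Bf v v A) (W A))) (xf v A))"
    by (rule LieMod_transfer[OF LieMod_yW]) (auto intro: Pol_Bf affin_Bf)
  then have "(\<lambda>A. Bf v v A * dd (\<lambda>A. Bf v v A) A (W A)) \<in> Idl v"
    by (simp add: Idl_def dd_csc Pol_Bf Pol.mult Pol_dd PolF_W)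
  from Idl_mult[OF this Pol.const[of "-1/2"]] show ?thesis
    by (rule Idl_cong) (auto simp: dd_W power2_eq_square intro!: Pol.mult Pol_Bf)
qed

end

section \<open>Lowering the degree of the ideal elements down to the constant 1\<close>

lemma Idl_yy_self:
  assumes v: "v \<noteq> 0"
  shows "(\<lambda>A. (Bf v v A)\<^sup>2) \<in> Idl v"
proof (rule Idl_contract[OF Pol_power[OF Pol_Bf] _ v])
  fix u
  obtain w where w: "om v w = 1" using exists_om_one[OF v] by blast
  \<comment> \<open>Only vectors with \<open>om v w = 1\<close> are admissible; \<open>?w\<close> is
    one of them, and \<open>u = ?w + (om v u - 1) w\<close> recovers an arbitrary
    \<open>u\<close>.\<close>
  let ?w = "w + (u - csc (om v u) w)"
  have w': "om v ?w = 1" by (simp add: om_lin w)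
  have "(\<lambda>A. (Bf v v A)\<^sup>2 * Bf v ?w A + (om v u - 1) * ((Bf v v A)\<^sup>2 * Bf v w A)) \<in> Idl v"
    by (intro Idl_add Idl_mult Idl_yya w w' Pol.const)
  then show "(\<lambda>A. (Bf v v A)\<^sup>2 * Bf v u A) \<in> Idl v"
    by (simp add: mv_lin om_lin algebra_simps)
qed

lemma Idl_yy:
  assumes uv: "om u v \<noteq> 0"
  shows "(\<lambda>A. (Bf v v A)\<^sup>2) \<in> Idl u"
proof -
  have v: "v \<noteq> 0" using uv by auto
  have M: "LieMod (\<lambda>A. csc ((Bf v v A)\<^sup>2) (xf v A))" using Idl_yy_self[OF v] by (simp add: Idl_def)
  have 1: "(\<lambda>A. (Bf v v A)\<^sup>2 * (om u v * Bf v u' A - om v u' * Bf u v A)) \<in> Idl u" for u'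
  proof -
    have "LieMod (\<lambda>A. csc (dd (\<lambda>A. Bf u u' A) A (csc ((Bf v v A)\<^sup>2) (xf v A))) (xf u A))"
      by (rule LieMod_transfer[OF M]) (auto intro: Pol_Bf affin_Bf)
    then show ?thesis
      by (simp add: Idl_def dd_Bf mv_lin om_lin Bf_xf Pol_Bf Pol.mult Pol_diff Pol.const Pol_power)
  qed
  \<comment> \<open>For \<open>u' = u\<close> the two terms of fact \<open>1\<close> coincide,
    because \<open>Bf\<close> is symmetric on the manifold and \<open>om\<close> is skew. This
    isolates \<open>Bf u v\<close>.\<close>
  have 2: "(\<lambda>A. (Bf v v A)\<^sup>2 * Bf u v A) \<in> Idl u"
    by (rule Idl_cong[OF Idl_mult[OF 1[of u] Pol.const[of "1 / (2 * om u v)"]]])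
       (use uv in \<open>auto simp: Bf_sym[of _ v u] om_skew[of v u] intro!: Pol.mult Pol_power Pol_Bf\<close>)
  show ?thesis
  proof (rule Idl_contract[OF Pol_power[OF Pol_Bf] _ v])
    fix u'
    show "(\<lambda>A. (Bf v v A)\<^sup>2 * Bf v u' A) \<in> Idl u"
      by (rule Idl_cong[OF Idl_mult[OF Idl_add[OF 1[of u'] Idl_mult[OF 2 Pol.const[of "om v u'"]]] Pol.const[of "1 / om u v"]]])
         (use uv in \<open>auto simp: algebra_simps intro!: Pol.mult Pol_power Pol_Bf\<close>)
  qed
qed

lemma Bf_pencil:
  assumes "A \<in> LagSplit"
  shows "Bf (a + csc t d) (a + csc t d) A = Bf a a A + 2 * t * Bf a d A + t\<^sup>2 * Bf d d A"
  using Bf_sym[OF assms, of d a] by (simp add: mv_lin om_lin algebra_simps power2_eq_square)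

text \<open>The squares of \<open>Bf (a + t d0) (a + t d0)\<close> lie in the ideal for every
  \<open>t\<close>, since \<open>om u d0 = 0\<close> keeps \<open>om u (a + t d0)\<close> nonzero.
  As a polynomial in \<open>t\<close> the square has linear coefficient
  \<open>4 Bf a a * Bf a d0\<close>; the part of \<open>d\<close> along \<open>a\<close> is added
  back, and contraction removes the second factor.\<close>

lemma Idl_y:
  assumes ua: "om u a \<noteq> 0"
  shows "(\<lambda>A. Bf a a A) \<in> Idl u"
proof (rule Idl_contract[OF Pol_Bf])
  show "a \<noteq> 0" using ua by auto
  fix d
  define d0 where "d0 = d - csc (om u d / om u a) a"
  have d0: "om u d0 = 0" using ua by (simp add: d0_def om_lin)
  define q where "q t A = (Bf (a + csc t d0) (a + csc t d0) A)\<^sup>2" for t A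
  have q: "q t \<in> Idl u" for t
    unfolding q_def by (rule Idl_yy) (simp add: om_lin d0 ua)
  text \<open>The five-point stencil recovers the linear coefficient of a quartic exactly.\<close>
  have "(\<lambda>A. (2 / 12) * q 1 A + ((-2 / 12) * q (-1) A + ((-1/48) * q 2 A + ((1/48) * q (-2) A +
      (om u d / om u a) * (Bf a a A)\<^sup>2)))) \<in> Idl u"
    by (intro Idl_add Idl_mult q Pol.const Idl_yy ua)
  then show "(\<lambda>A. Bf a a A * Bf a d A) \<in> Idl u"
  proof (rule Idl_cong)
    fix A :: "'a spmat" assume A: "A \<in> LagSplit"
    have "Bf a d A = Bf a d0 A + (om u d / om u a) * Bf a a A"
      by (simp add: d0_def mv_lin om_lin)
    then show "Bf a a A * Bf a d A = (2 / 12) * q 1 A + ((-2 / 12) * q (-1) A + ((-1/48) * q 2 A + ((1/48) * q (-2) A +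
      (om u d / om u a) * (Bf a a A)\<^sup>2)))"
      unfolding q_def Bf_pencil[OF A] by (simp add: field_simps power2_eq_square)
  qed (intro Pol.mult Pol_Bf)
qed

text \<open>The same argument one degree lower: the symmetric difference of the quadratic
  \<open>Bf (a + t d0) (a + t d0)\<close> at \<open>t = 1\<close> and \<open>t = - 1\<close> is
  \<open>4 Bf a d0\<close>.\<close>

lemma Idl_one:
  assumes u: "u \<noteq> 0"
  shows "(\<lambda>A. 1) \<in> Idl u"
proof -
  obtain a where ua: "om u a = 1" using exists_om_one[OF u] by blast
  then have a: "a \<noteq> 0" by auto
  have "(\<lambda>A. 1 * Bf a d A) \<in> Idl u" for d
  proof -
    define d0 where "d0 = d - csc (om u d) a"
    have d0: "om u d0 = 0" using ua by (simp add: d0_def om_lin)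
    have q: "(\<lambda>A. Bf (a + csc t d0) (a + csc t d0) A) \<in> Idl u" for t
      by (rule Idl_y) (simp add: om_lin d0 ua)
    have "(\<lambda>A. (1 / 4) * Bf (a + csc 1 d0) (a + csc 1 d0) A + ((-1 / 4) * Bf (a + csc (-1) d0) (a + csc (-1) d0) A +
       om u d * Bf a a A)) \<in> Idl u"
      by (intro Idl_add Idl_mult q Pol.const Idl_y) (simp add: ua)
    then show ?thesis
    proof (rule Idl_cong)
      fix A :: "'a spmat" assume A: "A \<in> LagSplit"
      have "Bf a d A = Bf a d0 A + om u d * Bf a a A"
        by (simp add: d0_def mv_lin om_lin)
      then show "1 * Bf a d A = (1 / 4) * Bf (a + csc 1 d0) (a + csc 1 d0) A + ((-1 / 4) * Bf (a + csc (-1) d0) (a + csc (-1) d0) A +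
       om u d * Bf a a A)"
        unfolding Bf_pencil[OF A] by (simp add: field_simps)
    qed (intro Pol.mult Pol.const Pol_Bf)
  qed
  then show ?thesis using Idl_contract[OF Pol.const[of 1] _ a] by simp
qed

theorem inLie_Pol_xf:
  assumes "h \<in> Pol"
  shows "inLie (\<lambda>A. csc (h A) (xf u A))"
proof (cases "u = 0")
  case True
  then have "(\<lambda>A. csc (h A) (xf u A)) = (\<lambda>A. csc 0 (xf u A))"
    by (auto simp: xf_def rk_def vec_eq_iff sp_mul_def)
  then show ?thesis using inLie_xf[of "\<lambda>_. 0" u] by (simp only: Pol.const invar_affin invar_const)
next
  case False
  from Idl_one[OF this] show ?thesis using assms by (simp add: Idl_iff)
qed

section \<open>The compact form\<close>

definition hin :: "'n::finite spvec \<Rightarrow> 'n spvec \<Rightarrow> complex" where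
  "hin x y = (\<Sum>i\<in>UNIV. cnj (x $ i) * y $ i)"

text \<open>The quaternionic structure; the compact group consists of the symplectic matrices commuting with it.\<close>

definition jj :: "'n::finite spvec \<Rightarrow> 'n spvec" where
  "jj x = (\<chi> i. case i of Inl k \<Rightarrow> cnj (x $ Inr k) | Inr k \<Rightarrow> - cnj (x $ Inl k))"

definition adj :: "'n::finite spmat \<Rightarrow> 'n spmat" where
  "adj X = (\<chi> ij. cnj (X $ (snd ij, fst ij)))"

lemma hin_lin:
  "hin (x + y) z = hin x z + hin y z" "hin x (y + z) = hin x y + hin x z"
  "hin (x - y) z = hin x z - hin y z" "hin x (y - z) = hin x y - hin x z"
  "hin (- x) y = - hin x y" "hin x (- y) = - hin x y"
  "hin (csc c x) y = cnj c * hin x y" "hin x (csc c y) = c * hin x y"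
  by (simp_all add: hin_def algebra_simps sum.distrib sum_subtractf sum_negf sum_distrib_left)

lemma hin_cnj: "cnj (hin x y) = hin y x"
  by (simp add: hin_def mult.commute)

lemma hin_self: "hin x x = of_real ((norm x)\<^sup>2)"
  by (simp add: hin_def norm_vec_def L2_set_def sum_nonneg mult.commute[of "cnj _"] flip: complex_norm_square)

lemma hin_nondegenerate: "(\<And>x. hin x y = hin x z) \<Longrightarrow> y = z"
proof -
  assume "\<And>x. hin x y = hin x z"
  then have "hin (y - z) (y - z) = 0" by (simp add: hin_lin)
  then show ?thesis by (simp add: hin_self)
qed

lemma hin_adj: "hin (mv X x) y = hin x (mv (adj X) y)"
  unfolding hin_def mv_def adj_def
  by (simp add: sum_distrib_left sum_distrib_right, subst sum.swap) (simp add: mult_ac)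

lemma adj_unique: "(\<And>x y. hin (mv X x) y = hin x (mv Y y)) \<Longrightarrow> adj X = Y"
  by (rule spmat_eqI) (metis hin_adj hin_nondegenerate)

lemma adj_adj [simp]: "adj (adj X) = X"
  by (simp add: adj_def vec_eq_iff)

lemma adj_mul: "adj (X \<cdot> Y) = adj Y \<cdot> adj X"
  and adj_add: "adj (X + Y) = adj X + adj Y"
  and adj_diff: "adj (X - Y) = adj X - adj Y"
  and adj_minus: "adj (- X) = - adj X"
  and adj_csc: "adj (csc c X) = csc (cnj c) (adj X)"
  and adj_id [simp]: "adj sp_id = sp_id"
  by (rule adj_unique; simp add: mv_lin hin_lin hin_adj)+

lemmas adj_lin = adj_mul adj_add adj_diff adj_minus adj_csc

lemma hin_jj: "hin (jj x) y = om x y"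
  by (simp add: hin_def jj_def om_def sum_UNIV_Plus sum_subtractf sum_negf)

lemma jj_jj [simp]: "jj (jj x) = - x"
proof -
  have "jj (jj x) $ i = - x $ i" for i by (cases i) (simp_all add: jj_def)
  then show ?thesis by (simp add: vec_eq_iff)
qed

lemma om_jj: "om x (jj y) = hin y x"
  using hin_jj[of "jj y" x] om_skew[of "jj y" x] by (simp add: hin_lin)

lemma om_jj_left: "om (jj y) x = - hin y x"
  using om_skew[of "jj y" x] om_jj[of x y] by simp

lemma adj_star_jj: "mv (adj (star X)) (jj x) = jj (mv X x)"
proof (rule hin_nondegenerate)
  fix y
  have "hin (jj (mv X x)) y = hin (mv (adj (star X)) (jj x)) y"
    by (metis adj_adj hin_adj hin_jj om_star)
  then show "hin y (mv (adj (star X)) (jj x)) = hin y (jj (mv X x))"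
    by (metis hin_cnj)
qed

lemma star_adj: "star (adj X) = adj (star X)"
proof (rule star_unique)
  fix x y
  have 1: "mv (adj (star X)) y = - jj (mv X (jj y))"
    using adj_star_jj[of X "jj y"] by (metis jj_jj minus_minus mv_minus_right)
  have "om x (mv (adj (star X)) y) = - hin (jj y) (mv (adj X) x)"
    unfolding 1 by (simp add: om_lin om_jj hin_adj)
  then show "om (mv (adj X) x) y = om x (mv (adj (star X)) y)"
    by (simp add: hin_jj om_skew[of y])
qed

lemma adj_rk: "adj (rk u v) = rk (jj v) (- jj u)"
proof (rule adj_unique)
  fix x y
  have "hin (mv (rk u v) x) y = cnj (om v x) * hin u y"
    by (simp add: mv_rk hin_lin)
  also have "cnj (om v x) = hin x (jj v)"
    by (metis hin_jj hin_cnj)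
  finally show "hin (mv (rk u v) x) y = hin x (mv (rk (jj v) (- jj u)) y)"
    by (simp add: mv_rk hin_lin om_lin om_jj_left)
qed

lemma rk_minus: "rk (- u) v = - rk u v" "rk u (- v) = - rk u v"
  by (rule spmat_eqI; simp add: mv_lin mv_rk om_lin csc_lin)+

lemma adj_xi: "adj (xi v) = - xi (jj v)" "adj (xi (jj v)) = - xi v"
  by (simp_all add: adj_rk rk_minus)

definition tr :: "'n::finite spmat \<Rightarrow> complex" where
  "tr X = (\<Sum>i\<in>UNIV. X $ (i, i))"

lemma tr_lin: "tr (X + Y) = tr X + tr Y" "tr (X - Y) = tr X - tr Y" "tr (- X) = - tr X" "tr (csc c X) = c * tr X"
  by (simp_all add: tr_def sum.distrib sum_subtractf sum_negf sum_distrib_left)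

lemma tr_commute: "tr (X \<cdot> Y) = tr (Y \<cdot> X)"
  unfolding tr_def sp_mul_def by (simp, subst sum.swap) (simp add: mult.commute)

lemma tr_rk_mul: "tr (rk u v \<cdot> X) = om v (mv X u)"
proof -
  have "om v (mv X u) = om v (mv X (\<Sum>i\<in>UNIV. csc (u $ i) (axis i 1)))"
    by (simp only: vec_axis_expand[symmetric])
  also have "\<dots> = (\<Sum>i\<in>UNIV. u $ i * om v (mv X (axis i 1)))"
    by (simp add: mv_sum_right om_sum_right mv_lin om_lin)
  also have "\<dots> = tr (rk u v \<cdot> X)"
    unfolding tr_def mul_rk(2) by (simp add: rk_def om_star)
  finally show ?thesis ..
qed

lemma tr_rk: "tr (rk u v) = om v u"
  using tr_rk_mul[of u v sp_id] by simp

lemma tr_id: "tr (sp_id :: 'n::finite spmat) = of_nat (2 * CARD('n))"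
  by (simp add: tr_def sp_id_def sum_UNIV_Plus)

lemma inner_tr: "inner X Y = Re (tr (adj X \<cdot> Y))"
proof -
  have "tr (adj X \<cdot> Y) = (\<Sum>ij\<in>UNIV. cnj (X $ ij) * Y $ ij)"
    unfolding tr_def sp_mul_def adj_def
    by (simp, subst sum.swap) (simp add: sum.cartesian_product UNIV_Times_UNIV)
  then show ?thesis by (simp add: inner_vec_def inner_complex_def)
qed

lemma tr_act: "g \<in> Sp \<Longrightarrow> tr (act g X \<cdot> act g Y) = tr (X \<cdot> Y)"
proof -
  assume g: "g \<in> Sp"
  have "tr (act g (X \<cdot> Y)) = tr (star g \<cdot> (g \<cdot> (X \<cdot> Y)))"
    unfolding act_def by (rule tr_commute)
  then show ?thesis using g by (simp add: act_mul Sp_iff flip: sp_mul_assoc)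
qed

definition Ksp :: "'n::finite spmat set" where
  "Ksp = {g \<in> Sp. adj g = star g}"

text \<open>Hermitian involutions, that is, the orthogonal Lagrangian splittings. Each is determined
  by its +1-eigenspace, so this is a copy of the compact Lagrangian Grassmannian.\<close>

definition Mc :: "'n::finite spmat set" where
  "Mc = {A \<in> LagSplit'. adj A = A}"

lemma Ksp_mul: "g \<in> Ksp \<Longrightarrow> h \<in> Ksp \<Longrightarrow> g \<cdot> h \<in> Ksp"
  by (auto simp: Ksp_def Sp_mul adj_lin star_lin)

lemma Ksp_star: "g \<in> Ksp \<Longrightarrow> star g \<in> Ksp"
  by (auto simp: Ksp_def Sp_star) (metis adj_adj)

lemma Ksp_id [simp]: "sp_id \<in> Ksp"
  by (simp add: Ksp_def)

lemma Mc_act: "g \<in> Ksp \<Longrightarrow> A \<in> Mc \<Longrightarrow> act g A \<in> Mc"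
proof -
  assume a: "g \<in> Ksp" "A \<in> Mc"
  then have "adj (star g) = g" by (metis (mono_tags, lifting) Ksp_def adj_adj mem_Collect_eq)
  then show ?thesis using a by (auto simp: Mc_def Ksp_def act_in) (simp add: act_def adj_lin spm_lin)
qed

lemma norm_sq_tr: "(norm X)\<^sup>2 = Re (tr (adj X \<cdot> X))"
  by (simp add: power2_norm_eq_inner inner_tr)

lemma norm_Ksp: "g \<in> Ksp \<Longrightarrow> norm (g :: 'n::finite spmat) = sqrt (2 * CARD('n))"
proof -
  assume "g \<in> Ksp"
  then have "(norm g)\<^sup>2 = 2 * CARD('n)" by (simp add: norm_sq_tr Ksp_def Sp_iff tr_id)
  then show ?thesis by (metis norm_ge_zero real_sqrt_unique)
qed

lemma norm_Mc: "A \<in> Mc \<Longrightarrow> norm (A :: 'n::finite spmat) = sqrt (2 * CARD('n))"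
proof -
  assume "A \<in> Mc"
  then have "(norm A)\<^sup>2 = 2 * CARD('n)" by (simp add: norm_sq_tr Mc_def LagSplit'_def tr_id)
  then show ?thesis by (metis norm_ge_zero real_sqrt_unique)
qed

lemma adj_D: "adj sp_D = sp_D"
  by (auto simp: adj_def sp_D_def vec_eq_iff split: sum.splits)

lemma D_in_Mc: "sp_D \<in> Mc"
  by (simp add: Mc_def D_in adj_D)

lemma linear_adj: "linear (adj :: 'n::finite spmat \<Rightarrow> _)"
  by (rule linearI) (simp_all add: adj_lin scaleR_eq_csc)

lemma continuous_on_adj [continuous_intros]: "continuous_on S f \<Longrightarrow> continuous_on S (\<lambda>x. adj (f x))"
  by (rule bounded_linear.continuous_on[OF linear_adj[THEN linear_conv_bounded_linear[THEN iffD1]]])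

lemma linear_star: "linear (star :: 'n::finite spmat \<Rightarrow> _)"
  using bounded_linear_star bounded_linear.linear by blast

lemma continuous_on_star [continuous_intros]: "continuous_on S f \<Longrightarrow> continuous_on S (\<lambda>x. star (f x))"
  by (rule bounded_linear.continuous_on[OF linear_star[THEN linear_conv_bounded_linear[THEN iffD1]]])

lemmas continuous_on_sp_mul [continuous_intros] = bounded_bilinear.continuous_on[OF bounded_bilinear_sp_mul]
lemmas continuous_on_csc [continuous_intros] = bounded_bilinear.continuous_on[OF bounded_bilinear_csc]

lemma continuous_on_act [continuous_intros]:
  "continuous_on S f \<Longrightarrow> continuous_on S g \<Longrightarrow> continuous_on S (\<lambda>x. act (f x) (g x))"
  unfolding act_def by (intro continuous_intros)

lemma linear_tr: "linear (tr :: 'n::finite spmat \<Rightarrow> _)"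
  by (rule linearI) (simp_all add: tr_lin scaleR_eq_csc scaleR_conv_of_real)

lemma continuous_on_tr [continuous_intros]: "continuous_on S f \<Longrightarrow> continuous_on S (\<lambda>x. tr (f x))"
  by (rule bounded_linear.continuous_on[OF linear_tr[THEN linear_conv_bounded_linear[THEN iffD1]]])

lemma closed_LagSplit': "closed LagSplit'"
  unfolding LagSplit'_def by (intro closed_Collect_conj closed_Collect_eq continuous_intros)

lemma closed_Mc: "closed Mc"
  using closed_LagSplit' unfolding Mc_def Collect_conj_eq
  by (intro closed_Int closed_Collect_eq continuous_intros) simp

lemma closed_Sp: "closed (Sp :: 'n::finite spmat set)"
proof -
  have e: "(Sp :: 'n spmat set) = {g. star g \<cdot> g = sp_id}" by (simp add: set_eq_iff Sp_iff)
  show ?thesis unfolding e by (intro closed_Collect_eq continuous_intros)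
qed

lemma compact_Mc: "compact Mc"
  using closed_Mc by (auto simp: compact_eq_bounded_closed norm_Mc intro!: boundedI)

lemma compact_Ksp: "compact Ksp"
proof -
  have "closed Ksp"
    using closed_Sp unfolding Ksp_def Collect_conj_eq
    by (intro closed_Int closed_Collect_eq continuous_intros) simp
  then show ?thesis
    by (auto simp: compact_eq_bounded_closed norm_Ksp intro!: boundedI)
qed

text \<open>For \<open>b = cnj a\<close> the operator is skew-hermitian, for \<open>b = 0\<close> it
  generates transvections. Varying \<open>a\<close> and \<open>b\<close> independently connects the
  two cases holomorphically.\<close>

definition cw :: "'n::finite spvec \<Rightarrow> complex \<Rightarrow> complex \<Rightarrow> 'n spmat" where
  "cw v a b = csc a (xi v) + csc b (xi (jj v))"

definition cN :: "'n::finite spvec \<Rightarrow> complex \<Rightarrow> complex \<Rightarrow> complex" where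
  "cN v a b = a * b * (hin v v)\<^sup>2"

text \<open>The Cayley transform \<open>(1 + w) / (1 - w)\<close> of \<open>w = cw v a b\<close>, in closed form because \<open>w\<^sup>3 = - cN v a b \<cdot> w\<close>.\<close>

definition cay :: "'n::finite spvec \<Rightarrow> complex \<Rightarrow> complex \<Rightarrow> 'n spmat" where
  "cay v a b = sp_id + csc (2 / (1 + cN v a b)) (cw v a b + cw v a b \<cdot> cw v a b)"

lemma cw_sq: "cw v a b \<cdot> cw v a b = csc (a * b * hin v v) (rk v (jj v) - rk (jj v) v)"
  by (simp add: cw_def spm_lin rk_mul om_jj om_jj_left csc_lin) (simp add: mult_ac)

lemma cw_cube: "cw v a b \<cdot> (cw v a b \<cdot> cw v a b) = csc (- cN v a b) (cw v a b)"
  unfolding cw_sq cN_def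
  by (simp add: cw_def spm_lin rk_mul om_jj om_jj_left csc_lin power2_eq_square) (simp add: mult_ac)

lemma star_cw: "star (cw v a b) = - cw v a b"
  by (simp add: cw_def star_lin star_xi csc_lin)

lemma cw_minus: "cw v (- a) (- b) = - cw v a b"
  by (simp add: cw_def csc_lin)

lemma star_cay: "star (cay v a b) = cay v (- a) (- b)"
  by (simp add: cay_def star_lin star_cw cw_minus spm_lin cN_def)

lemma cay_Sp: "1 + cN v a b \<noteq> 0 \<Longrightarrow> cay v a b \<in> Sp"
proof -
  assume N: "1 + cN v a b \<noteq> 0"
  define c where "c = 2 / (1 + cN v a b)"
  let ?w = "cw v a b" and ?N = "cN v a b"
  have w4: "?w \<cdot> (?w \<cdot> (?w \<cdot> ?w)) = csc (- ?N) (?w \<cdot> ?w)"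
    by (simp add: cw_cube spm_lin)
  have "cay v (- a) (- b) \<cdot> cay v a b = (sp_id + csc c (- ?w + ?w \<cdot> ?w)) \<cdot> (sp_id + csc c (?w + ?w \<cdot> ?w))"
    by (simp add: cay_def cw_minus cN_def c_def spm_lin)
  also have "\<dots> = sp_id + csc (2 * c - c * c * (1 + ?N)) (?w \<cdot> ?w)"
    by (simp add: spm_lin w4 cw_cube vec_eq_iff algebra_simps)
  also have "2 * c - c * c * (1 + ?N) = 0" 
  proof -
    have "c * (1 + ?N) = 2" using N unfolding c_def by (metis nonzero_eq_divide_eq)
    then show ?thesis by (simp only: mult.assoc) simp
  qed
  finally show ?thesis by (simp add: Sp_iff star_cay)
qed

lemma cay_Ksp: "cay v a (cnj a) \<in> Ksp"
proof -
  have N: "cN v a (cnj a) = of_real ((cmod a)\<^sup>2 * (norm v)^4)"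
    by (simp add: cN_def hin_self complex_norm_square[symmetric] del: of_real_power) (simp flip: of_real_mult power_mult)
  then have "1 + cN v a (cnj a) = of_real (1 + (cmod a)\<^sup>2 * (norm v)^4)" by simp
  moreover have "1 + (cmod a)\<^sup>2 * (norm v)^4 \<noteq> 0"
    by (metis add_nonneg_eq_0_iff mult_nonneg_nonneg zero_le_one zero_le_power2 zero_neq_one norm_ge_zero zero_le_power)
  ultimately have N1: "1 + cN v a (cnj a) \<noteq> 0" by (metis of_real_eq_0_iff)
  have c: "cnj (cN v a (cnj a)) = cN v a (cnj a)" by (simp add: N)
  have "adj (cw v a (cnj a)) = - cw v a (cnj a)"
    by (simp add: cw_def adj_lin adj_xi csc_lin rk_minus)
  then have "adj (cay v a (cnj a)) = cay v (- a) (- cnj a)"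
    by (simp add: cay_def adj_lin c cw_minus spm_lin) (simp add: cN_def)
  then show ?thesis using cay_Sp[OF N1] by (simp add: Ksp_def star_cay)
qed

text \<open>For \<open>b = 0\<close> the operator \<open>w\<close> squares to zero, so the Cayley
  transform is just \<open>1 + 2 w\<close>.\<close>

lemma cay_transvection: "cay v (1/2) 0 = transv v 1"
proof -
  have "cw v (1/2) 0 = csc (1/2) (xi v)" by (simp add: cw_def)
  then show ?thesis by (simp add: cay_def cN_def transv_def csc_csc spm_lin)
qed

section \<open>Transitivity of the compact group\<close>

text \<open>The form \<open>om y (mv X x)\<close> is symmetric, hence determined by its diagonal
  values.\<close>

lemma sp_zeroI:
  assumes X: "star X = - X" and z: "\<And>v. om v (mv X v) = 0"
  shows "X = 0"
proof (rule spmat_eqI)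
  fix x
  have "om y (mv X x) = 0" for y
  proof -
    have "om x (mv X y) = om y (mv X x)"
      using om_star[of X x y] om_skew[of "mv X x" y] X by (simp add: mv_lin om_lin)
    then show ?thesis using z[of "x + y"] z[of x] z[of y] by (simp add: mv_lin om_lin)
  qed
  then have "mv X x = 0" by (intro om_nondegenerate) simp
  then show "mv X x = mv 0 x" by simp
qed

lemma has_vector_derivative_cay: "((\<lambda>t. cay v (of_real t) (of_real t)) has_vector_derivative csc 2 (cw v 1 1)) (at 0)"
proof -
  let ?c = "\<lambda>t. 2 / (1 + cN v (complex_of_real t) (complex_of_real t))"
  have "(?c has_vector_derivative 0) (at 0)"
    unfolding cN_def has_vector_derivative_def
    by (auto intro!: derivative_eq_intros)
  moreover have w: "((\<lambda>t. cw v (of_real t) (of_real t)) has_vector_derivative cw v 1 1) (at 0)"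
    unfolding cw_def has_vector_derivative_def
    by (auto intro!: derivative_eq_intros bounded_linear.has_derivative[OF bounded_linear_csc_left]
        simp: scaleR_eq_csc csc_lin)
  ultimately have "((\<lambda>t. sp_id + csc (?c t) (cw v (of_real t) (of_real t) + cw v (of_real t) (of_real t) \<cdot> cw v (of_real t) (of_real t)))
     has_vector_derivative 0 + (csc (?c 0) (cw v 1 1 + (cw v (of_real 0) (of_real 0) \<cdot> cw v 1 1 + cw v 1 1 \<cdot> cw v (of_real 0) (of_real 0)))
       + csc 0 (cw v (of_real 0) (of_real 0) + cw v (of_real 0) (of_real 0) \<cdot> cw v (of_real 0) (of_real 0)))) (at 0)"
    by (intro has_vector_derivative_add has_vector_derivative_const has_vector_derivative_sp_mul
        bounded_bilinear.has_vector_derivative[OF bounded_bilinear_csc])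
  then show ?thesis by (simp add: cay_def cN_def cw_def[of v 0 0])
qed

lemma Mc_jj: "A \<in> Mc \<Longrightarrow> mv A (jj x) = - jj (mv A x)"
proof -
  assume "A \<in> Mc"
  then have "adj (star A) = - A" by (simp add: Mc_def LagSplit'_def adj_lin)
  then show ?thesis using adj_star_jj[of A x] by (metis minus_minus mv_minus_left)
qed

text \<open>Along each Cayley curve the derivative of the trace vanishes at the maximum; it pairs
  the commutator \<open>X\<close> with \<open>cw v 1 1\<close>, which gives
  \<open>Re (om v (mv X v)) = 0\<close> for every \<open>v\<close>.\<close>

lemma commute_if_critical:
  assumes r: "r \<in> Mc" and max: "\<And>k. k \<in> Ksp \<Longrightarrow> Re (tr (sp_D \<cdot> act k r)) \<le> Re (tr (sp_D \<cdot> r))"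
  shows "r \<cdot> sp_D = sp_D \<cdot> r"
proof -
  define X where "X = r \<cdot> sp_D - sp_D \<cdot> r"
  have r': "star r = - r" "adj r = r" using r by (auto simp: Mc_def LagSplit'_def)
  have X: "star X = - X" "adj X = - X"
    by (simp_all add: X_def star_lin adj_lin r' star_D adj_D spm_lin)
  have Xj: "mv X (jj x) = jj (mv X x)" for x
    using adj_star_jj[of X x] by (simp add: X adj_lin)
  have re: "Re (om v (mv X v)) = 0" for v
  proof -
    let ?k = "\<lambda>t. cay v (complex_of_real t) (complex_of_real t)"
    let ?f = "\<lambda>t. Re (tr (sp_D \<cdot> act (?k t) r))"
    have k0: "?k 0 = sp_id" "cay v 0 0 = sp_id" by (simp_all add: cay_def cw_def)
    have d: "((\<lambda>t. sp_D \<cdot> (?k t \<cdot> r \<cdot> star (?k t))) has_vector_derivative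
        sp_D \<cdot> (?k 0 \<cdot> r \<cdot> star (csc 2 (cw v 1 1)) + (?k 0 \<cdot> 0 + csc 2 (cw v 1 1) \<cdot> r) \<cdot> star (?k 0))
        + 0 \<cdot> (?k 0 \<cdot> r \<cdot> star (?k 0))) (at 0)"
      using has_vector_derivative_cay[of v]
      by (intro has_vector_derivative_sp_mul has_vector_derivative_star has_vector_derivative_const) auto
    have l: "bounded_linear (\<lambda>X. Re (tr X))"
      by (intro linear_conv_bounded_linear[THEN iffD1] linearI) (simp_all add: tr_lin scaleR_eq_csc)
    have "(?f has_real_derivative Re (tr (sp_D \<cdot> (r \<cdot> star (csc 2 (cw v 1 1)) + csc 2 (cw v 1 1) \<cdot> r)))) (at 0)"
      using bounded_linear.has_vector_derivative[OF l d]
      by (simp add: act_def k0 has_real_derivative_iff_has_vector_derivative)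
    then have "Re (tr (sp_D \<cdot> (r \<cdot> star (csc 2 (cw v 1 1)) + csc 2 (cw v 1 1) \<cdot> r))) = 0"
      by (rule DERIV_local_max[of _ _ _ 1]) (use max cay_Ksp[of v "of_real _"] k0 in \<open>auto simp: \<close>)
    then have "Re (tr (sp_D \<cdot> (cw v 1 1 \<cdot> r)) - tr (sp_D \<cdot> (r \<cdot> cw v 1 1))) = 0"
      by (simp add: star_lin star_cw spm_lin tr_lin)
    moreover have "tr (sp_D \<cdot> (cw v 1 1 \<cdot> r)) = tr (cw v 1 1 \<cdot> (r \<cdot> sp_D))"
      using tr_commute[of sp_D "cw v 1 1 \<cdot> r"] by (simp add: spm_lin)
    moreover have "tr (sp_D \<cdot> (r \<cdot> cw v 1 1)) = tr (cw v 1 1 \<cdot> (sp_D \<cdot> r))"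
      using tr_commute[of "sp_D \<cdot> r" "cw v 1 1"] by (simp add: spm_lin)
    ultimately have "Re (tr (cw v 1 1 \<cdot> X)) = 0"
      by (simp add: X_def spm_lin tr_lin)
    moreover have "tr (cw v 1 1 \<cdot> X) = om v (mv X v) + cnj (om v (mv X v))"
    proof -
      have "om (jj v) (mv X (jj v)) = - hin v (jj (mv X v))" by (simp add: Xj om_jj_left)
      also have "\<dots> = - cnj (om (mv X v) v)" by (metis hin_cnj hin_jj)
      also have "\<dots> = cnj (om v (mv X v))" by (simp add: om_skew[of "mv X v"])
      finally show ?thesis by (simp add: cw_def spm_lin tr_lin tr_rk_mul)
    qed
    ultimately show ?thesis by simp
  qed
  have "om v (mv X v) = 0" for v
  proof -
    \<comment> \<open>Scaling \<open>v\<close> by \<open>c\<close> multiplies the value by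
      \<open>c\<^sup>2\<close>. This choice makes the result the squared modulus, which is real, so
      the vanishing real part forces the value itself to vanish.\<close>
    define c where "c = csqrt (cnj (om v (mv X v)))"
    have "om (csc c v) (mv X (csc c v)) = c\<^sup>2 * om v (mv X v)"
      by (simp add: mv_lin om_lin power2_eq_square)
    also have "\<dots> = of_real ((cmod (om v (mv X v)))\<^sup>2)"
      unfolding complex_norm_square c_def by (simp add: mult.commute)
    finally show ?thesis using re[of "csc c v"] by simp
  qed
  then have "X = 0" using sp_zeroI X(1) by blast
  then show ?thesis by (simp add: X_def)
qed

text \<open>On the plane of \<open>u\<close> and \<open>jj u\<close> the involutions
  \<open>D\<close> and \<open>r\<close> are opposite, and \<open>D \<cdot> r\<close> contributes
  \<open>- 2\<close> to the trace. Conjugation by \<open>k\<close> flips \<open>r\<close> on this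
  plane only, so the contribution becomes 2.\<close>

lemma swap_increases:
  assumes r: "r \<in> Mc" and c: "r \<cdot> sp_D = sp_D \<cdot> r" and ne: "r \<noteq> sp_D"
  shows "\<exists>k\<in>Ksp. Re (tr (sp_D \<cdot> act k r)) > Re (tr (sp_D \<cdot> r))"
proof -
  let ?D = "sp_D :: 'a spmat"
  have DD: "mv ?D (mv ?D x) = x" for x by (metis D_D mv_id mv_mul)
  have rr: "mv r (mv r x) = x" for x using r by (auto simp: Mc_def LagSplit'_def simp flip: mv_mul)
  have rD: "mv r (mv ?D x) = mv ?D (mv r x)" for x by (metis c mv_mul)
  obtain u where u: "u \<noteq> 0" "mv ?D u = u" "mv r u = - u"
  proof -
    obtain x where x: "mv r x \<noteq> mv ?D x" using ne spmat_eqI by blast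
    \<comment> \<open>This vector satisfies \<open>mv r y = - mv sp_D y\<close>. Its component in
      the +1-eigenspace of \<open>D\<close> serves as \<open>u\<close> unless that component is
      zero.\<close>
    define y where "y = mv r x - mv ?D x"
    have y0: "y \<noteq> 0" using x by (simp add: y_def)
    have ry: "mv r y = - mv ?D y" by (simp add: y_def mv_lin rr rD DD)
    show ?thesis
    proof (cases "y + mv ?D y = 0")
      case False
      then show ?thesis using that[of "y + mv ?D y"] by (simp add: mv_lin DD rD ry add.commute)
    next
      case True
      \<comment> \<open>Now \<open>y\<close> is in the -1-eigenspace of \<open>D\<close>; points of
        \<open>Mc\<close> anticommute with \<open>jj\<close>, so \<open>jj y\<close> is in the
        +1-eigenspace.\<close>
      then have Dy: "mv ?D y = - y" by (simp add: eq_neg_iff_add_eq_0 add.commute)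
      have j: "jj (- y) = - jj y" by (simp add: jj_def vec_eq_iff split: sum.splits)
      have "jj 0 = (0 :: 'a spvec)" by (simp add: jj_def vec_eq_iff split: sum.splits)
      then have "jj y \<noteq> 0" using y0 jj_jj[of y] by force
      then show ?thesis using that[of "jj y"] Mc_jj[OF D_in_Mc, of y] Mc_jj[OF r, of y]
        by (simp add: ry Dy mv_lin j)
    qed
  qed
  define s where "s = hin u u"
  have s0: "s \<noteq> 0" using u(1) by (simp add: s_def hin_self)
  have sr: "cnj s = s" by (simp add: s_def hin_self)
  \<comment> \<open>The factor \<open>1/s\<close> makes \<open>cN\<close> equal to 1, so that the
    prefactor \<open>2 / (1 + cN)\<close> is 1 and \<open>k\<close> rotates the plane of
    \<open>u\<close> and \<open>jj u\<close> by a right angle.\<close>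
  define w where "w = cw u (1/s) (1/s)"
  define k where "k = sp_id + w + w \<cdot> w"
  have N: "cN u (1/s) (1/s) = 1" using s0 by (simp add: cN_def power2_eq_square flip: s_def)
  have kc: "k = cay u (1/s) (cnj (1/s))"
    by (simp add: cay_def sr N k_def w_def add.assoc)
  have w3: "w \<cdot> (w \<cdot> w) = - w" using cw_cube[of u "1/s" "1/s"] by (simp add: w_def N csc_lin)
  have sD: "star ?D = - ?D" "star r = - r" using r by (auto simp: star_D Mc_def LagSplit'_def)
  have ju: "mv ?D (jj u) = - jj u" "mv r (jj u) = jj u"
    using Mc_jj[OF D_in_Mc, of u] Mc_jj[OF r, of u] u by (simp_all, metis jj_jj minus_minus u(3) mv_minus_right)
  have w2: "w \<cdot> w = csc (1/s) (rk u (jj u) - rk (jj u) u)"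
    using cw_sq[of u "1/s" "1/s"] s0 by (simp add: w_def flip: s_def)
  have wr: "w \<cdot> r = - (r \<cdot> w)"
    by (simp add: w_def cw_def spm_lin mul_rk sD mv_lin u ju rk_minus csc_lin)
  have Dr: "?D \<cdot> (r \<cdot> (w \<cdot> w)) = - (w \<cdot> w)"
    unfolding w2 by (simp add: spm_lin mul_rk u ju mv_lin rk_minus csc_lin)
  have "w \<cdot> (r \<cdot> Y) = - (r \<cdot> (w \<cdot> Y))" for Y using wr by (metis sp_mul_assoc sp_mul_minus_left)
  then have "act k r = r \<cdot> (sp_id + csc 2 (w \<cdot> w))"
  proof -
    assume wY: "\<And>Y. w \<cdot> (r \<cdot> Y) = - (r \<cdot> (w \<cdot> Y))"
    have sw: "star w = - w" by (simp add: w_def star_cw)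
    have w4: "w \<cdot> (w \<cdot> (w \<cdot> w)) = - (w \<cdot> w)" by (simp add: w3 spm_lin)
    show ?thesis
      unfolding act_def k_def
      by (simp add: star_lin sw spm_lin wr wY w3 w4 vec_eq_iff algebra_simps)
  qed
  then have "tr (?D \<cdot> act k r) = tr (?D \<cdot> r) + 2 * tr (- (w \<cdot> w))"
    by (simp add: spm_lin Dr tr_lin)
  also have "tr (- (w \<cdot> w)) = 2"
    unfolding w2 using s0 by (simp add: tr_lin tr_rk om_jj om_jj_left flip: s_def)
  finally have "Re (tr (?D \<cdot> act k r)) > Re (tr (?D \<cdot> r))" by simp
  then show ?thesis using cay_Ksp kc by metis
qed

text \<open>A maximum of \<open>tr (D k q k\<^sup>-\<^sup>1)\<close> over the compact group commutes with \<open>D\<close>; if it were not \<open>D\<close> itself,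
  rotating a common eigenvector \<open>u\<close> to \<open>jj u\<close> would increase the trace.\<close>

lemma Ksp_transitive:
  assumes q: "q \<in> Mc"
  shows "\<exists>k\<in>Ksp. q = act k sp_D"
proof -
  have "continuous_on Ksp (\<lambda>k. Re (tr (sp_D \<cdot> act k q)))" by (intro continuous_intros)
  then obtain k where k: "k \<in> Ksp" "\<And>h. h \<in> Ksp \<Longrightarrow> Re (tr (sp_D \<cdot> act h q)) \<le> Re (tr (sp_D \<cdot> act k q))"
    using continuous_attains_sup[OF compact_Ksp] by (metis Ksp_id empty_iff)
  have r: "act k q \<in> Mc" using Mc_act k(1) q by blast
  have "Re (tr (sp_D \<cdot> act h (act k q))) \<le> Re (tr (sp_D \<cdot> act k q))" if "h \<in> Ksp" for h
    using k(2)[of "h \<cdot> k"] that k(1) by (simp add: act_act Ksp_mul)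
  then have "act k q = sp_D"
    using commute_if_critical[OF r] swap_increases[OF r] by fastforce
  then have "q = act (star k) sp_D"
    using k(1) by (metis (mono_tags, lifting) Ksp_def Sp_iff act_act act_id mem_Collect_eq)
  then show ?thesis using Ksp_star k(1) by blast
qed

section \<open>Reaching every splitting from the compact form\<close>

text \<open>Finite products of transvections. Invariance of the integral is obtained one
  transvection at a time, so points must be reached inside this set.\<close>

inductive_set Tg :: "'n::finite spmat set" where
  id: "sp_id \<in> Tg"
| step: "g \<in> Tg \<Longrightarrow> transv v s \<cdot> g \<in> Tg"

lemma Tg_Sp: "g \<in> Tg \<Longrightarrow> g \<in> Sp"
  by (induction rule: Tg.induct) (auto intro: Sp_mul transv_Sp)

lemma Tg_mul: "g \<in> Tg \<Longrightarrow> h \<in> Tg \<Longrightarrow> g \<cdot> h \<in> Tg"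
  by (induction rule: Tg.induct) (auto simp: sp_mul_assoc intro: Tg.step)

text \<open>The image of \<open>P\<close> is isotropic, and operators that map into it and vanish on
  it have product zero. On them \<open>X \<mapsto> sp_id + X\<close> turns sums into products, so it
  suffices to expand \<open>Z\<close> into transvection generators
  \<open>xi (mv P x)\<close>.\<close>

lemma unipotent_in_Tg:
  assumes P: "P \<cdot> P = P" "star P \<cdot> P = 0" and Z: "star Z = - Z" "P \<cdot> Z \<cdot> star P = Z"
  shows "sp_id + Z \<in> Tg"
proof -
  define Q where "Q X \<longleftrightarrow> sp_id + X \<in> Tg \<and> P \<cdot> X = X \<and> X \<cdot> P = 0" for X
  have add: "Q (X + Y)" if "Q X" "Q Y" for X Y
  proof -
    have "X \<cdot> Y = 0" using that unfolding Q_def by (metis sp_mul_assoc sp_mul_simps(3))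
    then have "(sp_id + X) \<cdot> (sp_id + Y) = sp_id + (X + Y)" by (simp add: spm_lin add_ac)
    moreover have "(sp_id + X) \<cdot> (sp_id + Y) \<in> Tg" using that by (auto simp: Q_def intro: Tg_mul)
    ultimately have "sp_id + (X + Y) \<in> Tg" by (simp only:)
    then show ?thesis using that by (simp add: Q_def sp_mul_add_left sp_mul_add_right)
  qed
  have zero: "Q 0" by (simp add: Q_def Tg.id)
  have sum: "Q (\<Sum>i\<in>S. f i)" if "\<And>i. i \<in> S \<Longrightarrow> Q (f i)" for S :: "('a + 'a) set" and f
    using that by (induction S rule: infinite_finite_induct) (auto intro: add zero)
  have xi: "Q (csc c (xi (mv P x)))" for c x
  proof -
    have "sp_id + csc c (xi (mv P x)) \<in> Tg"
      using Tg.step[OF Tg.id, of "mv P x" c] by (simp add: transv_def)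
    moreover have "mv P (mv P x) = mv P x" "mv (star P) (mv P x) = 0"
      using P by (simp_all flip: mv_mul)
    moreover have "rk u 0 = 0" for u :: "'a spvec" by (simp add: rk_def vec_eq_iff)
    ultimately show ?thesis by (simp add: Q_def spm_lin mul_rk)
  qed
  have pol: "Q (P \<cdot> csc c (rk a b + rk b a) \<cdot> star P)" for c a b
  proof -
    have "P \<cdot> csc c (rk a b + rk b a) \<cdot> star P = csc c (rk (mv P a) (mv P b) + rk (mv P b) (mv P a))"
      by (simp add: spm_lin mul_rk)
    also have "\<dots> = csc c (xi (mv P (a + b))) + (csc (- c) (xi (mv P a)) + csc (- c) (xi (mv P b)))"
      by (simp add: rk_polar csc_lin mv_add_right)
    finally show ?thesis using add xi by metis
  qed
  have "Q (P \<cdot> Z \<cdot> star P)"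
    by (subst sp_decomp[OF Z(1)]) (simp only: sp_mul_sum, intro sum pol)
  then show ?thesis using Z by (simp add: Q_def)
qed

text \<open>The witness \<open>q = (2 + p - p\<^sup>*) (p + p\<^sup>*)\<^sup>-\<^sup>1\<close> is the reflection whose +1-eigenspace is that of \<open>p\<close> and
  whose -1-eigenspace is the orthogonal complement.\<close>

lemma polar_point:
  assumes p: "p \<in> LagSplit'"
  shows "\<exists>q\<in>Mc. p \<cdot> q = sp_id + q - p \<and> q \<cdot> p = sp_id + p - q"
proof -
  have p': "star p = - p" "p \<cdot> p = sp_id" using p by (auto simp: LagSplit'_def)
  define c where "c = adj p"
  have c: "c \<cdot> c = sp_id" "star c = - c"
    by (metis c_def p'(2) adj_mul adj_id) (simp add: c_def star_adj p' adj_lin)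
  define h where "h = p + c"
  have hp: "h \<cdot> p = c \<cdot> h" "p \<cdot> h = h \<cdot> c" by (simp_all add: h_def spm_lin p' c add.commute)
  have ah: "adj h = h" by (simp add: h_def c_def adj_lin add.commute)
  have sh: "star h = - h" by (simp add: h_def star_lin p' c)
  have inj: "x = 0" if "mv h x = 0" for x
  proof -
    \<comment> \<open>With \<open>c = adj p\<close> the right-hand side is 2 plus two positive
      semidefinite operators, hence positive definite; so \<open>h\<close> has trivial
      kernel.\<close>
    have "h \<cdot> h = csc 2 sp_id + p \<cdot> c + c \<cdot> p"
      by (simp add: h_def spm_lin p' c vec_eq_iff)
    then have "hin x (mv (csc 2 sp_id + p \<cdot> c + c \<cdot> p) x) = 0"
      using that by (metis hin_lin(8) mult_zero_left mv_mul mv_zero(2) csc_simps(1))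
    moreover have "hin x (mv (csc 2 sp_id + p \<cdot> c + c \<cdot> p) x) = 2 * hin x x + hin (mv c x) (mv c x) + hin (mv p x) (mv p x)"
      by (simp add: mv_lin hin_lin hin_adj) (simp add: c_def)
    ultimately have "complex_of_real (2 * (norm x)\<^sup>2 + (norm (mv c x))\<^sup>2 + (norm (mv p x))\<^sup>2) = 0"
      by (simp add: hin_self)
    then have "2 * (norm x)\<^sup>2 + (norm (mv c x))\<^sup>2 + (norm (mv p x))\<^sup>2 = 0" by (metis of_real_eq_0_iff)
    then show ?thesis by (smt (verit) zero_le_power2 norm_eq_zero power_eq_0_iff)
  qed
  obtain b where b: "h \<cdot> b = sp_id" "b \<cdot> h = sp_id" using sp_inverse_exists[of h] inj by blast
  have bX: "b \<cdot> (h \<cdot> X) = X" "h \<cdot> (b \<cdot> X) = X" for X using b by (metis sp_mul_assoc sp_mul_simps(1))+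
  have bp: "b \<cdot> c = p \<cdot> b" "b \<cdot> p = c \<cdot> b"
  proof -
    have "b \<cdot> (h \<cdot> p) \<cdot> b = b \<cdot> (c \<cdot> h) \<cdot> b" "b \<cdot> (p \<cdot> h) \<cdot> b = b \<cdot> (h \<cdot> c) \<cdot> b" using hp by simp_all
    then show "b \<cdot> c = p \<cdot> b" "b \<cdot> p = c \<cdot> b" by (simp_all add: sp_mul_assoc bX b)
  qed
  have bpX: "b \<cdot> (c \<cdot> X) = p \<cdot> (b \<cdot> X)" "b \<cdot> (p \<cdot> X) = c \<cdot> (b \<cdot> X)" for X
    using bp by (metis sp_mul_assoc)+
  have ppX: "p \<cdot> (p \<cdot> X) = X" "c \<cdot> (c \<cdot> X) = X" for X using p' c by (metis sp_mul_assoc sp_mul_simps(1))+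
  have ab: "adj b = b"
  proof -
    have "adj b \<cdot> h = sp_id" using b(1) ah by (metis adj_mul adj_id)
    then have "adj b \<cdot> (h \<cdot> b) = b" by (metis sp_mul_assoc sp_mul_simps(1))
    then show ?thesis using b by simp
  qed
  have sb: "star b = - b"
  proof -
    have "star b \<cdot> h = - sp_id" using b(1) sh
      by (metis star_mul star_id sp_mul_minus_right minus_minus)
    then have "star b \<cdot> (h \<cdot> b) = - b" by (metis sp_mul_assoc sp_mul_minus_left sp_mul_simps(1))
    then show ?thesis using b by simp
  qed
  define q where "q = (csc 2 sp_id + p - c) \<cdot> b"
  \<comment> \<open>Writing \<open>sp_id\<close> as \<open>h \<cdot> b\<close> factors
    \<open>q + sp_id\<close> through \<open>sp_id + p\<close>, and likewise \<open>q - sp_id\<close>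
    through \<open>sp_id - c\<close>. The relations between \<open>p\<close> and \<open>q\<close>
    become vanishing products.\<close>
  have q1: "q + sp_id = csc 2 ((sp_id + p) \<cdot> b)"
  proof -
    have "q + sp_id = q + h \<cdot> b" by (simp add: b)
    then show ?thesis by (simp add: q_def h_def spm_lin vec_eq_iff)
  qed
  have q2: "q - sp_id = csc 2 ((sp_id - c) \<cdot> b)"
  proof -
    have "q - sp_id = q - h \<cdot> b" by (simp add: b)
    then show ?thesis by (simp add: q_def h_def spm_lin vec_eq_iff)
  qed
  have "(p - sp_id) \<cdot> (q + sp_id) = 0"
    unfolding q1 by (simp add: spm_lin ppX)
  then have e1: "p \<cdot> q = sp_id + q - p" by (simp add: spm_lin algebra_simps)
  have "(q - sp_id) \<cdot> (p + sp_id) = 0"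
    unfolding q2 by (simp add: spm_lin bp ppX csc_lin)
  then have e2: "q \<cdot> p = sp_id + p - q" by (simp add: spm_lin algebra_simps)
  have "(q - sp_id) \<cdot> (q + sp_id) = 0"
    unfolding q2 unfolding q1 by (simp add: spm_lin bpX ppX csc_lin)
  then have e3: "q \<cdot> q = sp_id" by (simp add: spm_lin)
  have aq: "adj q = q"
    by (simp add: q_def adj_lin ab spm_lin bp) (simp add: c_def spm_lin, simp add: spm_lin bp flip: c_def)
  have sq: "star q = - q"
    by (simp add: q_def star_lin sb p' c spm_lin bp csc_lin)
  show ?thesis using e1 e2 e3 aq sq by (auto simp: Mc_def LagSplit'_def)
qed

text \<open>The points \<open>p\<close> and \<open>q\<close> have the same +1-eigenspace,
  \<open>Z = (q - p) / 2\<close> maps into it and vanishes on it, and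
  \<open>p = (1 + Z) q (1 - Z)\<close>. The norm bound makes the group element range over a compact
  set when \<open>p\<close> does.\<close>

lemma LagSplit'_reach:
  fixes p :: "'n::finite spmat"
  assumes p: "p \<in> LagSplit'"
  shows "\<exists>g\<in>Tg. \<exists>k\<in>Ksp. p = act (g \<cdot> k) sp_D \<and> norm g \<le> norm (sp_id :: 'n spmat) + sqrt (2 * CARD('n)) + norm p"
proof -
  have p': "star p = - p" "p \<cdot> p = sp_id" using p by (auto simp: LagSplit'_def)
  obtain q where q: "q \<in> Mc" and e: "p \<cdot> q = sp_id + q - p" "q \<cdot> p = sp_id + p - q" using polar_point[OF p] by blast
  have q': "star q = - q" "q \<cdot> q = sp_id" using q by (auto simp: Mc_def LagSplit'_def)
  define Z where "Z = csc (1/2) (q - p)"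
  define P where "P = csc (1/2) (sp_id + q)"
  have "sp_id + Z \<in> Tg"
  proof (rule unipotent_in_Tg[of P])
    show "P \<cdot> P = P" by (simp add: P_def spm_lin q' vec_eq_iff field_simps)
    show "star P \<cdot> P = 0" by (simp add: P_def spm_lin q' star_lin csc_lin)
    show "star Z = - Z" by (simp add: Z_def star_lin p' q' vec_eq_iff field_simps)
    have "q \<cdot> Z = Z" "Z \<cdot> q = - Z" by (simp_all add: Z_def spm_lin q' e vec_eq_iff field_simps)
    then have "P \<cdot> Z = Z" "Z \<cdot> star P = Z"
      by (simp_all add: P_def star_lin q' spm_lin vec_eq_iff field_simps)
    then show "P \<cdot> Z \<cdot> star P = Z" by simp
  qed
  moreover have "p = act (sp_id + Z) q"
  proof -
    have "star Z = - Z" by (simp add: Z_def star_lin p' q' vec_eq_iff field_simps)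
    moreover have "Z \<cdot> q = - Z" "q \<cdot> Z = Z" by (simp_all add: Z_def spm_lin q' e vec_eq_iff field_simps)
    moreover have "Z \<cdot> Z = 0"  by (simp add: Z_def spm_lin q' p' e vec_eq_iff field_simps)
    ultimately have "act (sp_id + Z) q = q - (Z + Z)"
      by (simp add: act_def star_lin spm_lin)
    also have "Z + Z = csc 2 Z" by (simp add: vec_eq_iff)
    finally have "act (sp_id + Z) q = q - csc 2 Z" .
    then show ?thesis by (simp add: Z_def csc_lin)
  qed
  moreover obtain k where k: "k \<in> Ksp" "q = act k sp_D" using Ksp_transitive[OF q] by blast
  moreover have "norm (sp_id + Z) \<le> norm (sp_id :: 'n spmat) + sqrt (2 * CARD('n)) + norm p"
  proof -
    have "norm Z \<le> 1/2 * (norm q + norm p)"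
      unfolding Z_def norm_csc using norm_triangle_ineq4[of q p] by simp
    also have "\<dots> \<le> norm q + norm p" by simp
    finally show ?thesis using norm_triangle_ineq[of sp_id Z] norm_Mc[OF q] by simp
  qed
  ultimately show ?thesis by (metis act_act)
qed

lemma LagSplit_eq: "LagSplit = (LagSplit' :: 'n::finite spmat set)"
proof
  show "(LagSplit' :: 'n spmat set) \<subseteq> LagSplit"
  proof
    fix p :: "'n spmat" assume "p \<in> LagSplit'"
    then obtain g k where "g \<in> Tg" "k \<in> Ksp" "p = act (g \<cdot> k) sp_D" using LagSplit'_reach by metis
    then show "p \<in> LagSplit" using Tg_Sp Sp_mul act_in_LagSplit D_in_LagSplit by (metis (mono_tags, lifting) Ksp_def mem_Collect_eq)
  qed
qed (rule LagSplit_subset)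

section \<open>Rotation invariance of Lebesgue measure\<close>

lemma nn_integral_lborel_translate:
  fixes f :: "'a::euclidean_space \<Rightarrow> ennreal"
  assumes [measurable]: "f \<in> borel_measurable borel"
  shows "(\<integral>\<^sup>+x. f (a + x) \<partial>lborel) = (\<integral>\<^sup>+x. f x \<partial>lborel)"
proof -
  have "(\<integral>\<^sup>+x. f x \<partial>lborel) = (\<integral>\<^sup>+x. f x \<partial>distr lborel borel ((+) a))"
    by (simp add: lborel_distr_plus)
  also have "\<dots> = (\<integral>\<^sup>+x. f (a + x) \<partial>lborel)"
    by (subst nn_integral_distr) auto
  finally show ?thesis ..
qed

text \<open>Uniqueness of translation-invariant measures, by the usual double integral against the unit ball.\<close>

lemma nn_integral_lborel_isometry:
  fixes T :: "'a::euclidean_space \<Rightarrow> 'a" and f :: "'a \<Rightarrow> ennreal"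
  assumes T: "linear T" "surj T" "\<And>x. norm (T x) = norm x" and f [measurable]: "f \<in> borel_measurable borel"
  shows "(\<integral>\<^sup>+x. f (T x) \<partial>lborel) = (\<integral>\<^sup>+x. f x \<partial>lborel)"
proof -
  have "continuous_on UNIV T" using T(1) linear_continuous_on linear_conv_bounded_linear by blast
  then have T_meas [measurable]: "T \<in> borel_measurable borel" by (rule borel_measurable_continuous_onI)
  define g where "g x = (indicator (ball (0::'a) 1) x :: ennreal)" for x
  have g [measurable]: "g \<in> borel_measurable borel" unfolding g_def
    by (intro borel_measurable_indicator) simp
  have gT: "g (T x) = g x" for x by (simp add: g_def T(3) indicator_def)
  have gs: "g (- x) = g x" for x by (simp add: g_def indicator_def)
  let ?G = "\<integral>\<^sup>+x. g x \<partial>lborel"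
  have G: "?G = emeasure lborel (ball (0::'a) 1)" unfolding g_def by simp
  have G0: "?G \<noteq> 0" unfolding G using content_ball_pos[of 1 "0::'a"]
    by (auto simp: measure_def)
  have G1: "?G \<noteq> \<infinity>" unfolding G by (metis emeasure_lborel_ball_finite infinity_ennreal_def less_irrefl)
  have "(\<integral>\<^sup>+x. f (T x) \<partial>lborel) * ?G = (\<integral>\<^sup>+x. (\<integral>\<^sup>+y. f (T x) * g y \<partial>lborel) \<partial>lborel)"
    by (simp add: nn_integral_cmult nn_integral_multc)
  also have "\<dots> = (\<integral>\<^sup>+x. (\<integral>\<^sup>+y. f (T x) * g (- T x + y) \<partial>lborel) \<partial>lborel)"
  proof (rule nn_integral_cong)
    fix x
    show "(\<integral>\<^sup>+y. f (T x) * g y \<partial>lborel) = (\<integral>\<^sup>+y. f (T x) * g (- T x + y) \<partial>lborel)"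
      by (subst nn_integral_lborel_translate[of "\<lambda>y. f (T x) * g y"]) auto
  qed
  also have "\<dots> = (\<integral>\<^sup>+y. (\<integral>\<^sup>+x. f (T x) * g (- T x + y) \<partial>lborel) \<partial>lborel)"
    by (rule lborel_pair.Fubini'[symmetric]) measurable
  also have "\<dots> = (\<integral>\<^sup>+y. (\<integral>\<^sup>+x. f (T x + y) * g (T x) \<partial>lborel) \<partial>lborel)"
  proof (rule nn_integral_cong)
    fix y
    obtain z where z: "T z = y" using T(2) by (metis surjD)
    have "(\<integral>\<^sup>+x. f (T x) * g (- T x + y) \<partial>lborel) = (\<integral>\<^sup>+x. f (T (z + x)) * g (- T (z + x) + y) \<partial>lborel)"
      by (subst nn_integral_lborel_translate[of "\<lambda>x. f (T x) * g (- T x + y)"]) auto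
    also have "\<dots> = (\<integral>\<^sup>+x. f (T x + y) * g (T x) \<partial>lborel)"
      by (simp add: linear_add[OF T(1)] z gs add.commute)
    finally show "(\<integral>\<^sup>+x. f (T x) * g (- T x + y) \<partial>lborel) = (\<integral>\<^sup>+x. f (T x + y) * g (T x) \<partial>lborel)" .
  qed
  also have "\<dots> = (\<integral>\<^sup>+x. (\<integral>\<^sup>+y. f (T x + y) * g (T x) \<partial>lborel) \<partial>lborel)"
    by (rule lborel_pair.Fubini') measurable
  also have "\<dots> = (\<integral>\<^sup>+x. (\<integral>\<^sup>+y. f y \<partial>lborel) * g x \<partial>lborel)"
    by (rule nn_integral_cong) (simp add: nn_integral_multc nn_integral_lborel_translate gT)
  also have "\<dots> = (\<integral>\<^sup>+x. f x \<partial>lborel) * ?G"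
    by (simp add: nn_integral_cmult)
  finally have "?G * (\<integral>\<^sup>+x. f (T x) \<partial>lborel) = ?G * (\<integral>\<^sup>+x. f x \<partial>lborel)" by (simp add: mult.commute)
  then show ?thesis unfolding ennreal_mult_cancel_left using G0 G1 by auto
qed

lemma emeasure_lborel_isometry:
  fixes T :: "'a::euclidean_space \<Rightarrow> 'a"
  assumes T: "linear T" "surj T" "\<And>x. norm (T x) = norm x" and S: "S \<in> sets borel"
  shows "emeasure lborel (T -` S) = emeasure lborel S"
proof -
  have "continuous_on UNIV T" using T(1) linear_continuous_on linear_conv_bounded_linear by blast
  then have "T \<in> borel_measurable borel" by (rule borel_measurable_continuous_onI)
  then have "T -` S \<in> sets borel" using S by (metis inf_top.right_neutral measurable_sets space_borel)
  moreover have "indicator (T -` S) x = (indicator S (T x) :: ennreal)" for x by (simp add: indicator_def)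
  ultimately show ?thesis
    using nn_integral_lborel_isometry[OF T, of "indicator S"] S
    by (simp flip: nn_integral_indicator)
qed

section \<open>The matrix sign function near the compact form\<close>

text \<open>Newton iteration for the matrix sign.\<close>

definition newt :: "'n::finite spmat \<Rightarrow> 'n spmat" where
  "newt A = csc (1/2) (csc 3 A - A \<cdot> (A \<cdot> A))"

definition defect :: "'n::finite spmat \<Rightarrow> 'n spmat" where
  "defect A = A \<cdot> A - sp_id"

text \<open>No linear term in the defect survives; the iteration therefore converges quadratically,
  and for defect below 1/2 it at least halves the defect.\<close>

lemma defect_newt: "defect (newt A) = csc (1/4) (defect A \<cdot> (defect A \<cdot> defect A) - csc 3 (defect A \<cdot> defect A))"
  unfolding defect_def newt_def spm_lin sp_mul_simps by (simp add: vec_eq_iff field_simps)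

lemma newt_diff: "newt A - A = csc (-1/2) (A \<cdot> defect A)"
  by (simp add: defect_def newt_def spm_lin vec_eq_iff field_simps)

definition NearMc :: "'n::finite spmat set" where
  "NearMc = {A. adj A = A \<and> star A = - A \<and> norm (defect A) < 1/2}"

lemma norm_defect_newt: "norm (defect A) < 1/2 \<Longrightarrow> norm (defect (newt A)) \<le> norm (defect A) / 2"
proof -
  assume a: "norm (defect A) < 1/2"
  let ?e = "norm (defect A)"
  have "norm (defect (newt A)) \<le> 1/4 * (norm (defect A \<cdot> (defect A \<cdot> defect A)) + norm (csc 3 (defect A \<cdot> defect A)))"
    unfolding defect_newt norm_csc using norm_triangle_ineq4[of "defect A \<cdot> (defect A \<cdot> defect A)" "csc 3 (defect A \<cdot> defect A)"] by (simp add: norm_csc)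
  also have "\<dots> \<le> 1/4 * (?e * (?e * ?e) + 3 * (?e * ?e))"
    by (intro mult_left_mono add_mono order_trans[OF norm_sp_mul])
       (auto simp: norm_csc norm_sp_mul intro!: mult_left_mono order_trans[OF norm_sp_mul])
  also have "\<dots> = ?e * (1/4 * (?e * ?e + 3 * ?e))" by (simp add: algebra_simps)
  also have "\<dots> \<le> ?e * (1/2)"
  proof (rule mult_left_mono)
    have "?e * ?e \<le> 1/2 * ?e" using a by (intro mult_right_mono) auto
    then show "1/4 * (?e * ?e + 3 * ?e) \<le> 1/2" using a by simp
  qed simp
  finally show ?thesis by simp
qed

lemma newt_NearMc: "A \<in> NearMc \<Longrightarrow> newt A \<in> NearMc"
proof -
  assume A: "A \<in> NearMc"
  then have "norm (defect (newt A)) < 1/2" using norm_defect_newt[of A] norm_ge_zero[of "defect A"] by (simp add: NearMc_def)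
  moreover have "adj (newt A) = newt A" "star (newt A) = - newt A"
    using A by (simp_all add: NearMc_def newt_def adj_lin star_lin spm_lin csc_lin)
  ultimately show ?thesis by (simp add: NearMc_def)
qed

definition newt_iter :: "nat \<Rightarrow> 'n::finite spmat \<Rightarrow> 'n spmat" where
  "newt_iter k A = (newt ^^ k) A"

lemma newt_iter_Suc: "newt_iter (Suc k) A = newt (newt_iter k A)" and newt_iter_0 [simp]: "newt_iter 0 A = A"
  by (simp_all add: newt_iter_def)

lemma newt_iter_NearMc: "A \<in> NearMc \<Longrightarrow> newt_iter k A \<in> NearMc"
  by (induction k) (simp_all add: newt_iter_Suc newt_NearMc)

lemma norm_defect_newt_iter: "A \<in> NearMc \<Longrightarrow> norm (defect (newt_iter k A)) \<le> (1/2) ^ k"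
proof (induction k)
  case 0
  then show ?case by (simp add: NearMc_def)
next
  case (Suc k)
  have "norm (defect (newt_iter k A)) < 1/2" using newt_iter_NearMc[OF Suc.prems, of k] by (simp add: NearMc_def)
  from norm_defect_newt[OF this] Suc show ?case by (simp add: newt_iter_Suc)
qed

definition NearMc_bound :: "'n::finite itself \<Rightarrow> real" where
  "NearMc_bound t = sqrt (2 * CARD('n) + norm (sp_id :: 'n spmat))"

text \<open>For hermitian \<open>A\<close> the squared norm is \<open>tr (A \<cdot> A)\<close>,
  which the defect controls. This uniform bound turns decay of the defect into convergence of the
  iterates.\<close>

lemma norm_NearMc: "A \<in> NearMc \<Longrightarrow> norm (A :: 'n::finite spmat) \<le> NearMc_bound TYPE('n)"
proof -
  assume A: "A \<in> NearMc"
  have "(norm A)\<^sup>2 = Re (tr (A \<cdot> A))" using A by (simp add: norm_sq_tr NearMc_def)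
  also have "A \<cdot> A = sp_id + defect A" by (simp add: defect_def)
  also have "Re (tr (sp_id + defect A)) = 2 * CARD('n) + inner sp_id (defect A)"
    by (simp add: tr_lin tr_id inner_tr)
  also have "inner sp_id (defect A) \<le> norm (sp_id :: 'n spmat) * norm (defect A)" by (rule norm_cauchy_schwarz)
  also have "\<dots> \<le> norm (sp_id :: 'n spmat) * 1" using A by (intro mult_left_mono) (auto simp: NearMc_def)
  finally show ?thesis by (simp add: NearMc_bound_def real_le_rsqrt)
qed

definition msign :: "'n::finite spmat \<Rightarrow> 'n spmat" where
  "msign A = lim (\<lambda>k. newt_iter k A)"

text \<open>Consecutive iterates differ by half of \<open>A \<cdot> defect A\<close>, which decays
  geometrically and uniformly. Uniformity is what gives continuity of the limit.\<close>

lemma msign_uniform: "uniform_limit NearMc newt_iter (msign :: 'n::finite spmat \<Rightarrow> _) sequentially"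
proof -
  have b: "norm (newt_iter (Suc k) A - newt_iter k A) \<le> NearMc_bound TYPE('n) * (1/2) ^ k" if A: "A \<in> NearMc" for k and A :: "'n spmat"
  proof -
    have "norm (newt_iter (Suc k) A - newt_iter k A) = 1/2 * norm (newt_iter k A \<cdot> defect (newt_iter k A))"
      unfolding newt_iter_Suc newt_diff norm_csc by simp
    also have "\<dots> \<le> norm (newt_iter k A \<cdot> defect (newt_iter k A))" by simp
    also have "\<dots> \<le> norm (newt_iter k A) * norm (defect (newt_iter k A))" by (rule norm_sp_mul)
    also have "\<dots> \<le> NearMc_bound TYPE('n) * (1/2) ^ k"
      using norm_NearMc[OF newt_iter_NearMc[OF A, of k]] norm_defect_newt_iter[OF A, of k] norm_ge_zero order_trans
      by (intro mult_mono) (auto simp: NearMc_bound_def)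
    finally show ?thesis .
  qed
  have "uniformly_convergent_on NearMc (\<lambda>n A. \<Sum>k<n. newt_iter (Suc k) A - newt_iter k A :: 'n spmat)"
    by (rule Weierstrass_m_test'[OF b]) (auto intro!: summable_mult summable_geometric)
  then have "uniformly_convergent_on NearMc (\<lambda>n A. newt_iter n A - A :: 'n spmat)"
    unfolding sum_lessThan_telescope[of "\<lambda>k. newt_iter k _"] by simp
  then obtain l where "uniform_limit NearMc (\<lambda>n A. newt_iter n A - A :: 'n spmat) l sequentially"
    by (auto simp: uniformly_convergent_on_def)
  then have "uniform_limit NearMc (\<lambda>n A. (newt_iter n A - A) + A :: 'n spmat) (\<lambda>A. l A + A) sequentially"
    by (intro uniform_limit_intros)
  then have u: "uniform_limit NearMc newt_iter (\<lambda>A. l A + A :: 'n spmat) sequentially" by simp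
  moreover have "l A + A = msign A" if "A \<in> NearMc" for A
    using tendsto_uniform_limitI[OF u that] by (simp add: msign_def limI)
  ultimately show ?thesis by (simp cong: uniform_limit_cong')
qed

lemma msign_limit: "A \<in> NearMc \<Longrightarrow> (\<lambda>k. newt_iter k A) \<longlonglongrightarrow> msign A"
  using tendsto_uniform_limitI[OF msign_uniform] .

lemma continuous_on_newt_iter: "continuous_on S (newt_iter k)"
proof (induction k)
  case (Suc k)
  then show ?case unfolding newt_iter_Suc[abs_def] newt_def by (intro continuous_intros)
qed (simp add: newt_iter_def id_def[symmetric] continuous_on_id)

lemma continuous_on_msign: "continuous_on NearMc msign"
  by (rule uniform_limit_theorem[OF _ msign_uniform]) (auto simp: continuous_on_newt_iter)

lemma msign_Mc: "A \<in> NearMc \<Longrightarrow> msign A \<in> Mc"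
proof -
  assume A: "A \<in> NearMc"
  note l = msign_limit[OF A]
  have 1: "(\<lambda>k. adj (newt_iter k A)) \<longlonglongrightarrow> adj (msign A)"
    using l linear_adj linear_conv_bounded_linear bounded_linear.tendsto by blast
  have 2: "(\<lambda>k. star (newt_iter k A)) \<longlonglongrightarrow> star (msign A)"
    using l bounded_linear_star bounded_linear.tendsto by blast
  have 3: "(\<lambda>k. defect (newt_iter k A)) \<longlonglongrightarrow> defect (msign A)"
    unfolding defect_def by (intro tendsto_intros bounded_bilinear.tendsto[OF bounded_bilinear_sp_mul] l)
  have 4: "(\<lambda>k. defect (newt_iter k A)) \<longlonglongrightarrow> 0"
    by (rule Lim_null_comparison[OF _ LIMSEQ_power_zero[of "1/2::real"]]) (use norm_defect_newt_iter[OF A] in auto)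
  have h: "adj (newt_iter k A) = newt_iter k A" "star (newt_iter k A) = - newt_iter k A" for k
    using newt_iter_NearMc[OF A, of k] by (auto simp: NearMc_def)
  have "adj (msign A) = msign A" using LIMSEQ_unique[OF 1] l by (simp add: h)
  moreover have "star (msign A) = - msign A" using LIMSEQ_unique[OF 2] tendsto_minus[OF l] by (simp add: h)
  moreover have "defect (msign A) = 0" using LIMSEQ_unique[OF 3 4] .
  ultimately show ?thesis by (simp add: Mc_def LagSplit'_def defect_def)
qed

lemma act_lin: "act g (A + B) = act g A + act g B" "act g (A - B) = act g A - act g B"
  "act g (csc c A) = csc c (act g A)"
  by (simp_all add: act_def spm_lin)

lemma linear_act: "linear (act g)"
  by (rule linearI) (simp_all add: act_lin scaleR_eq_csc)

lemma newt_iter_act: "g \<in> Sp \<Longrightarrow> newt_iter k (act g A) = act g (newt_iter k A)"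
  by (induction k) (simp_all add: newt_iter_Suc newt_def act_lin act_mul)

lemma act_sp_id: "g \<in> Sp \<Longrightarrow> act g sp_id = sp_id"
  by (simp add: act_def Sp_iff')

lemma adj_act: "g \<in> Ksp \<Longrightarrow> adj (act g A) = act g (adj A)"
  and star_act: "star (act g A) = act g (star A)"
proof -
  assume "g \<in> Ksp"
  then have "adj g = star g" "adj (star g) = g" by (auto simp: Ksp_def) (metis adj_adj)
  then show "adj (act g A) = act g (adj A)" by (simp add: act_def adj_lin spm_lin)
qed (simp add: act_def star_lin spm_lin)

lemma norm_act: "g \<in> Ksp \<Longrightarrow> norm (act g A) = norm A"
proof -
  assume g: "g \<in> Ksp"
  then have "(norm (act g A))\<^sup>2 = (norm A)\<^sup>2"
    by (simp add: norm_sq_tr adj_act tr_act Ksp_def)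
  then show ?thesis by (metis norm_ge_zero power2_eq_iff_nonneg)
qed

lemma defect_act: "g \<in> Sp \<Longrightarrow> defect (act g A) = act g (defect A)"
  by (simp add: defect_def act_lin act_mul act_sp_id)

lemma msign_act: "g \<in> Ksp \<Longrightarrow> A \<in> NearMc \<Longrightarrow> msign (act g A) = act g (msign A)"
proof -
  assume g: "g \<in> Ksp" and A: "A \<in> NearMc"
  have gS: "g \<in> Sp" using g by (simp add: Ksp_def)
  have "act g A \<in> NearMc" using A g gS
    by (simp add: NearMc_def adj_act star_act defect_act norm_act) (simp add: act_def spm_lin)
  then have "(\<lambda>k. newt_iter k (act g A)) \<longlonglongrightarrow> msign (act g A)" by (rule msign_limit)
  moreover have "(\<lambda>k. newt_iter k (act g A)) \<longlonglongrightarrow> act g (msign A)"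
    unfolding newt_iter_act[OF gS] using msign_limit[OF A] linear_act linear_conv_bounded_linear bounded_linear.tendsto by blast
  ultimately show ?thesis using LIMSEQ_unique by blast
qed

section \<open>An invariant measure on the compact form\<close>

text \<open>The average over the group generated by the commuting involutions \<open>adj\<close> and
  \<open>- star\<close>: the projection onto hermitian elements of the symplectic Lie algebra. It
  allows Lebesgue measure on the full matrix space to be used.\<close>

definition hproj :: "'n::finite spmat \<Rightarrow> 'n spmat" where
  "hproj X = csc (1/4) (X + adj X - star X - star (adj X))"

lemma adj_star_star: "adj (star X) = star (adj X)"
  by (simp add: star_adj)

lemma hproj_props: "adj (hproj X) = hproj X" "star (hproj X) = - hproj X"
  by (simp_all add: hproj_def adj_lin star_lin adj_star_star csc_lin)

lemma hproj_D: "hproj sp_D = sp_D"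
  by (simp add: hproj_def adj_D star_D vec_eq_iff)

lemma hproj_act: "g \<in> Ksp \<Longrightarrow> hproj (act g X) = act g (hproj X)"
  by (simp add: hproj_def act_lin adj_act star_act)

lemma continuous_on_hproj: "continuous_on S hproj"
  unfolding hproj_def by (intro continuous_intros)

text \<open>An open neighbourhood of \<open>sp_D\<close>, invariant under the compact group; the
  norm bound gives it finite Lebesgue measure.\<close>

definition SgnDom :: "'n::finite spmat set" where
  "SgnDom = {X. norm X < norm (sp_D :: 'n spmat) + 1 \<and> norm (defect (hproj X)) < 1/2}"

lemma open_SgnDom: "open SgnDom"
  unfolding SgnDom_def defect_def by (intro open_Collect_conj open_Collect_less continuous_intros continuous_on_hproj)

lemma D_in_SgnDom: "sp_D \<in> SgnDom"
  by (simp add: SgnDom_def hproj_D defect_def D_D)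

lemma hproj_NearMc: "X \<in> SgnDom \<Longrightarrow> hproj X \<in> NearMc"
  by (simp add: SgnDom_def NearMc_def hproj_props)

lemma act_SgnDom: "g \<in> Ksp \<Longrightarrow> act g X \<in> SgnDom \<longleftrightarrow> X \<in> SgnDom"
  using defect_act[of g] by (simp add: SgnDom_def hproj_act norm_act) (simp add: norm_act Ksp_def)

text \<open>Off the domain \<open>sp_D\<close> is a dummy value that keeps the image inside
  \<open>Mc\<close>.\<close>

definition msign_hproj :: "'n::finite spmat \<Rightarrow> 'n spmat" where
  "msign_hproj X = (if X \<in> SgnDom then msign (hproj X) else sp_D)"

lemma continuous_on_msign_hproj: "continuous_on SgnDom msign_hproj"
proof -
  have "continuous_on SgnDom (\<lambda>X. msign (hproj X))"
    by (rule continuous_on_compose2[OF continuous_on_msign continuous_on_hproj]) (auto intro: hproj_NearMc)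
  then show ?thesis by (rule continuous_on_eq) (simp add: msign_hproj_def)
qed

lemma msign_hproj_Mc: "msign_hproj X \<in> Mc"
  by (simp add: msign_hproj_def msign_Mc hproj_NearMc D_in_Mc)

lemma msign_hproj_act: "g \<in> Ksp \<Longrightarrow> X \<in> SgnDom \<Longrightarrow> msign_hproj (act g X) = act g (msign_hproj X)"
  by (simp add: msign_hproj_def act_SgnDom hproj_act msign_act hproj_NearMc)

lemma msign_hproj_D: "msign_hproj sp_D = sp_D"
proof -
  have "newt_iter k sp_D = (sp_D :: 'a spmat)" for k
  proof (induction k)
    case (Suc k)
    show ?case unfolding newt_iter_Suc Suc.IH by (simp add: newt_def D_D) (simp add: vec_eq_iff)
  qed simp
  then show ?thesis using D_in_SgnDom by (simp add: msign_hproj_def hproj_D msign_def)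
qed

lemma msign_hproj_measurable [measurable]: "msign_hproj \<in> measurable (restrict_space lborel SgnDom) borel"
proof -
  have "msign_hproj \<in> borel_measurable (restrict_space borel SgnDom)"
    by (rule borel_measurable_continuous_on_restrict[OF continuous_on_msign_hproj])
  moreover have "sets (restrict_space lborel SgnDom) = sets (restrict_space borel SgnDom)"
    by (rule sets_restrict_space_cong) simp
  ultimately show ?thesis using measurable_cong_sets by blast
qed

text \<open>Conjugation by the compact group is a linear isometry and commutes with the retraction,
  so the push-forward of Lebesgue measure is invariant.\<close>

definition mu :: "'n::finite spmat measure" where
  "mu = distr (restrict_space lborel SgnDom) borel msign_hproj"

lemma sets_mu [simp, measurable_cong]: "sets mu = sets borel" and space_mu [simp]: "space mu = UNIV"
  by (simp_all add: mu_def)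

lemma SgnDom_borel: "SgnDom \<in> sets borel"
  by (simp add: open_SgnDom)

lemma msign_hproj_vimage_borel:
  fixes S :: "'n::finite spmat set"
  assumes "S \<in> sets borel"
  shows "msign_hproj -` S \<inter> SgnDom \<in> sets borel"
proof -
  have "msign_hproj -` S \<inter> space (restrict_space lborel SgnDom) \<in> sets (restrict_space lborel (SgnDom :: 'n spmat set))"
    by (rule measurable_sets[OF msign_hproj_measurable assms])
  moreover have "SgnDom \<inter> space lborel \<in> sets (lborel :: 'n spmat measure)" using SgnDom_borel by simp
  ultimately show ?thesis by (simp add: space_restrict_space sets_restrict_space_iff)
qed

lemma emeasure_mu:
  fixes S :: "'n::finite spmat set"
  assumes "S \<in> sets borel"
  shows "emeasure mu S = emeasure lborel (msign_hproj -` S \<inter> SgnDom)"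
proof -
  have B: "SgnDom \<inter> space lborel \<in> sets (lborel :: 'n spmat measure)" using SgnDom_borel by simp
  have "emeasure mu S = emeasure (restrict_space lborel SgnDom) (msign_hproj -` S \<inter> SgnDom)"
    unfolding mu_def using assms by (subst emeasure_distr) (simp_all add: space_restrict_space)
  also have "\<dots> = emeasure lborel (msign_hproj -` S \<inter> SgnDom)"
    by (rule emeasure_restrict_space[OF B]) simp
  finally show ?thesis .
qed

lemma finite_measure_mu: "finite_measure (mu :: 'n::finite spmat measure)"
proof
  have "bounded (SgnDom :: 'n spmat set)"
    unfolding bounded_iff by (rule exI[of _ "norm (sp_D :: 'n spmat) + 1"]) (auto simp: SgnDom_def)
  then have "emeasure lborel (SgnDom :: 'n spmat set) < \<infinity>" by (rule emeasure_bounded_finite)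
  then show "emeasure mu (space (mu :: 'n spmat measure)) \<noteq> \<infinity>" by (simp add: emeasure_mu)
qed

lemma AE_mu_Mc: "AE q in (mu :: 'n::finite spmat measure). q \<in> Mc"
proof -
  have "msign_hproj -` (- Mc) \<inter> SgnDom = ({} :: 'n spmat set)" using msign_hproj_Mc by auto
  then have "emeasure mu (- Mc :: 'n spmat set) = 0" using emeasure_mu[OF borel_open[OF open_Compl[OF closed_Mc]], where 'n='n] by simp
  then have "- Mc \<in> null_sets (mu :: 'n spmat measure)" using borel_open[OF open_Compl[OF closed_Mc]] by (simp add: null_sets_def)
  then show ?thesis by (rule AE_I') auto
qed

lemma distr_mu:
  assumes g: "g \<in> Ksp"
  shows "distr mu borel (act g) = mu"
proof (rule measure_eqI)
  fix S assume "S \<in> sets (distr mu borel (act g))"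
  then have S: "S \<in> sets borel" by simp
  have m: "act g \<in> borel_measurable borel"
    by (intro borel_measurable_continuous_onI continuous_intros)
  have S': "act g -` S \<in> sets borel" using measurable_sets[OF m S] by simp
  have "emeasure (distr mu borel (act g)) S = emeasure mu (act g -` S)"
    using m S by (subst emeasure_distr) auto
  also have "\<dots> = emeasure lborel (msign_hproj -` (act g -` S) \<inter> SgnDom)" using S' by (rule emeasure_mu)
  also have "msign_hproj -` (act g -` S) \<inter> SgnDom = act g -` (msign_hproj -` S \<inter> SgnDom)"
    using g by (auto simp: msign_hproj_act act_SgnDom)
  also have "emeasure lborel \<dots> = emeasure lborel (msign_hproj -` S \<inter> SgnDom)"
  proof (rule emeasure_lborel_isometry)
    show "surj (act g)"
      using g by (intro surjI[of _ "act (star g)"]) (simp add: act_act Ksp_def Sp_iff')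
  qed (use g in \<open>auto simp: linear_act norm_act msign_hproj_vimage_borel S\<close>)
  also have "\<dots> = emeasure mu S" using S by (rule emeasure_mu[symmetric])
  finally show "emeasure (distr mu borel (act g)) S = emeasure mu S" .
qed simp

text \<open>The retraction is continuous and fixes \<open>sp_D\<close>, so the preimage of the ball
  is open and nonempty.\<close>

lemma measure_mu_pos:
  assumes "e > 0"
  shows "measure mu (ball sp_D e :: 'n::finite spmat set) > 0"
proof -
  interpret finite_measure "mu :: 'n spmat measure" by (rule finite_measure_mu)
  have "open (msign_hproj -` ball sp_D e \<inter> SgnDom :: 'n spmat set)"
    using continuous_on_open_vimage[OF open_SgnDom] continuous_on_msign_hproj open_ball by blast
  moreover have "sp_D \<in> msign_hproj -` ball sp_D e \<inter> SgnDom" using assms by (simp add: msign_hproj_D D_in_SgnDom)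
  ultimately obtain r where r: "r > 0" "ball sp_D r \<subseteq> msign_hproj -` ball sp_D e \<inter> (SgnDom :: 'n spmat set)"
    using open_contains_ball by blast
  have "0 < emeasure lborel (ball (sp_D :: 'n spmat) r)"
    using content_ball_pos[OF r(1), of "sp_D :: 'n spmat"]
    by (metis not_gr_zero less_irrefl measure_def enn2real_0)
  also have "\<dots> \<le> emeasure lborel (msign_hproj -` ball sp_D e \<inter> (SgnDom :: 'n spmat set))"
    by (rule emeasure_mono[OF r(2)]) (simp add: msign_hproj_vimage_borel)
  finally have "0 < emeasure mu (ball sp_D e :: 'n spmat set)" by (simp add: emeasure_mu)
  then show ?thesis by (simp add: emeasure_eq_measure)
qed

text \<open>The cutoff makes the integrand measurable for functions that are known to be continuous
  on \<open>Mc\<close> only.\<close>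

definition Ic :: "('n::finite spmat \<Rightarrow> complex) \<Rightarrow> complex" where
  "Ic h = (\<integral>q. (if q \<in> Mc then h q else 0) \<partial>mu)"

lemma Mc_borel: "Mc \<in> sets borel"
  by (rule borel_closed[OF closed_Mc])

lemma Ic_measurable:
  assumes "continuous_on Mc h"
  shows "(\<lambda>q. if q \<in> Mc then h q else 0 :: complex) \<in> borel_measurable borel"
  using assms by (intro borel_measurable_continuous_on_if Mc_borel) auto

lemma Mc_bounded:
  assumes "continuous_on Mc h"
  obtains B where "\<And>q. q \<in> Mc \<Longrightarrow> cmod (h q) \<le> B" "0 \<le> B"
proof -
  have "bounded (h ` Mc)" using assms compact_Mc by (intro compact_imp_bounded compact_continuous_image)
  then obtain B where "\<And>q. q \<in> Mc \<Longrightarrow> cmod (h q) \<le> B" unfolding bounded_iff by auto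
  then show ?thesis using that[of "max B 0"] by fastforce
qed

lemma Ic_integrable:
  fixes h :: "'n::finite spmat \<Rightarrow> complex"
  assumes h: "continuous_on Mc h"
  shows "integrable mu (\<lambda>q. if q \<in> Mc then h q else 0)"
proof -
  interpret finite_measure "mu :: 'n spmat measure" by (rule finite_measure_mu)
  obtain B where "\<And>q. q \<in> Mc \<Longrightarrow> cmod (h q) \<le> B" "0 \<le> B" using Mc_bounded[OF h] by blast
  then show ?thesis using Ic_measurable[OF h]
    by (intro integrable_const_bound[of _ B]) auto
qed

lemma Ic_cong: "(\<And>q. q \<in> Mc \<Longrightarrow> f q = g q) \<Longrightarrow> Ic f = Ic g"
  unfolding Ic_def by (intro Bochner_Integration.integral_cong) auto

lemma Ic_add: "continuous_on Mc f \<Longrightarrow> continuous_on Mc g \<Longrightarrow> Ic (\<lambda>q. f q + g q) = Ic f + Ic g"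
proof -
  assume a: "continuous_on Mc f" "continuous_on Mc g"
  have "(\<lambda>q. if q \<in> Mc then f q + g q else 0) = (\<lambda>q. (if q \<in> Mc then f q else 0) + (if q \<in> Mc then g q else 0))"
    by auto
  then show ?thesis unfolding Ic_def
    by (simp only: Bochner_Integration.integral_add[OF Ic_integrable[OF a(1)] Ic_integrable[OF a(2)]])
qed

lemma Ic_cmult: "continuous_on Mc f \<Longrightarrow> Ic (\<lambda>q. c * f q) = c * Ic f"
proof -
  assume a: "continuous_on Mc f"
  have "(\<lambda>q. if q \<in> Mc then c * f q else 0) = (\<lambda>q. c * (if q \<in> Mc then f q else 0))" by auto
  then show ?thesis unfolding Ic_def by simp
qed

lemma Ic_diff: "continuous_on Mc f \<Longrightarrow> continuous_on Mc g \<Longrightarrow> Ic (\<lambda>q. f q - g q) = Ic f - Ic g"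
proof -
  assume a: "continuous_on Mc f" "continuous_on Mc g"
  have "Ic (\<lambda>q. f q + (- 1) * g q) = Ic f + (- 1) * Ic g"
    unfolding Ic_cmult[OF a(2), symmetric] by (intro Ic_add a continuous_on_mult continuous_on_const)
  then show ?thesis by simp
qed

lemma Ic_sum: "(\<And>i. i \<in> S \<Longrightarrow> continuous_on Mc (f i)) \<Longrightarrow> Ic (\<lambda>q. \<Sum>i\<in>S. f i q) = (\<Sum>i\<in>S. Ic (f i))"
proof (induction S rule: infinite_finite_induct)
  case (insert x F)
  then show ?case by (simp add: Ic_add continuous_on_sum)
qed (auto simp: Ic_def cong: if_cong)

lemma Ic_Ksp:
  assumes k: "k \<in> Ksp" and h: "continuous_on Mc h"
  shows "Ic (\<lambda>q. h (act k q)) = Ic h"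
proof -
  have m: "act k \<in> borel_measurable borel"
    by (intro borel_measurable_continuous_onI continuous_intros)
  have iff: "act k q \<in> Mc \<longleftrightarrow> q \<in> Mc" for q
  proof
    assume "act k q \<in> Mc"
    then have "act (star k) (act k q) \<in> Mc" using Mc_act Ksp_star k by blast
    then show "q \<in> Mc" using k by (simp add: act_act Ksp_def Sp_iff)
  qed (use Mc_act k in blast)
  have "Ic h = (\<integral>q. (if q \<in> Mc then h q else 0) \<partial>distr mu borel (act k))"
    by (simp add: Ic_def distr_mu[OF k])
  also have "\<dots> = (\<integral>q. (if act k q \<in> Mc then h (act k q) else 0) \<partial>mu)"
    using m Ic_measurable[OF h] by (subst integral_distr) auto
  finally show ?thesis by (simp add: Ic_def iff)
qed

text \<open>Differentiation under the integral by dominated convergence. Compactness of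
  \<open>Mc\<close> bounds the integrand near \<open>z0\<close>, and Cauchy's inequality turns this
  into a Lipschitz bound for the difference quotients.\<close>

lemma holomorphic_Ic:
  fixes \<phi> :: "complex \<Rightarrow> 'n::finite spmat \<Rightarrow> complex"
  assumes \<Omega>: "open \<Omega>" and hol: "\<And>q. q \<in> Mc \<Longrightarrow> (\<lambda>z. \<phi> z q) holomorphic_on \<Omega>"
    and cont: "continuous_on (\<Omega> \<times> Mc) (\<lambda>(z, q). \<phi> z q)"
  shows "(\<lambda>z. Ic (\<phi> z)) holomorphic_on \<Omega>"
proof -
  interpret finite_measure "mu :: 'n spmat measure" by (rule finite_measure_mu)
  have c1: "continuous_on Mc (\<phi> z)" if "z \<in> \<Omega>" for z
  proof -
    have "continuous_on Mc (\<lambda>q. (z, q))" by (intro continuous_on_Pair continuous_on_const continuous_on_id)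
    from continuous_on_compose2[OF cont this] show ?thesis using that by auto
  qed
  have "\<exists>D. ((\<lambda>z. Ic (\<phi> z)) has_field_derivative D) (at z0)" if z0: "z0 \<in> \<Omega>" for z0
  proof -
    obtain r where r: "r > 0" "cball z0 r \<subseteq> \<Omega>" using \<Omega> z0 open_contains_cball by blast
    have "compact (cball z0 r \<times> (Mc :: 'n spmat set))" by (intro compact_Times compact_cball compact_Mc)
    moreover have "continuous_on (cball z0 r \<times> Mc) (\<lambda>(z, q). \<phi> z q)"
      by (rule continuous_on_subset[OF cont]) (use r in auto)
    ultimately have "bounded ((\<lambda>(z, q). \<phi> z q) ` (cball z0 r \<times> Mc))"
      by (intro compact_imp_bounded compact_continuous_image)
    then obtain B where B: "\<And>z q. z \<in> cball z0 r \<Longrightarrow> q \<in> Mc \<Longrightarrow> cmod (\<phi> z q) \<le> B"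
      unfolding bounded_iff by fastforce
    \<comment> \<open>Circles of radius \<open>r/2\<close> about points of
      \<open>ball z0 (r/2)\<close> stay in \<open>cball z0 r\<close>, so Cauchy's inequality bounds
      the derivative by \<open>C\<close> uniformly in \<open>q\<close>.\<close>
    define C where "C = B / (r/2)"
    define Q where "Q w q = (if q \<in> Mc then (\<phi> w q - \<phi> z0 q) / (w - z0) else 0)" for w q
    have lip: "cmod (\<phi> w q - \<phi> z0 q) \<le> C * cmod (w - z0)" if q: "q \<in> Mc" and w: "w \<in> ball z0 (r/2)" for w q
    proof (rule field_differentiable_bound[of "ball z0 (r/2)" "\<lambda>z. \<phi> z q" "deriv (\<lambda>z. \<phi> z q)"])
      fix x assume x: "x \<in> ball z0 (r/2)"
      have sub: "cball x (r/2) \<subseteq> cball z0 r"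
      proof
        fix y assume "y \<in> cball x (r/2)"
        then show "y \<in> cball z0 r" using x dist_triangle[of z0 y x] by simp
      qed
      have h: "(\<lambda>z. \<phi> z q) holomorphic_on cball x (r/2)"
        using hol[OF q] holomorphic_on_subset sub r(2) by blast
      have "x \<in> cball x (r/2)" using r(1) by simp
      then have "x \<in> \<Omega>" using sub r(2) by blast
      then show "((\<lambda>z. \<phi> z q) has_field_derivative deriv (\<lambda>z. \<phi> z q) x) (at x within ball z0 (r/2))"
        using hol[OF q] \<Omega> holomorphic_derivI by blast
      have "norm ((deriv ^^ 1) (\<lambda>z. \<phi> z q) x) \<le> fact 1 * B / (r/2) ^ 1"
      proof (rule Cauchy_inequality)
        show "(\<lambda>z. \<phi> z q) holomorphic_on ball x (r/2)" using h holomorphic_on_subset ball_subset_cball by blast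
        show "continuous_on (cball x (r/2)) (\<lambda>z. \<phi> z q)" using h by (rule holomorphic_on_imp_continuous_on)
        show "cmod (\<phi> y q) \<le> B" if "cmod (x - y) = r/2" for y
          using that sub by (intro B q) (auto simp: dist_norm subset_iff)
      qed (use r in simp)
      then show "norm (deriv (\<lambda>z. \<phi> z q) x) \<le> C" by (simp add: C_def)
    qed (use w r in auto)
    define D where "D = (\<integral>q. (if q \<in> Mc then deriv (\<lambda>z. \<phi> z q) z0 else 0) \<partial>mu)"
    have "((\<lambda>w. (Ic (\<phi> w) - Ic (\<phi> z0)) / (w - z0)) \<longlongrightarrow> D) (at z0 within ball z0 (r/2))"
      unfolding tendsto_at_iff_sequentially
    proof (intro allI impI)
      fix X :: "nat \<Rightarrow> complex"
      assume X: "\<forall>i. X i \<in> ball z0 (r/2) - {z0}" and lim: "X \<longlonglongrightarrow> z0"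
      have X\<Omega>: "X i \<in> \<Omega>" for i
      proof -
        have "dist z0 (X i) < r/2" using X by simp
        then have "X i \<in> cball z0 r" using r(1) by simp
        then show ?thesis using r(2) by blast
      qed
      have Qc: "continuous_on Mc (\<lambda>q. (\<phi> (X i) q - \<phi> z0 q) / (X i - z0))" for i
        using X by (intro continuous_intros c1 X\<Omega> z0) auto
      have Qm: "Q (X i) \<in> borel_measurable mu" for i
        using Ic_measurable[OF Qc[of i]] by (simp add: Q_def[abs_def])
      have pt: "(\<lambda>i. Q (X i) q) \<longlonglongrightarrow> (if q \<in> Mc then deriv (\<lambda>z. \<phi> z q) z0 else 0)" for q
      proof (cases "q \<in> Mc")
        case True
        then have "((\<lambda>z. \<phi> z q) has_field_derivative deriv (\<lambda>z. \<phi> z q) z0) (at z0)"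
          using hol \<Omega> z0 holomorphic_derivI by blast
        then have "((\<lambda>w. (\<phi> w q - \<phi> z0 q) / (w - z0)) \<longlongrightarrow> deriv (\<lambda>z. \<phi> z q) z0) (at z0)"
          by (simp add: has_field_derivative_iff)
        then have "(\<lambda>i. (\<phi> (X i) q - \<phi> z0 q) / (X i - z0)) \<longlonglongrightarrow> deriv (\<lambda>z. \<phi> z q) z0"
          using X lim unfolding tendsto_at_iff_sequentially comp_def by auto
        then show ?thesis using True by (simp add: Q_def)
      qed (simp add: Q_def)
      have "(\<lambda>i. \<integral>q. Q (X i) q \<partial>mu) \<longlonglongrightarrow> D"
        unfolding D_def
      proof (rule integral_dominated_convergence[where w="\<lambda>_. \<bar>C\<bar>"])
        show "(\<lambda>q. if q \<in> Mc then deriv (\<lambda>z. \<phi> z q) z0 else 0) \<in> borel_measurable mu"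
          by (rule borel_measurable_LIMSEQ_metric[OF Qm pt])
        show "AE q in mu. cmod (Q (X i) q) \<le> \<bar>C\<bar>" for i
        proof (rule AE_I2)
          fix q
          have "X i \<noteq> z0" "X i \<in> ball z0 (r/2)" using X by auto
          then show "cmod (Q (X i) q) \<le> \<bar>C\<bar>" using lip[of q "X i"]
            by (auto simp: Q_def norm_divide divide_simps) (smt (verit) mult_right_mono norm_ge_zero)
        qed
        show "AE q in mu. (\<lambda>i. Q (X i) q) \<longlonglongrightarrow> (if q \<in> Mc then deriv (\<lambda>z. \<phi> z q) z0 else 0)"
          using pt by (intro AE_I2)
      qed (use Qm in auto)
      moreover have "(\<integral>q. Q (X i) q \<partial>mu) = (Ic (\<phi> (X i)) - Ic (\<phi> z0)) / (X i - z0)" for i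
      proof -
        have "(\<integral>q. Q (X i) q \<partial>mu) = Ic (\<lambda>q. (1 / (X i - z0)) * (\<phi> (X i) q - \<phi> z0 q))"
          unfolding Ic_def Q_def by (simp cong: if_cong)
        also have "\<dots> = (1 / (X i - z0)) * (Ic (\<phi> (X i)) - Ic (\<phi> z0))"
          unfolding Ic_cmult[OF continuous_on_diff[OF c1[OF X\<Omega>] c1[OF z0]]] Ic_diff[OF c1[OF X\<Omega>] c1[OF z0]] ..
        finally show ?thesis by simp
      qed
      ultimately show "((\<lambda>w. (Ic (\<phi> w) - Ic (\<phi> z0)) / (w - z0)) \<circ> X) \<longlonglongrightarrow> D"
        by (simp add: comp_def)
    qed
    then have "((\<lambda>z. Ic (\<phi> z)) has_field_derivative D) (at z0 within ball z0 (r/2))"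
      by (simp add: has_field_derivative_iff)
    then show ?thesis using r by (auto simp: at_within_open[of z0 "ball z0 (r/2)"])
  qed
  then show ?thesis unfolding holomorphic_on_def field_differentiable_def
    using has_field_derivative_at_within by blast
qed

section \<open>Holomorphic functions on the manifold\<close>

definition HolM :: "('n::finite spmat \<Rightarrow> complex) \<Rightarrow> bool" where
  "HolM f \<longleftrightarrow> (\<forall>p\<in>LagSplit. \<exists>U F. open U \<and> p \<in> U \<and> chol1 U F \<and> (\<forall>q\<in>U \<inter> LagSplit. F q = f q))"

lemma HolM_I: "(\<And>p. p \<in> LagSplit \<Longrightarrow> \<exists>U F. open U \<and> p \<in> U \<and> chol1 U F \<and> (\<forall>q\<in>U \<inter> LagSplit. F q = f q)) \<Longrightarrow> HolM f"
  unfolding HolM_def by (rule ballI)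

lemma HolM_E:
  assumes "HolM f" "p \<in> LagSplit"
  obtains U F where "open U" "p \<in> U" "chol1 U F" "\<And>q. q \<in> U \<Longrightarrow> q \<in> LagSplit \<Longrightarrow> F q = f q"
proof -
  obtain U F where "open U" "p \<in> U" "chol1 U F" "\<forall>q\<in>U \<inter> LagSplit. F q = f q"
    using assms(1)[unfolded HolM_def, THEN bspec, OF assms(2)] by (elim exE conjE)
  then show ?thesis by (intro that[of U F]) simp_all
qed

lemma chol1_subset: "chol1 U f \<Longrightarrow> V \<subseteq> U \<Longrightarrow> chol1 V f"
  unfolding chol1_def by blast

lemma HolM_Pol: "f \<in> Pol \<Longrightarrow> HolM f"
  unfolding HolM_def using Pol_chol1[of f] by (intro ballI exI[of _ UNIV] exI[of _ f]) simp

lemma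
  assumes f: "HolM f" and g: "HolM g"
  shows HolM_add: "HolM (\<lambda>x. f x + g x)" and HolM_mult: "HolM (\<lambda>x. f x * g x)"
proof -
  have "\<exists>U F G. open U \<and> p \<in> U \<and> chol1 U F \<and> chol1 U G \<and> (\<forall>q\<in>U \<inter> LagSplit. F q = f q \<and> G q = g q)"
    if p: "p \<in> LagSplit" for p
  proof -
    obtain U F where 1: "open U" "p \<in> U" "chol1 U F" "\<And>q. q \<in> U \<Longrightarrow> q \<in> LagSplit \<Longrightarrow> F q = f q"
      using HolM_E[OF f p] by blast
    obtain V G where 2: "open V" "p \<in> V" "chol1 V G" "\<And>q. q \<in> V \<Longrightarrow> q \<in> LagSplit \<Longrightarrow> G q = g q"
      using HolM_E[OF g p] by blast
    show ?thesis using 1 2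
      by (intro exI[of _ "U \<inter> V"] exI[of _ F] exI[of _ G]) (auto intro: chol1_subset)
  qed
  note fg = this
  show "HolM (\<lambda>x. f x + g x)"
  proof (rule HolM_I)
    fix p :: "'a spmat" assume "p \<in> LagSplit"
    from fg[OF this] obtain U F G where "open U" "p \<in> U" "chol1 U F" "chol1 U G" "\<forall>q\<in>U \<inter> LagSplit. F q = f q \<and> G q = g q"
      by (elim exE conjE)
    then show "\<exists>U F. open U \<and> p \<in> U \<and> chol1 U F \<and> (\<forall>q\<in>U \<inter> LagSplit. F q = f q + g q)"
      by (intro exI[of _ U] exI[of _ "\<lambda>x. F x + G x"]) (simp add: chol1_add)
  qed
  show "HolM (\<lambda>x. f x * g x)"
  proof (rule HolM_I)
    fix p :: "'a spmat" assume "p \<in> LagSplit"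
    from fg[OF this] obtain U F G where "open U" "p \<in> U" "chol1 U F" "chol1 U G" "\<forall>q\<in>U \<inter> LagSplit. F q = f q \<and> G q = g q"
      by (elim exE conjE)
    then show "\<exists>U F. open U \<and> p \<in> U \<and> chol1 U F \<and> (\<forall>q\<in>U \<inter> LagSplit. F q = f q * g q)"
      by (intro exI[of _ U] exI[of _ "\<lambda>x. F x * G x"]) (simp add: chol1_mult)
  qed
qed

lemma HolM_sum: "(\<And>i. i \<in> S \<Longrightarrow> HolM (f i)) \<Longrightarrow> HolM (\<lambda>x. \<Sum>i\<in>S. f i x)"
proof (induction S rule: infinite_finite_induct)
  case (insert i S)
  have "HolM (\<lambda>x. f i x + (\<Sum>j\<in>S. f j x))"
    by (rule HolM_add[OF insert.prems insert.IH]) (use insert.prems in auto)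
  then show ?case using insert.hyps by simp
qed (simp_all add: HolM_Pol Pol.const)

lemma HolM_act:
  assumes f: "HolM f" and g: "g \<in> Sp"
  shows "HolM (\<lambda>A. f (act g A))"
proof (rule HolM_I)
  fix p :: "'a spmat" assume "p \<in> LagSplit"
  then have "act g p \<in> LagSplit" using act_in_LagSplit g by blast
  then obtain U F where U: "open U" "act g p \<in> U" "chol1 U F" "\<And>q. q \<in> U \<Longrightarrow> q \<in> LagSplit \<Longrightarrow> F q = f q"
    using HolM_E[OF f] by blast
  have l: "bounded_linear (act g)" using linear_act linear_conv_bounded_linear by blast
  have "open (act g -` U)"
    using U(1) by (intro open_vimage continuous_intros)
  moreover have "chol1 (act g -` U) (\<lambda>A. F (act g A))"
    unfolding chol1_def
  proof
    fix x assume "x \<in> act g -` U"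
    then obtain L where L: "(F has_derivative L) (at (act g x))" "\<And>c v. L (csc c v) = c * L v"
      using U(3) unfolding chol1_def by auto
    have "((\<lambda>A. F (act g A)) has_derivative (\<lambda>v. L (act g v))) (at x)"
      using diff_chain_at[OF bounded_linear_imp_has_derivative[OF l] L(1)] by (simp add: comp_def)
    then show "\<exists>L. ((\<lambda>A. F (act g A)) has_derivative L) (at x) \<and> (\<forall>c v. L (csc c v) = c * L v)"
      using L(2) by (intro exI[of _ "\<lambda>v. L (act g v)"]) (simp add: act_lin)
  qed
  ultimately show "\<exists>U F. open U \<and> p \<in> U \<and> chol1 U F \<and> (\<forall>q\<in>U \<inter> LagSplit. F q = f (act g q))"
    using U act_in_LagSplit[OF g]
    by (intro exI[of _ "act g -` U"] exI[of _ "\<lambda>A. F (act g A)"]) auto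
qed

lemma HolM_continuous: "HolM f \<Longrightarrow> continuous_on LagSplit f"
  unfolding continuous_on_eq_continuous_within
proof
  fix p :: "'a spmat" assume f: "HolM f" and p: "p \<in> LagSplit"
  obtain U F where U: "open U" "p \<in> U" "chol1 U F" "\<And>q. q \<in> U \<Longrightarrow> q \<in> LagSplit \<Longrightarrow> F q = f q"
    using HolM_E[OF f p] by blast
  have "isCont F p" using U(2,3) has_derivative_continuous unfolding chol1_def by blast
  then have "continuous (at p within LagSplit) F" by (rule continuous_at_imp_continuous_at_within)
  moreover have "\<forall>\<^sub>F q in at p within LagSplit. F q = f q"
    using U(1,2,4) unfolding eventually_at_topological by blast
  ultimately show "continuous (at p within LagSplit) f"
    unfolding continuous_within using U(4)[OF U(2) p] by (metis tendsto_cong)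
qed

lemma Mc_LagSplit: "Mc \<subseteq> LagSplit"
  by (auto simp: LagSplit_eq Mc_def)

definition CDiff :: "(complex \<Rightarrow> 'n::finite spmat) \<Rightarrow> complex \<Rightarrow> bool" where
  "CDiff c z \<longleftrightarrow> (\<exists>d. (c has_derivative (\<lambda>s. csc s d)) (at z))"

lemma CDiff_const: "CDiff (\<lambda>z. A) z"
  unfolding CDiff_def by (intro exI[of _ 0]) simp

lemma CDiff_add: "CDiff c z \<Longrightarrow> CDiff d z \<Longrightarrow> CDiff (\<lambda>z. c z + d z) z"
proof -
  assume "CDiff c z" "CDiff d z"
  then obtain c' d' where "(c has_derivative (\<lambda>s. csc s c')) (at z)" "(d has_derivative (\<lambda>s. csc s d')) (at z)"
    unfolding CDiff_def by blast
  from has_derivative_add[OF this] show ?thesis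
    unfolding CDiff_def by (intro exI[of _ "c' + d'"]) (simp add: csc_lin)
qed

lemma CDiff_mul: "CDiff c z \<Longrightarrow> CDiff d z \<Longrightarrow> CDiff (\<lambda>z. c z \<cdot> d z) z"
proof -
  assume "CDiff c z" "CDiff d z"
  then obtain c' d' where "(c has_derivative (\<lambda>s. csc s c')) (at z)" "(d has_derivative (\<lambda>s. csc s d')) (at z)"
    unfolding CDiff_def by blast
  from bounded_bilinear.FDERIV[OF bounded_bilinear_sp_mul this] show ?thesis
    unfolding CDiff_def by (intro exI[of _ "c z \<cdot> d' + c' \<cdot> d z"]) (simp add: spm_lin csc_lin)
qed

lemma CDiff_csc: "(f has_field_derivative f') (at z) \<Longrightarrow> CDiff d z \<Longrightarrow> CDiff (\<lambda>z. csc (f z) (d z)) z"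
proof -
  assume f: "(f has_field_derivative f') (at z)" and "CDiff d z"
  then obtain d' where "(d has_derivative (\<lambda>s. csc s d')) (at z)"
    unfolding CDiff_def by blast
  from bounded_bilinear.FDERIV[OF bounded_bilinear_csc f[unfolded has_field_derivative_def] this] show ?thesis
    unfolding CDiff_def by (intro exI[of _ "csc (f z) d' + csc f' (d z)"]) (simp add: csc_lin mult.commute)
qed

lemma HolM_holomorphic:
  assumes f: "HolM f" and \<Omega>: "open \<Omega>" and c: "\<And>z. z \<in> \<Omega> \<Longrightarrow> c z \<in> LagSplit" "\<And>z. z \<in> \<Omega> \<Longrightarrow> CDiff c z"
  shows "(\<lambda>z. f (c z)) holomorphic_on \<Omega>"
  unfolding holomorphic_on_open[OF \<Omega>]
proof
  fix z assume z: "z \<in> \<Omega>"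
  obtain U F where U: "open U" "c z \<in> U" "chol1 U F" "\<And>q. q \<in> U \<Longrightarrow> q \<in> LagSplit \<Longrightarrow> F q = f q"
    using HolM_E[OF f c(1)[OF z]] by blast
  obtain L where L: "(F has_derivative L) (at (c z))" "\<And>a v. L (csc a v) = a * L v"
    using U(2,3) unfolding chol1_def by blast
  obtain d where d: "(c has_derivative (\<lambda>s. csc s d)) (at z)" using c(2)[OF z] unfolding CDiff_def by blast
  have "((\<lambda>z. F (c z)) has_field_derivative L d) (at z)"
    unfolding has_field_derivative_def
    using diff_chain_at[OF d L(1)] by (simp add: comp_def L(2) mult.commute[of _ "L d"])
  moreover have "isCont c z" using d has_derivative_continuous by blast
  then have "\<forall>\<^sub>F w in at z. c w \<in> U"
    using U(1,2) by (metis isCont_def topological_tendstoD)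
  then have "\<forall>\<^sub>F w in nhds z. c w \<in> U" using U(2) by (simp add: eventually_nhds_conv_at)
  then have "\<forall>\<^sub>F w in nhds z. F (c w) = f (c w)"
    using eventually_nhds_in_open[OF \<Omega> z] by eventually_elim (use U(4) c(1) in auto)
  ultimately have "((\<lambda>z. f (c z)) has_field_derivative L d) (at z)"
    using DERIV_cong_ev[of z z "\<lambda>w. F (c w)" "\<lambda>w. f (c w)" "L d" "L d"] by simp
  then show "\<exists>f'. ((\<lambda>z. f (c z)) has_field_derivative f') (at z)" by blast
qed

section \<open>Invariance under the complex group\<close>

text \<open>The family \<open>k z\<close> lies in the compact group for real \<open>z\<close> and equals the transvection at \<open>z = - \<i>\<close>.\<close>

lemma Ic_transvection:
  fixes h :: "'n::finite spmat \<Rightarrow> complex"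
  assumes h: "HolM h"
  shows "Ic (\<lambda>q. h (act (transv v 1) q)) = Ic h"
proof (cases "v = 0")
  case True
  have "transv v 1 = sp_id" unfolding True by (intro spmat_eqI) (simp add: mv_transv)
  then show ?thesis by simp
next
  case False
  define r where "r = (norm v)\<^sup>2"
  have r: "r > 0" using False by (simp add: r_def)
  define a where "a z = (1 + \<i> * z) / 4" for z
  define b where "b z = (1 - \<i> * z) / 4" for z
  \<comment> \<open>The modulus of the zeros of \<open>1 + cN v (a z) (b z)\<close>. Since it
    exceeds 1, the disc avoids the poles of the Cayley transform and still contains
    \<open>- \<i>\<close>.\<close>
  define \<rho> where "\<rho> = sqrt (1 + 16 / r\<^sup>2)"
  have \<rho>: "\<rho> > 1" using r by (simp add: \<rho>_def)
  have N: "cN v (a z) (b z) = (1 + z\<^sup>2) * of_real (r\<^sup>2) / 16" for z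
    by (simp add: cN_def a_def b_def hin_self r_def field_simps power2_eq_square)
  have N0: "1 + cN v (a z) (b z) \<noteq> 0" if "z \<in> ball 0 \<rho>" for z
  proof
    assume "1 + cN v (a z) (b z) = 0"
    then have "z\<^sup>2 = - of_real (1 + 16 / r\<^sup>2)" using r by (simp add: N field_simps) (simp add: algebra_simps add_eq_0_iff)
    then have "(cmod z)\<^sup>2 = 1 + 16 / r\<^sup>2"
      by (metis norm_power norm_minus_cancel norm_of_real abs_of_nonneg add_nonneg_nonneg zero_le_one divide_nonneg_nonneg zero_le_numeral zero_le_power2)
    then have "cmod z = \<rho>" unfolding \<rho>_def by (metis norm_ge_zero real_sqrt_unique)
    then show False using that by simp
  qed
  define k where "k z = cay v (a z) (b z)" for z
  have kS: "k z \<in> Sp" if "z \<in> ball 0 \<rho>" for z unfolding k_def using cay_Sp N0[OF that] by blast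
  have kM: "act (k z) q \<in> LagSplit" if "z \<in> ball 0 \<rho>" "q \<in> Mc" for z q
    using act_in_LagSplit[OF kS[OF that(1)]] that(2) Mc_LagSplit by blast
  have CDw: "CDiff (\<lambda>z. cw v (s * a z) (s * b z)) z" for z s
    unfolding cw_def a_def b_def
    by (rule CDiff_add; rule CDiff_csc; auto intro!: derivative_eq_intros CDiff_const)
  \<comment> \<open>The signs \<open>s = 1\<close> and \<open>s = - 1\<close> treat \<open>k\<close>
    and its inverse \<open>star k\<close> together.\<close>
  have CDc: "CDiff (\<lambda>z. cay v (s * a z) (s * b z)) z" if z: "z \<in> ball 0 \<rho>" and s: "s * s = 1" for z s
  proof -
    have e: "cN v (s * a z) (s * b z) = cN v (a z) (b z)" for z
      using s by (simp add: cN_def)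
    have "\<exists>D. ((\<lambda>z. 2 / (1 + cN v (a z) (b z))) has_field_derivative D) (at z)"
      using N0[OF z] unfolding N by (intro exI) (auto intro!: derivative_eq_intros)
    then obtain D where D: "((\<lambda>z. 2 / (1 + cN v (a z) (b z))) has_field_derivative D) (at z)" by blast
    show ?thesis unfolding cay_def e
      by (intro CDiff_add CDiff_const CDiff_csc[OF D] CDiff_mul CDw)
  qed
  have CDk: "CDiff k z" "CDiff (\<lambda>z. star (k z)) z" if z: "z \<in> ball 0 \<rho>" for z
    using CDc[OF z, of 1] CDc[OF z, of "-1"] by (simp_all add: k_def[abs_def] star_cay)
  have hol: "(\<lambda>z. Ic (\<lambda>q. h (act (k z) q))) holomorphic_on ball 0 \<rho>"
  proof (rule holomorphic_Ic)
    fix q :: "'n spmat" assume q: "q \<in> Mc"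
    show "(\<lambda>z. h (act (k z) q)) holomorphic_on ball 0 \<rho>"
    proof (rule HolM_holomorphic[OF h])
      fix z :: complex assume z: "z \<in> ball 0 \<rho>"
      show "act (k z) q \<in> LagSplit" using kM[OF z q] .
      show "CDiff (\<lambda>z. act (k z) q) z" unfolding act_def by (intro CDiff_mul CDiff_const CDk z)
    qed simp
  next
    show "continuous_on (ball 0 \<rho> \<times> Mc) (\<lambda>(z, q). h (act (k z) q))"
    proof -
      have kc: "continuous_on (ball 0 \<rho>) k"
      proof (rule continuous_at_imp_continuous_on, rule ballI)
        fix z :: complex assume "z \<in> ball 0 \<rho>"
        then obtain d where "(k has_derivative (\<lambda>s. csc s d)) (at z)" using CDk(1) unfolding CDiff_def by blast
        then show "isCont k z" by (rule has_derivative_continuous)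
      qed
      have "continuous_on (ball 0 \<rho> \<times> (Mc :: 'n spmat set)) (\<lambda>x. act (k (fst x)) (snd x))"
        by (intro continuous_intros continuous_on_compose2[OF kc]) auto
      then have "continuous_on (ball 0 \<rho> \<times> (Mc :: 'n spmat set)) (\<lambda>x. h (act (k (fst x)) (snd x)))"
        by (rule continuous_on_compose2[OF HolM_continuous[OF h]])
           (use kM in auto)
      then show ?thesis by (simp add: case_prod_beta')
    qed
  qed simp
  have hc: "continuous_on Mc h" using HolM_continuous[OF h] Mc_LagSplit continuous_on_subset by blast
  \<comment> \<open>The difference is holomorphic on the disc and vanishes on a real interval
    accumulating at 0, hence also at \<open>- \<i>\<close>.\<close>
  have "Ic (\<lambda>q. h (act (k (- \<i>)) q)) - Ic h = 0"
  proof (rule analytic_continuation[of "\<lambda>z. Ic (\<lambda>q. h (act (k z) q)) - Ic h" "ball 0 \<rho>" "complex_of_real ` {0<..<1}" 0])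
    show "(\<lambda>z. Ic (\<lambda>q. h (act (k z) q)) - Ic h) holomorphic_on ball 0 \<rho>"
      by (intro holomorphic_intros hol)
    show "complex_of_real ` {0<..<1} \<subseteq> ball 0 \<rho>" using \<rho> by auto
    show "(0::complex) islimpt complex_of_real ` {0<..<1}"
    proof (rule islimptI)
      fix T :: "complex set" assume "0 \<in> T" "open T"
      then obtain e where e: "e > 0" "ball 0 e \<subseteq> T" using open_contains_ball by blast
      let ?y = "complex_of_real (min e 1 / 2)"
      have "?y \<in> T" using e by (auto simp: subset_iff min_def)
      moreover have "?y \<in> complex_of_real ` {0<..<1}" using e by (intro imageI) (auto simp: min_def)
      moreover have "?y \<noteq> 0" using e by (auto simp: min_def)
      ultimately show "\<exists>y\<in>complex_of_real ` {0<..<1}. y \<in> T \<and> y \<noteq> 0" by blast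
    qed
    show "Ic (\<lambda>q. h (act (k z) q)) - Ic h = 0" if "z \<in> complex_of_real ` {0<..<1}" for z
    proof -
      have "b z = cnj (a z)" using that by (auto simp: a_def b_def)
      then have "k z \<in> Ksp" using cay_Ksp by (simp add: k_def)
      then show ?thesis using Ic_Ksp hc by simp
    qed
  qed (use \<rho> in auto)
  moreover have "k (- \<i>) = transv v 1"
    by (simp add: k_def a_def b_def cay_transvection)
  ultimately show ?thesis by simp
qed

text \<open>Each transvection is moved from the point into the function, which stays in
  \<open>HolM\<close>; hence the induction over arbitrary \<open>h\<close>.\<close>

lemma Ic_Tg: "g \<in> Tg \<Longrightarrow> HolM h \<Longrightarrow> Ic (\<lambda>q. h (act g q)) = Ic h"
proof (induction arbitrary: h rule: Tg.induct)
  case (step g v s)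
  have "HolM (\<lambda>A. h (act (transv v s) A))"
    by (rule HolM_act[OF step.prems transv_Sp])
  from step.IH[OF this]
  have 1: "Ic (\<lambda>q. h (act (transv v s) (act g q))) = Ic (\<lambda>q. h (act (transv v s) q))" .
  have 2: "Ic (\<lambda>q. h (act (transv v s) q)) = Ic h"
    using Ic_transvection[OF step.prems, of "csc (csqrt s) v"] unfolding transv_csqrt[of v s, symmetric] .
  show ?case using 1 2 unfolding act_act by simp
qed simp

lemma Ic_Tg_Ksp:
  assumes "g \<in> Tg" "k \<in> Ksp" "HolM h"
  shows "Ic (\<lambda>q. h (act (g \<cdot> k) q)) = Ic h"
proof -
  have "continuous_on Mc (\<lambda>q. h (act g q))"
    by (rule continuous_on_subset[OF HolM_continuous[OF HolM_act[OF assms(3) Tg_Sp[OF assms(1)]]] Mc_LagSplit])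
  from Ic_Ksp[OF assms(2) this] show ?thesis
    using Ic_Tg[OF assms(1,3)] by (simp add: act_act)
qed

section \<open>Polynomial approximation\<close>

text \<open>An affine function of \<open>tr (p \<cdot> q)\<close>, scaled so that for
  \<open>p = sp_D\<close> its values on \<open>Mc\<close> lie between 0 and 1, with 1 attained only
  at \<open>sp_D\<close>.\<close>

definition trker :: "'n::finite spmat \<Rightarrow> 'n spmat \<Rightarrow> complex" where
  "trker p q = (tr (p \<cdot> q) + of_nat (2 * CARD('n))) / of_nat (4 * CARD('n))"

lemma trker_expand: "trker p q = (\<Sum>ij\<in>UNIV. p $ ij * (q $ (snd ij, fst ij) / of_nat (4 * CARD('n)))) + 1/2"
  for p :: "'n::finite spmat"
proof -
  have "tr (p \<cdot> q) = (\<Sum>ij\<in>UNIV. p $ ij * q $ (snd ij, fst ij))"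
    unfolding tr_def sp_mul_def
    by (simp add: sum.cartesian_product UNIV_Times_UNIV case_prod_beta')
  then show ?thesis
    by (simp add: trker_def add_divide_distrib sum_divide_distrib)
qed

lemma continuous_on_trker: "continuous_on S (trker p)"
  unfolding trker_def by (intro continuous_intros) simp_all

lemma Pol_trker: "trker p \<in> Pol"
proof -
  have "(\<lambda>q. (\<Sum>ij\<in>UNIV. p $ ij * (q $ (snd ij, fst ij) * (1 / of_nat (4 * CARD('a))))) + 1/2) \<in> Pol"
    by (intro Pol.add Pol_sum Pol.mult Pol.const Pol.coord)
  then show ?thesis unfolding trker_expand[of p, abs_def] by simp
qed

lemma trker_act: "g \<in> Sp \<Longrightarrow> trker (act g p) (act g q) = trker p q"
  by (simp add: trker_def tr_act)

text \<open>One factor of the kernel is affine in the entries of \<open>p\<close>; its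
  \<open>q\<close>-dependent coefficients are absorbed into \<open>f\<close>, so the induction needs
  arbitrary continuous \<open>f\<close>.\<close>

lemma Pol_kernel:
  fixes f :: "'n::finite spmat \<Rightarrow> complex"
  assumes "continuous_on Mc f"
  shows "(\<lambda>p. Ic (\<lambda>q. trker p q ^ N * f q)) \<in> Pol"
  using assms
proof (induction N arbitrary: f)
  case 0
  then show ?case by (simp add: Pol.const)
next
  case (Suc N)
  let ?m = "of_nat (4 * CARD('n)) :: complex"
  define F where "F ij q = q $ (snd ij, fst ij) / ?m * f q" for ij and q :: "'n spmat"
  have cn: "continuous_on Mc (\<lambda>q :: 'n spmat. q $ i)" for i
    using bounded_linear.continuous_on[OF bounded_linear_vec_nth continuous_on_id] .
  have Fc: "continuous_on Mc (F ij)" for ij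
    unfolding F_def by (rule continuous_on_mult[OF continuous_on_divide[OF cn continuous_on_const] Suc.prems]) simp
  have bc: "continuous_on Mc (\<lambda>q. trker p q ^ N * g q)" if "continuous_on Mc g" for g and p :: "'n spmat"
    by (rule continuous_on_mult[OF continuous_on_power[OF continuous_on_trker] that])
  have cc: "continuous_on Mc (\<lambda>q. c * g q)" if "continuous_on Mc g" for c and g :: "'n spmat \<Rightarrow> complex"
    by (rule continuous_on_mult[OF continuous_on_const that])
  have e: "Ic (\<lambda>q. trker p q ^ Suc N * f q) =
      (\<Sum>ij\<in>UNIV. p $ ij * Ic (\<lambda>q. trker p q ^ N * F ij q)) + 1/2 * Ic (\<lambda>q. trker p q ^ N * f q)" for p
  proof -
    have "trker p q ^ Suc N * f q = (\<Sum>ij\<in>UNIV. p $ ij * (trker p q ^ N * F ij q)) + 1/2 * (trker p q ^ N * f q)" for q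
    proof -
      have "trker p q ^ Suc N * f q = trker p q * (trker p q ^ N * f q)" by (simp add: mult_ac)
      also have "\<dots> = ((\<Sum>ij\<in>UNIV. p $ ij * (q $ (snd ij, fst ij) / ?m)) + 1/2) * (trker p q ^ N * f q)"
        by (subst trker_expand) (rule refl)
      also have "\<dots> = (\<Sum>ij\<in>UNIV. p $ ij * (trker p q ^ N * F ij q)) + 1/2 * (trker p q ^ N * f q)"
        unfolding distrib_right sum_distrib_right F_def by (simp add: mult_ac)
      finally show ?thesis .
    qed
    then have "Ic (\<lambda>q. trker p q ^ Suc N * f q) =
       Ic (\<lambda>q. (\<Sum>ij\<in>UNIV. p $ ij * (trker p q ^ N * F ij q)) + 1/2 * (trker p q ^ N * f q))" by (simp only:)
    also have "\<dots> = Ic (\<lambda>q. \<Sum>ij\<in>UNIV. p $ ij * (trker p q ^ N * F ij q)) + Ic (\<lambda>q. 1/2 * (trker p q ^ N * f q))"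
      by (rule Ic_add[OF continuous_on_sum[OF cc[OF bc[OF Fc]]] cc[OF bc[OF Suc.prems]]])
    also have "Ic (\<lambda>q. \<Sum>ij\<in>UNIV. p $ ij * (trker p q ^ N * F ij q)) = (\<Sum>ij\<in>UNIV. Ic (\<lambda>q. p $ ij * (trker p q ^ N * F ij q)))"
      by (rule Ic_sum[OF cc[OF bc[OF Fc]]])
    also have "\<dots> = (\<Sum>ij\<in>UNIV. p $ ij * Ic (\<lambda>q. trker p q ^ N * F ij q))"
      by (rule sum.cong[OF refl Ic_cmult[OF bc[OF Fc]]])
    also have "Ic (\<lambda>q. 1/2 * (trker p q ^ N * f q)) = 1/2 * Ic (\<lambda>q. trker p q ^ N * f q)"
      by (rule Ic_cmult[OF bc[OF Suc.prems]])
    finally show ?thesis .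
  qed
  have "(\<lambda>p. (\<Sum>ij\<in>UNIV. p $ ij * Ic (\<lambda>q. trker p q ^ N * F ij q)) + 1/2 * Ic (\<lambda>q. trker p q ^ N * f q)) \<in> Pol"
    by (intro Pol.add Pol_sum Pol.mult Pol.const Pol.coord Suc.IH Fc Suc.prems)
  then show ?case by (simp only: e)
qed

definition weight :: "'n::finite spmat \<Rightarrow> real" where
  "weight q = 1 - (norm (q - sp_D))\<^sup>2 / (8 * CARD('n))"

text \<open>For hermitian \<open>q\<close> the trace is the real inner product with
  \<open>sp_D\<close>, and all points of \<open>Mc\<close> have the same norm, so the kernel is a
  function of the distance to \<open>sp_D\<close>.\<close>

lemma trker_D:
  fixes q :: "'n::finite spmat"
  assumes q: "q \<in> Mc"
  shows "trker sp_D q = of_real (weight q)" "0 \<le> weight q" "weight q \<le> 1"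
proof -
  let ?m = "real CARD('n)"
  have c: "?m > 0" by simp
  have "cnj (tr X) = tr (adj X)" for X :: "'n spmat" by (simp add: tr_def adj_def)
  then have "cnj (tr (sp_D \<cdot> q)) = tr (sp_D \<cdot> q)"
    using q tr_commute[of q sp_D] by (simp add: adj_lin adj_D Mc_def)
  then have t: "tr (sp_D \<cdot> q) = of_real (inner sp_D q)"
    by (simp add: inner_tr adj_D complex_eq_iff)
  have n: "(norm (q - sp_D))\<^sup>2 = 4 * ?m - 2 * inner sp_D q"
  proof -
    have "(norm (q - sp_D))\<^sup>2 = (norm q)\<^sup>2 + (norm (sp_D :: 'n spmat))\<^sup>2 - 2 * inner sp_D q"
      by (simp add: power2_norm_eq_inner inner_diff_left inner_diff_right inner_commute)
    then show ?thesis by (simp add: norm_Mc q D_in_Mc)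
  qed
  have w: "weight q = (inner sp_D q + 2 * ?m) / (4 * ?m)"
    unfolding weight_def n using c by (simp add: field_simps)
  show "trker sp_D q = of_real (weight q)" unfolding trker_def t w by simp
  have "\<bar>inner sp_D q\<bar> \<le> norm (sp_D :: 'n spmat) * norm q" by (rule Cauchy_Schwarz_ineq2)
  then have "- (2 * ?m) \<le> inner sp_D q" by (simp add: norm_Mc q D_in_Mc)
  then show "0 \<le> weight q" unfolding w by simp
  show "weight q \<le> 1" by (simp add: weight_def)
qed

lemma continuous_on_weight: "continuous_on S weight"
  unfolding weight_def by (intro continuous_intros) simp_all

definition mass :: "'n::finite itself \<Rightarrow> nat \<Rightarrow> real" where
  "mass t N = (\<integral>q. (if q \<in> Mc then weight q ^ N else 0) \<partial>(mu :: 'n spmat measure))"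

lemma real_Ic_integrable:
  fixes h :: "'n::finite spmat \<Rightarrow> real"
  assumes h: "continuous_on Mc h"
  shows "integrable mu (\<lambda>q. if q \<in> Mc then h q else 0)"
proof -
  have "integrable mu (\<lambda>q. Re (if q \<in> Mc then complex_of_real (h q) else 0))"
    using h by (intro integrable_Re Ic_integrable continuous_intros)
  moreover have "(\<lambda>q. Re (if q \<in> Mc then complex_of_real (h q) else 0)) = (\<lambda>q. if q \<in> Mc then h q else 0)"
    by auto
  ultimately show ?thesis by simp
qed

lemma Ic_trker: "Ic (\<lambda>q. trker (sp_D :: 'n::finite spmat) q ^ N) = of_real (mass TYPE('n) N)"
proof -
  have "Ic (\<lambda>q. trker (sp_D :: 'n spmat) q ^ N) = (\<integral>q. complex_of_real (if q \<in> Mc then weight q ^ N else 0) \<partial>(mu :: 'n spmat measure))"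
    unfolding Ic_def by (intro Bochner_Integration.integral_cong) (auto simp: trker_D)
  then show ?thesis by (simp only: integral_complex_of_real mass_def)
qed

lemma mass_lower:
  fixes d :: real
  assumes d: "0 < d" "d\<^sup>2 \<le> 8 * CARD('n)"
  shows "(1 - d\<^sup>2 / (8 * CARD('n))) ^ N * measure mu (ball sp_D d :: 'n::finite spmat set) \<le> mass TYPE('n) N"
proof -
  interpret finite_measure "mu :: 'n spmat measure" by (rule finite_measure_mu)
  let ?c = "(1 - d\<^sup>2 / (8 * CARD('n))) ^ N"
  have "?c * measure mu (ball sp_D d :: 'n spmat set) = (\<integral>q. ?c * indicator (ball sp_D d) q \<partial>(mu :: 'n spmat measure))"
    by simp
  also have "\<dots> \<le> mass TYPE('n) N"
    unfolding mass_def
  proof (rule integral_mono_AE)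
    show "integrable mu (\<lambda>q :: 'n spmat. ?c * indicator (ball sp_D d) q)"
      by (intro integrable_mult_right integrable_real_indicator) (auto simp: emeasure_eq_measure)
    show "integrable mu (\<lambda>q :: 'n spmat. if q \<in> Mc then weight q ^ N else 0)"
      by (intro real_Ic_integrable continuous_on_power continuous_on_weight)
    show "AE q in (mu :: 'n spmat measure). ?c * indicator (ball sp_D d) q \<le> (if q \<in> Mc then weight q ^ N else 0)"
      using AE_mu_Mc
    proof eventually_elim
      fix q :: "'n spmat" assume q: "q \<in> Mc"
      have "?c \<le> weight q ^ N" if "q \<in> ball sp_D d"
      proof (rule power_mono)
        have "(norm (q - sp_D))\<^sup>2 \<le> d\<^sup>2"
          using that by (intro power_mono) (auto simp: dist_norm norm_minus_commute)
        then show "1 - d\<^sup>2 / (8 * CARD('n)) \<le> weight q"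
          unfolding weight_def by (simp add: divide_right_mono)
        show "0 \<le> 1 - d\<^sup>2 / real (8 * CARD('n))" using d(2) by simp
      qed
      then show "?c * indicator (ball sp_D d) q \<le> (if q \<in> Mc then weight q ^ N else 0)"
        using q trker_D(2)[OF q] by (auto simp: indicator_def)
    qed
  qed
  finally show ?thesis .
qed

text \<open>Within distance \<open>d\<close> of \<open>sp_D\<close> the oscillation bound
  \<open>e\<close> is used; farther away the weight is at most
  \<open>1 - d\<^sup>2 / (8 * CARD('n))\<close>, and \<open>F\<close> contributes at most
  \<open>2 * B\<close>.\<close>

lemma kernel_average:
  fixes F :: "'n::finite spmat \<Rightarrow> complex" and d e :: real
  assumes F: "continuous_on Mc F" and B: "\<And>q. q \<in> Mc \<Longrightarrow> cmod (F q) \<le> B"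
    and d: "0 < d" "d\<^sup>2 \<le> 8 * CARD('n)" and e: "\<And>q. q \<in> Mc \<Longrightarrow> norm (q - sp_D) < d \<Longrightarrow> cmod (F q - F sp_D) \<le> e"
  shows "cmod (Ic (\<lambda>q. trker sp_D q ^ N * F q) - of_real (mass TYPE('n) N) * F sp_D) \<le>
      e * mass TYPE('n) N + 2 * B * (1 - d\<^sup>2 / (8 * CARD('n))) ^ N * measure mu (UNIV :: 'n spmat set)"
proof -
  interpret finite_measure "mu :: 'n spmat measure" by (rule finite_measure_mu)
  let ?c = "(1 - d\<^sup>2 / (8 * CARD('n))) ^ N"
  have B0: "0 \<le> B" using B[OF D_in_Mc] norm_ge_zero order_trans by blast
  have e0: "0 \<le> e" using e[OF D_in_Mc] d(1) by simp
  have c0: "0 \<le> ?c" using d(2) by (intro zero_le_power) simp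
  have bc: "continuous_on Mc (\<lambda>q :: 'n spmat. trker sp_D q ^ N)" by (intro continuous_on_power continuous_on_trker)
  have "Ic (\<lambda>q. trker sp_D q ^ N * F q) - of_real (mass TYPE('n) N) * F sp_D =
      Ic (\<lambda>q. trker sp_D q ^ N * F q) - Ic (\<lambda>q :: 'n spmat. F sp_D * trker sp_D q ^ N)"
    by (simp add: Ic_cmult[OF bc] Ic_trker)
  also have "\<dots> = Ic (\<lambda>q. trker sp_D q ^ N * F q - F sp_D * trker sp_D q ^ N)"
    by (rule Ic_diff[symmetric]) (intro continuous_on_mult bc F continuous_on_const)+
  also have "\<dots> = Ic (\<lambda>q. trker sp_D q ^ N * (F q - F sp_D))"
    by (rule Ic_cong) (simp add: algebra_simps)
  finally have "cmod (Ic (\<lambda>q. trker sp_D q ^ N * F q) - of_real (mass TYPE('n) N) * F sp_D) =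
     cmod (Ic (\<lambda>q. trker sp_D q ^ N * (F q - F sp_D)))" by simp
  also have "\<dots> \<le> (\<integral>q. e * (if q \<in> Mc then weight q ^ N else 0) + 2 * B * ?c \<partial>(mu :: 'n spmat measure))"
    unfolding Ic_def
  proof (rule Bochner_Integration.integral_norm_bound_integral)
    show "integrable mu (\<lambda>q. if q \<in> Mc then trker sp_D q ^ N * (F q - F sp_D) else 0)"
      by (intro Ic_integrable continuous_on_mult bc continuous_on_diff F continuous_on_const)
    show "integrable mu (\<lambda>q :: 'n spmat. e * (if q \<in> Mc then weight q ^ N else 0) + 2 * B * ?c)"
      by (rule Bochner_Integration.integrable_add[OF integrable_mult_right[OF real_Ic_integrable[OF continuous_on_power[OF continuous_on_weight]]] integrable_const])
    fix q :: "'n spmat"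
    show "cmod (if q \<in> Mc then trker sp_D q ^ N * (F q - F sp_D) else 0) \<le> e * (if q \<in> Mc then weight q ^ N else 0) + 2 * B * ?c"
    proof (cases "q \<in> Mc")
      case True
      have n: "cmod (trker sp_D q ^ N * (F q - F sp_D)) = weight q ^ N * cmod (F q - F sp_D)"
        using trker_D[OF True] by (simp add: norm_mult norm_power)
      have w0: "0 \<le> weight q ^ N" using trker_D(2)[OF True] by simp
      show ?thesis
      proof (cases "norm (q - sp_D) < d")
        case near: True
        have "weight q ^ N * cmod (F q - F sp_D) \<le> weight q ^ N * e"
          using w0 e[OF True near] by (intro mult_left_mono)
        also have "\<dots> \<le> e * weight q ^ N + 2 * B * ?c" using B0 c0 by (simp add: mult.commute)
        finally show ?thesis using True n by simp
      next
        case False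
        have "weight q ^ N \<le> ?c"
        proof (rule power_mono)
          have "d\<^sup>2 \<le> (norm (q - sp_D))\<^sup>2" using False d(1) by (intro power_mono) auto
          then show "weight q \<le> 1 - d\<^sup>2 / (8 * CARD('n))"
            unfolding weight_def by (simp add: divide_right_mono)
        qed (rule trker_D(2)[OF True])
        moreover have "cmod (F q - F sp_D) \<le> 2 * B"
          using norm_triangle_ineq4[of "F q" "F sp_D"] B[OF True] B[OF D_in_Mc] by linarith
        ultimately have "weight q ^ N * cmod (F q - F sp_D) \<le> ?c * (2 * B)"
          using c0 by (intro mult_mono) auto
        also have "\<dots> \<le> e * weight q ^ N + 2 * B * ?c" using e0 w0 by (simp add: mult_ac)
        finally show ?thesis using True n by simp
      qed
    qed (use B0 c0 in simp)
  qed
  also have "\<dots> = e * mass TYPE('n) N + 2 * B * ?c * measure mu (UNIV :: 'n spmat set)"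
  proof -
    have "integrable (mu :: 'n spmat measure) (\<lambda>q. e * (if q \<in> Mc then weight q ^ N else 0))"
      by (intro integrable_mult_right real_Ic_integrable continuous_on_power continuous_on_weight)
    then show ?thesis unfolding mass_def by (subst Bochner_Integration.integral_add) auto
  qed
  finally show ?thesis .
qed

text \<open>Once the peak has been moved to \<open>sp_D\<close>, the functions to be averaged are
  \<open>q \<mapsto> f (act h q)\<close> with \<open>h\<close> in a fixed compact set
  \<open>G\<close>; their bounds and moduli of continuity are therefore uniform.\<close>

theorem HolM_approx:
  fixes f :: "'n::finite spmat \<Rightarrow> complex"
  assumes f: "HolM f" and K: "compact K" "K \<subseteq> LagSplit" and eps: "\<epsilon> > 0"
  shows "\<exists>P\<in>Pol. \<forall>p\<in>K. cmod (P p - f p) < \<epsilon>"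
proof -
  obtain R where R: "\<And>p. p \<in> K \<Longrightarrow> norm p \<le> R"
    using compact_imp_bounded[OF K(1)] unfolding bounded_iff by blast
  \<comment> \<open>The bound of \<open>LagSplit'_reach\<close> for the unipotent factor times the
    constant norm of elements of \<open>Ksp\<close>.\<close>
  define C where "C = (norm (sp_id :: 'n spmat) + sqrt (2 * CARD('n)) + R) * sqrt (2 * CARD('n))"
  define G where "G = (Sp :: 'n spmat set) \<inter> cball 0 C"
  have Gc: "compact G" unfolding G_def using closed_Sp by (intro closed_Int_compact compact_cball)
  have fc: "continuous_on LagSplit f" using HolM_continuous[OF f] .
  have cont: "continuous_on (G \<times> Mc) (\<lambda>x. f (act (fst x) (snd x)))"
  proof (rule continuous_on_compose2[OF fc])
    show "continuous_on (G \<times> Mc) (\<lambda>x. act (fst x) (snd x))" by (intro continuous_intros)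
    show "(\<lambda>x. act (fst x) (snd x)) ` (G \<times> Mc) \<subseteq> LagSplit"
      using act_in_LagSplit Mc_LagSplit unfolding G_def by fastforce
  qed
  have cpt: "compact (G \<times> (Mc :: 'n spmat set))" by (intro compact_Times Gc compact_Mc)
  obtain B where B: "\<And>g q. g \<in> G \<Longrightarrow> q \<in> Mc \<Longrightarrow> cmod (f (act g q)) \<le> B" "B \<ge> 0"
  proof -
    have "bounded ((\<lambda>x. f (act (fst x) (snd x))) ` (G \<times> Mc))"
      by (intro compact_imp_bounded compact_continuous_image cont cpt)
    then obtain B where "\<And>g q. g \<in> G \<Longrightarrow> q \<in> Mc \<Longrightarrow> cmod (f (act g q)) \<le> B"
      unfolding bounded_iff by fastforce
    then show ?thesis using that[of "max B 0"] by (meson max.cobounded1 max.cobounded2 order_trans)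
  qed
  obtain d0 where d0: "d0 > 0" "\<And>g q. g \<in> G \<Longrightarrow> q \<in> Mc \<Longrightarrow> norm (q - sp_D) < d0 \<Longrightarrow>
      cmod (f (act g q) - f (act g sp_D)) < \<epsilon> / 2"
  proof -
    have "uniformly_continuous_on (G \<times> Mc) (\<lambda>x. f (act (fst x) (snd x)))"
      by (rule compact_uniformly_continuous[OF cont cpt])
    then obtain d where d: "d > 0" "\<And>x x'. x \<in> G \<times> Mc \<Longrightarrow> x' \<in> G \<times> Mc \<Longrightarrow> dist x' x < d \<Longrightarrow>
       dist (f (act (fst x') (snd x'))) (f (act (fst x) (snd x))) < \<epsilon> / 2"
      unfolding uniformly_continuous_on_def using eps by (metis half_gt_zero)
    show ?thesis
    proof (rule that[OF d(1)])
      fix g q :: "'n spmat" assume "g \<in> G" "q \<in> Mc" "norm (q - sp_D) < d"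
      then show "cmod (f (act g q) - f (act g sp_D)) < \<epsilon> / 2"
        using d(2)[of "(g, sp_D)" "(g, q)"] D_in_Mc by (simp add: dist_Pair_Pair dist_norm)
    qed
  qed
  define d where "d = min d0 1"
  have d: "d > 0" "d \<le> d0" "d \<le> 1" using d0(1) by (auto simp: d_def)
  have m1: "1 \<le> real CARD('n)" by (simp add: Suc_leI)
  have d2: "d\<^sup>2 \<le> 1" using d by (simp add: power_le_one)
  have dm: "d\<^sup>2 \<le> 8 * CARD('n)" "(d/2)\<^sup>2 \<le> 8 * CARD('n)"
  proof -
    show "d\<^sup>2 \<le> 8 * CARD('n)" unfolding of_nat_mult of_nat_numeral using d2 m1 by linarith
    moreover have "(d/2)\<^sup>2 \<le> d\<^sup>2" using d(1) by (intro power_mono) auto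
    ultimately show "(d/2)\<^sup>2 \<le> 8 * CARD('n)" by linarith
  qed
  \<comment> \<open>Two radii are compared: outside radius \<open>d\<close> the kernel is at most
    \<open>a ^ N\<close>, while the total mass is at least \<open>b ^ N * \<mu>0\<close>, from the
    ball of radius \<open>d/2\<close>. As \<open>a < b\<close>, the normalised tail tends to
    0.\<close>
  define a where "a = 1 - d\<^sup>2 / (8 * CARD('n))"
  define b where "b = 1 - (d/2)\<^sup>2 / (8 * CARD('n))"
  have ab: "0 \<le> a" "a < b" using dm d(1) m1 by (simp_all add: a_def b_def power_divide field_simps)
  define \<mu>0 where "\<mu>0 = measure mu (ball sp_D (d/2) :: 'n spmat set)"
  have \<mu>0: "\<mu>0 > 0" unfolding \<mu>0_def using d(1) by (intro measure_mu_pos) simp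
  define \<mu>1 where "\<mu>1 = measure mu (UNIV :: 'n spmat set)"
  have \<mu>1: "\<mu>1 \<ge> 0" by (simp add: \<mu>1_def)
  have "(\<lambda>N. 2 * B * \<mu>1 / \<mu>0 * (a / b) ^ N) \<longlonglongrightarrow> 2 * B * \<mu>1 / \<mu>0 * 0"
    using ab by (intro tendsto_mult_left LIMSEQ_power_zero) simp
  then have "\<forall>\<^sub>F N in sequentially. 2 * B * \<mu>1 / \<mu>0 * (a / b) ^ N < \<epsilon> / 2"
    using eps by (intro order_tendstoD(2)) auto
  then obtain N where N: "2 * B * \<mu>1 / \<mu>0 * (a / b) ^ N < \<epsilon> / 2"
    by (auto simp: eventually_sequentially)
  define c where "c = mass TYPE('n) N"
  have cl: "b ^ N * \<mu>0 \<le> c"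
    using mass_lower[where 'n='n, of "d/2" N] d(1) dm by (simp add: b_def \<mu>0_def c_def)
  have b0: "b ^ N > 0" using ab by simp
  have c0: "c > 0" using cl b0 \<mu>0 by (metis less_le_trans mult_pos_pos)
  define P where "P p = (1 / of_real c) * Ic (\<lambda>q. trker p q ^ N * f q)" for p
  have fM: "continuous_on Mc f" using fc Mc_LagSplit continuous_on_subset by blast
  have "P \<in> Pol" unfolding P_def by (intro Pol.mult Pol.const Pol_kernel fM)
  moreover have "cmod (P p - f p) < \<epsilon>" if p: "p \<in> K" for p
  proof -
    have "p \<in> LagSplit'" using K(2) p LagSplit_subset by blast
    then obtain g k where gk: "g \<in> Tg" "k \<in> Ksp" "p = act (g \<cdot> k) sp_D"
      and ng: "norm g \<le> norm (sp_id :: 'n spmat) + sqrt (2 * CARD('n)) + norm p"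
      using LagSplit'_reach by blast
    define h where "h = g \<cdot> k"
    have hp: "act h sp_D = p" by (simp add: h_def gk(3))
    have hS: "h \<in> Sp" using Sp_mul[OF Tg_Sp[OF gk(1)]] gk(2) by (simp add: h_def Ksp_def)
    have "norm h \<le> norm g * norm k" unfolding h_def by (rule norm_sp_mul)
    also have "\<dots> \<le> C" unfolding C_def norm_Ksp[OF gk(2)]
      using ng R[OF p] by (intro mult_right_mono) auto
    finally have hG: "h \<in> G" using hS by (simp add: G_def)
    \<comment> \<open>The whole integrand is holomorphic in \<open>q\<close>, so the complex group
      may act on it; invariance of \<open>trker\<close> then replaces \<open>p\<close> by
      \<open>sp_D\<close> in the kernel.\<close>
    have "HolM (\<lambda>q. trker p q ^ N * f q)"
      by (rule HolM_mult[OF HolM_Pol[OF Pol_power[OF Pol_trker]] f])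
    from Ic_Tg_Ksp[OF gk(1,2) this]
    have "Ic (\<lambda>q. trker p q ^ N * f q) = Ic (\<lambda>q. trker (act h sp_D) (act h q) ^ N * f (act h q))"
      by (simp add: h_def gk(3))
    then have I: "Ic (\<lambda>q. trker p q ^ N * f q) = Ic (\<lambda>q. trker sp_D q ^ N * f (act h q))"
      by (simp add: trker_act[OF hS])
    have hc: "continuous_on Mc (\<lambda>q. f (act h q))"
      by (rule continuous_on_subset[OF HolM_continuous[OF HolM_act[OF f hS]] Mc_LagSplit])
    have "cmod (Ic (\<lambda>q. trker sp_D q ^ N * f (act h q)) - of_real c * f (act h sp_D)) \<le>
        \<epsilon> / 2 * c + 2 * B * a ^ N * \<mu>1"
      unfolding c_def a_def \<mu>1_def
    proof (rule kernel_average[OF hc _ d(1) dm(1)])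
      fix q :: "'n spmat" assume q: "q \<in> Mc"
      show "cmod (f (act h q)) \<le> B" by (rule B(1)[OF hG q])
      show "cmod (f (act h q) - f (act h sp_D)) \<le> \<epsilon> / 2" if "norm (q - sp_D) < d"
        using d0(2)[OF hG q] that d(2) by fastforce
    qed
    also have "\<dots> < \<epsilon> / 2 * c + \<epsilon> / 2 * c"
    proof -
      have "2 * B * a ^ N * \<mu>1 = 2 * B * \<mu>1 / \<mu>0 * (a / b) ^ N * (b ^ N * \<mu>0)"
        using b0 \<mu>0 ab by (simp add: power_divide field_simps)
      also have "\<dots> < \<epsilon> / 2 * (b ^ N * \<mu>0)"
        using N b0 \<mu>0 by (intro mult_strict_right_mono) simp_all
      also have "\<dots> \<le> \<epsilon> / 2 * c" using cl eps by (intro mult_left_mono) auto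
      finally show ?thesis by simp
    qed
    finally have x: "cmod (Ic (\<lambda>q. trker p q ^ N * f q) - of_real c * f p) < \<epsilon> * c"
      by (simp add: I hp)
    have "P p - f p = (Ic (\<lambda>q. trker p q ^ N * f q) - of_real c * f p) / of_real c"
      unfolding P_def using c0 by (simp add: field_simps)
    then have "cmod (P p - f p) = cmod (Ic (\<lambda>q. trker p q ^ N * f q) - of_real c * f p) / c"
      using c0 by (simp add: norm_divide)
    also have "\<dots> < \<epsilon>" using x c0 by (simp add: divide_less_eq)
    finally show ?thesis .
  qed
  ultimately show ?thesis by blast
qed

section \<open>Reduction of vector fields to coefficient functions\<close>

lemma hvf_component_HolM:
  fixes Y :: "'a::finite spmat \<Rightarrow> 'a spmat"
  assumes "hvf LagSplit Y"
  shows "HolM (\<lambda>A. Y A $ i)"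
proof (rule HolM_I)
  fix p :: "'a spmat" assume p: "p \<in> LagSplit"
  have "\<exists>U F. open U \<and> p \<in> U \<and> cholo U F \<and> (\<forall>q\<in>U \<inter> LagSplit. F q = Y q)"
    using assms p unfolding hvf_def by simp
  then obtain U F where U: "open U" "p \<in> U" "cholo U F" "\<forall>q\<in>U \<inter> LagSplit. F q = Y q"
    by (elim exE conjE)
  have "chol1 U (\<lambda>A. F A $ i)"
    unfolding chol1_def
  proof
    fix x assume "x \<in> U"
    then obtain L where L: "(F has_derivative L) (at x)" "\<And>c v. L (csc c v) = csc c (L v)"
      using U(3) unfolding cholo_def by blast
    then show "\<exists>L. ((\<lambda>A. F A $ i) has_derivative L) (at x) \<and> (\<forall>c v. L (csc c v) = c * L v)"
      by (intro exI[of _ "\<lambda>v. L v $ i"]) (simp add: bounded_linear.has_derivative[OF bounded_linear_vec_nth])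
  qed
  then show "\<exists>U F. open U \<and> p \<in> U \<and> chol1 U F \<and> (\<forall>q\<in>U \<inter> LagSplit. F q = Y q $ i)"
    using U by (intro exI[of _ U] exI[of _ "\<lambda>A. F A $ i"]) simp
qed

definition pfield :: "'n::finite + 'n \<Rightarrow> 'n + 'n \<Rightarrow> 'n spmat \<Rightarrow> 'n spmat" where
  "pfield k j A = xf (axis j 1 + axis k 1) A - xf (axis j 1) A - xf (axis k 1) A"

text \<open>The coefficients of \<open>sp_decomp\<close> for the lift
  \<open>Y A \<cdot> A / 2\<close> supplied by \<open>tang_commutator\<close>.\<close>

definition cfun :: "('n::finite spmat \<Rightarrow> 'n spmat) \<Rightarrow> 'n + 'n \<Rightarrow> 'n + 'n \<Rightarrow> 'n spmat \<Rightarrow> complex" where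
  "cfun Y k j A = - mv (csc (1/2) (Y A \<cdot> A)) (dual k) $ j / 2"

lemma pfield_eq: "pfield k j A = (rk (axis j 1) (axis k 1) + rk (axis k 1) (axis j 1)) \<cdot> A
    - A \<cdot> (rk (axis j 1) (axis k 1) + rk (axis k 1) (axis j 1))"
  unfolding rk_polar pfield_def xf_def by (simp add: spm_lin)

text \<open>The lift of the tangent vector is expanded in the Lie algebra, and the commutator with
  \<open>A\<close> is taken term by term.\<close>

lemma tang_expand:
  assumes A: "A \<in> LagSplit" and V: "tang A (Y A)"
  shows "Y A = (\<Sum>k\<in>UNIV. \<Sum>j\<in>UNIV. csc (cfun Y k j A) (pfield k j A))"
proof -
  let ?V = "Y A"
  define X where "X = csc (1/2) (?V \<cdot> A)"
  note X = tang_commutator[OF subsetD[OF LagSplit_subset A] V, folded X_def]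
  let ?r = "\<lambda>k j. rk (axis j 1) (axis k 1) + rk (axis k 1) (axis j 1) :: 'a spmat"
  have Xs: "X = (\<Sum>k\<in>UNIV. \<Sum>j\<in>UNIV. csc (cfun Y k j A) (?r k j))"
    using sp_decomp[OF X(1)] unfolding cfun_def X_def .
  have "?V = (\<Sum>k\<in>UNIV. \<Sum>j\<in>UNIV. csc (cfun Y k j A) (?r k j)) \<cdot> A - A \<cdot> (\<Sum>k\<in>UNIV. \<Sum>j\<in>UNIV. csc (cfun Y k j A) (?r k j))"
    using X(2) unfolding Xs[symmetric] by simp
  also have "\<dots> = (\<Sum>k\<in>UNIV. \<Sum>j\<in>UNIV. csc (cfun Y k j A) (pfield k j A))"
    unfolding sp_mul_sum pfield_eq csc_diff_right sum_subtractf sp_mul_csc_left sp_mul_csc_right ..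
  finally show ?thesis .
qed

lemma HolM_cfun:
  assumes "hvf LagSplit Y"
  shows "HolM (cfun Y k j)"
proof -
  have e: "cfun Y k j = (\<lambda>A. \<Sum>r\<in>UNIV. Y A $ (j, r) * (\<Sum>l\<in>UNIV. A $ (r, l) * dual k $ l) * (- 1 / 4))"
    by (rule ext) (simp add: cfun_def mv_lin, simp add: mv_def sum_divide_distrib sum_negf)
  show ?thesis unfolding e
    by (intro HolM_sum[OF HolM_mult[OF HolM_mult[OF hvf_component_HolM[OF assms] HolM_Pol] HolM_Pol]] Pol_sum Pol.mult Pol.const Pol.coord)
qed

lemma inLie_pfield: "h \<in> Pol \<Longrightarrow> inLie (\<lambda>A. csc (h A) (pfield k j A))"
  unfolding pfield_def csc_diff_right by (intro inLie_diff inLie_Pol_xf)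

lemma inLie_zero: "inLie (\<lambda>A. 0)"
  using inLie_smul[OF inLie_Pol_xf[OF Pol.const[of 0]], of 0] by simp

lemma inLie_sum: "(\<And>i. i \<in> S \<Longrightarrow> inLie (T i)) \<Longrightarrow> inLie (\<lambda>A. \<Sum>i\<in>S. T i A)"
proof (induction S rule: infinite_finite_induct)
  case (insert i S)
  have "inLie (\<lambda>A. T i A + (\<Sum>j\<in>S. T j A))"
    by (rule inLie_add[OF insert.prems insert.IH]) (use insert.prems in auto)
  then show ?case using insert.hyps by simp
qed (simp_all add: inLie_zero)

theorem theorem4p4:
  shows "density_property (LagSplit :: 'n::finite spmat set)"
  unfolding density_property_def
proof (intro allI impI, elim conjE)
  fix Y :: "'n spmat \<Rightarrow> 'n spmat" and K :: "'n spmat set" and \<epsilon> :: real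
  assume Y: "hvf LagSplit Y" and K: "compact K" "K \<subseteq> LagSplit" and eps: "\<epsilon> > 0"
  have gc: "continuous_on K (pfield k j)" for k j
    unfolding pfield_def xf_def by (intro continuous_intros)
  have "\<exists>B. \<forall>A\<in>K. norm (pfield k j A) \<le> B" for k j
    using compact_imp_bounded[OF compact_continuous_image[OF gc K(1)]] unfolding bounded_iff by auto
  then obtain B where B: "\<And>k j A. A \<in> K \<Longrightarrow> norm (pfield k j A) \<le> B k j" by metis
  \<comment> \<open>The summand 1 makes \<open>L\<close> positive and leaves room for the strict
    final inequality.\<close>
  define L where "L = (\<Sum>k\<in>UNIV. \<Sum>j\<in>UNIV. \<bar>B k j\<bar>) + 1"
  have L: "L > 0" unfolding L_def by (intro add_nonneg_pos sum_nonneg) auto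
  have "\<exists>P\<in>Pol. \<forall>p\<in>K. cmod (P p - cfun Y k j p) < \<epsilon> / L" for k j
    using HolM_approx[OF HolM_cfun[OF Y] K] eps L by simp
  then obtain P where P: "\<And>k j. P k j \<in> Pol" "\<And>k j p. p \<in> K \<Longrightarrow> cmod (P k j p - cfun Y k j p) < \<epsilon> / L"
    by metis
  define Z where "Z A = (\<Sum>k\<in>UNIV. \<Sum>j\<in>UNIV. csc (P k j A) (pfield k j A))" for A
  have "inLie Z" unfolding Z_def by (intro inLie_sum inLie_pfield P)
  then have "res Z \<in> Lie_gen LagSplit" by (simp add: inLie_def)
  moreover have "norm (res Z p - Y p) < \<epsilon>" if p: "p \<in> K" for p
  proof -
    have pM: "p \<in> LagSplit" using p K(2) by blast
    then have "tangent_vec LagSplit p (Y p)" using Y by (simp add: hvf_def)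
    then have "tang p (Y p)" by (rule tangent_vec_imp_tang)
    from tang_expand[of p Y, OF pM this] pM have "res Z p - Y p =
        (\<Sum>k\<in>UNIV. \<Sum>j\<in>UNIV. csc (P k j p) (pfield k j p)) - (\<Sum>k\<in>UNIV. \<Sum>j\<in>UNIV. csc (cfun Y k j p) (pfield k j p))"
      by (simp add: res_def Z_def)
    also have "\<dots> = (\<Sum>k\<in>UNIV. \<Sum>j\<in>UNIV. csc (P k j p - cfun Y k j p) (pfield k j p))"
      by (simp add: sum_subtractf csc_diff_left)
    also have "norm \<dots> \<le> (\<Sum>k\<in>UNIV. \<Sum>j\<in>UNIV. \<epsilon> / L * \<bar>B k j\<bar>)"
    proof (intro order_trans[OF norm_sum] sum_mono)
      fix k j
      have "norm (csc (P k j p - cfun Y k j p) (pfield k j p)) = cmod (P k j p - cfun Y k j p) * norm (pfield k j p)"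
        by (rule norm_csc)
      also have "\<dots> \<le> \<epsilon> / L * \<bar>B k j\<bar>"
        using P(2)[OF p, of k j] B[OF p, of k j] eps L by (intro mult_mono) auto
      finally show "norm (csc (P k j p - cfun Y k j p) (pfield k j p)) \<le> \<epsilon> / L * \<bar>B k j\<bar>" .
    qed
    also have "\<dots> = \<epsilon> / L * (L - 1)" by (simp add: L_def sum_distrib_left)
    also have "\<dots> < \<epsilon>" using eps L by (simp add: field_simps)
    finally show ?thesis .
  qed
  ultimately show "\<exists>Z\<in>Lie_gen LagSplit. \<forall>p\<in>K. norm (Z p - Y p) < \<epsilon>" by blast
qed

end
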